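(* Let $\Gamma$ be a countable discrete sofic group with sofic approximation $\Sigma$. Suppose that a probability measure-preserving action $\Gamma\curvearrowright(X,\mu)$ on a standard probability space has completely positive entropy with respect to $\Sigma$. (i) If $\Gamma$ is infinite, then $\Gamma\curvearrowright(X,\mu)$ is mixing. (ii) If $\Lambda$ is any nonamenable subgroup of $\Gamma$, then the restricted action $\Lambda\curvearrowright(X,\mu)$ is strongly ergodic (in fact, it has spectral gap).
   Context: A probability measure-preserving action $G\curvearrowright(X,\mu)$ of a countable discrete group is: mixing if $\lim_{g\to\infty}\mu(gA\cap B)=\mu(A)\mu(B)$ for all measurable $A,B\subseteq X$; strongly ergodic if for every sequence $A_n$ of measurable subsets of $X$ with $\mu(gA_n\Delta A_n)\to0$ for all $g\in G$ one has $\mu(A_n)(1-\mu(A_n))\to0$. It has spectral gap if for every sequence $\xi_n\in L^2(X,\mu)\ominus\mathbb{C}1$ with $\|g\xi_n-\xi_n\|_2\to0$ for all $g\in G$ one has $\|\xi_n\|_2\to0$, where $(g\xi)(x)=\xi(g^{-1}x)$. Sofic approximations. $u_d$ is the uniform probability measure on $\{1,\dots,d\}$ and $S_d$ is the symmetric group. A sofic approximation of a countable discrete group $\Gamma$ is a sequence $\Sigma=(\sigma_i\colon\Gamma\to S_{d_i})$ of functions (not assumed homomorphisms) such that $u_{d_i}(\{k:\sigma_i(g)\sigma_i(h)(k)=\sigma_i(gh)(k)\})\to1$ for all $g,h\in\Gamma$ and $u_{d_i}(\{k:\sigma_i(g)(k)\neq\sigma_i(h)(k)\})\to1$ for all $g\neq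 h$ in $\Gamma$. $\Gamma$ is sofic if it has a sofic approximation. Sofic measure entropy (Bowen, Kerr–Li; in Kerr's formulation). A finite observable on $X$ is a measurable map $\alpha\colon X\to A$ with $A$ finite. A finite observable $\beta\colon X\to B$ refines $\alpha$, written $\alpha\le\beta$, if there is $\pi\colon B\to A$ with $\pi(\beta(x))=\alpha(x)$ for a.e. $x$. For finite $F\subseteq\Gamma$, let $\widetilde{\beta}^{F}\colon X\to B^F$, $\widetilde\beta^F(x)(g)=\beta(g^{-1}x)$. For finite $F\subseteq \Gamma$ containing the identity $e$, $\delta>0$ and $\sigma\colon\Gamma\to S_d$, let $\mathrm{AP}(\beta,F,\delta,\sigma)$ be the set of all $\phi\colon\{1,\dots,d\}\to B^F$ with $$\sum_{b\in B^F}\left|u_d(\phi^{-1}(\{b\}))-\mu((\widetilde\beta^F)^{-1}(\{b\}))\right|<\delta,\qquad u_d(\{j:\phi(j)(g)\neq\phi(\sigma(g)^{-1}(j))(e)\})<\delta\ \text{ for all } g\in F.$$ Let $\pi^*\colon B^F\to A$, $\pi^*(b)=\pi(b(e))$. With $\log 0=-\infty$, put $$h_{\Sigma,\mu}(\alpha;\beta,F,\delta)=\limsup_{i\to\infty}\frac1{d_i}\log\left|\{\pi^*\circ\phi:\phi\in\mathrm{AP}(\beta,F,\delta,\sigma_i)\}\right|,\qquad h_{\Sigma,\mu}(\alpha;\beta)=\inf_{F,\delta}h_{\Sigma,\mu}(\alpha;\beta,F,\delta),$$ and $h_{\Sigma,\mu}(X,\Gamma)=\sup_\alpha\inf_{\beta\ge\alpha}h_{\Sigma,\mu}(\alpha;\beta)$,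 over all finite observables $\alpha$ and finite observables $\beta$ refining $\alpha$. Completely positive entropy. $\Gamma\curvearrowright(X,\mu)$ has completely positive entropy with respect to $\Sigma$ if for every factor $\Gamma\curvearrowright(Y,\nu)$ of $\Gamma\curvearrowright(X,\mu)$ such that $(Y,\nu)$ is not a one-atom space, $h_{\Sigma,\nu}(Y,\Gamma)>0$. *)

theory Defs
  imports
    "HOL-Probability.Probability"
    "HOL-Algebra.Group_Action"
    "HOL-Combinatorics.Permutations"
begin

section \<open>Standard probability spaces and measure-preserving actions\<close>

definition standard_prob_space :: "'a measure \<Rightarrow> bool" where
  "standard_prob_space M \<longleftrightarrow>
     prob_space M \<and>
     (\<exists>T. topspace T = space M \<and> completely_metrizable_space T \<and> second_countable T \<and>
          sets M = sigma_sets (topspace T) {U. openin T U})"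

definition pmp_action ::
    "('g, 'z) monoid_scheme \<Rightarrow> 'a measure \<Rightarrow> ('g \<Rightarrow> 'a \<Rightarrow> 'a) \<Rightarrow> bool" where
  "pmp_action G M act \<longleftrightarrow>
     prob_space M \<and> group_action G (space M) act \<and>
     (\<forall>g\<in>carrier G. act g \<in> measurable M M \<and> distr M M (act g) = M)"

text \<open>
  The limit as \<open>g\<close> tends to infinity in the discrete group is taken along the complements of
  finite subsets of \<open>carrier G\<close>.
\<close>

definition mixing ::
    "('g, 'z) monoid_scheme \<Rightarrow> 'a measure \<Rightarrow> ('g \<Rightarrow> 'a \<Rightarrow> 'a) \<Rightarrow> bool" where
  "mixing G M act \<longleftrightarrow>
     (\<forall>A\<in>sets M. \<forall>B\<in>sets M.
        ((\<lambda>g. measure M (act g ` A \<inter> B)) \<longlongrightarrow> measure M A * measure M B)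
          (inf cofinite (principal (carrier G))))"

definition strongly_ergodic ::
    "('g, 'z) monoid_scheme \<Rightarrow> 'a measure \<Rightarrow> ('g \<Rightarrow> 'a \<Rightarrow> 'a) \<Rightarrow> bool" where
  "strongly_ergodic G M act \<longleftrightarrow>
     (\<forall>A :: nat \<Rightarrow> 'a set.
        (\<forall>n. A n \<in> sets M) \<longrightarrow>
        (\<forall>g\<in>carrier G. (\<lambda>n. measure M (sym_diff (act g ` A n) (A n))) \<longlonglongrightarrow> 0) \<longrightarrow>
        (\<lambda>n. measure M (A n) * (1 - measure M (A n))) \<longlonglongrightarrow> 0)"

definition square_integrable :: "'a measure \<Rightarrow> ('a \<Rightarrow> complex) \<Rightarrow> bool" where
  "square_integrable M \<xi> \<longleftrightarrow>
     \<xi> \<in> borel_measurable M \<and> integrable M (\<lambda>x. (norm (\<xi> x))\<^sup>2)"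

definition l2_norm :: "'a measure \<Rightarrow> ('a \<Rightarrow> complex) \<Rightarrow> real" where
  "l2_norm M \<xi> = sqrt (\<integral>x. (norm (\<xi> x))\<^sup>2 \<partial>M)"

text \<open>
  Vectors of \<open>L\<^sup>2\<close> are represented by functions rather than by classes modulo null sets; all the
  conditions below only depend on the class. Being orthogonal to the constants is having
  integral zero.
\<close>

definition spectral_gap ::
    "('g, 'z) monoid_scheme \<Rightarrow> 'a measure \<Rightarrow> ('g \<Rightarrow> 'a \<Rightarrow> 'a) \<Rightarrow> bool" where
  "spectral_gap G M act \<longleftrightarrow>
     (\<forall>\<xi> :: nat \<Rightarrow> 'a \<Rightarrow> complex.
        (\<forall>n. square_integrable M (\<xi> n) \<and> (\<integral>x. \<xi> n x \<partial>M) = 0) \<longrightarrow>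
        (\<forall>g\<in>carrier G.
           (\<lambda>n. l2_norm M (\<lambda>x. \<xi> n (act (inv\<^bsub>G\<^esub> g) x) - \<xi> n x)) \<longlonglongrightarrow> 0) \<longrightarrow>
        (\<lambda>n. l2_norm M (\<xi> n)) \<longlonglongrightarrow> 0)"

text \<open>
  Equivariance of a factor map is only required almost everywhere.
\<close>

definition factor_of ::
    "('g, 'z) monoid_scheme \<Rightarrow> 'b measure \<Rightarrow> ('g \<Rightarrow> 'b \<Rightarrow> 'b) \<Rightarrow>
     'a measure \<Rightarrow> ('g \<Rightarrow> 'a \<Rightarrow> 'a) \<Rightarrow> bool" where
  "factor_of G N actN M actM \<longleftrightarrow>
     (\<exists>\<pi>\<in>measurable M N. distr M N \<pi> = N \<and>
        (\<forall>g\<in>carrier G. AE x in M. \<pi> (actM g x) = actN g (\<pi> x)))"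

definition one_atom :: "'a measure \<Rightarrow> bool" where
  "one_atom M \<longleftrightarrow> (\<exists>x\<in>space M. measure M {x} = 1)"

section \<open>Amenability\<close>

text \<open>
  Amenability of a discrete group in the sense of von Neumann: there is a finitely additive
  left-invariant probability measure defined on all subsets of the group.
\<close>

definition amenable :: "('g, 'z) monoid_scheme \<Rightarrow> bool" where
  "amenable G \<longleftrightarrow>
     (\<exists>m :: 'g set \<Rightarrow> real.
        m (carrier G) = 1 \<and>
        (\<forall>A. A \<subseteq> carrier G \<longrightarrow> 0 \<le> m A) \<and>
        (\<forall>A B. A \<subseteq> carrier G \<longrightarrow> B \<subseteq> carrier G \<longrightarrow> A \<inter> B = {} \<longrightarrow> m (A \<union> B) = m A + m B) \<and>
        (\<forall>g\<in>carrier G. \<forall>A. A \<subseteq> carrier G \<longrightarrow> m (g <#\<^bsub>G\<^esub> A) = m A))"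

section \<open>Sofic approximations\<close>

text \<open>
  The uniform probability measure on \<open>{1..d}\<close>, extended to all sets of natural numbers by ignoring
  what lies outside \<open>{1..d}\<close>. It is only meaningful for \<open>d > 0\<close>.
\<close>

abbreviation unif :: "nat \<Rightarrow> nat set \<Rightarrow> real" where
  "unif d S \<equiv> measure_pmf.prob (pmf_of_set {1..d}) S"

definition sofic_approximation ::
    "('g, 'z) monoid_scheme \<Rightarrow> (nat \<Rightarrow> nat) \<Rightarrow> (nat \<Rightarrow> 'g \<Rightarrow> nat \<Rightarrow> nat) \<Rightarrow> bool" where
  "sofic_approximation G d \<sigma> \<longleftrightarrow>
     (\<forall>i. d i > 0) \<and>
     (\<forall>i. \<forall>g\<in>carrier G. \<sigma> i g permutes {1..d i}) \<and>
     (\<forall>g\<in>carrier G. \<forall>h\<in>carrier G.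
        (\<lambda>i. unif (d i) {k. \<sigma> i g (\<sigma> i h k) = \<sigma> i (g \<otimes>\<^bsub>G\<^esub> h) k}) \<longlonglongrightarrow> 1) \<and>
     (\<forall>g\<in>carrier G. \<forall>h\<in>carrier G. g \<noteq> h \<longrightarrow>
        (\<lambda>i. unif (d i) {k. \<sigma> i g k \<noteq> \<sigma> i h k}) \<longlonglongrightarrow> 1)"

section \<open>Sofic measure entropy\<close>

text \<open>
  A finite observable is a measurable map into a finite set of labels. Labels are natural numbers,
  which costs no generality as every finite label set can be enumerated.
\<close>

definition finite_observable :: "'a measure \<Rightarrow> nat set \<Rightarrow> ('a \<Rightarrow> nat) \<Rightarrow> bool" where
  "finite_observable M A \<alpha> \<longleftrightarrow> finite A \<and> \<alpha> \<in> measurable M (count_space A)"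

definition refines_via ::
    "'a measure \<Rightarrow> nat set \<Rightarrow> ('a \<Rightarrow> nat) \<Rightarrow> nat set \<Rightarrow> ('a \<Rightarrow> nat) \<Rightarrow> (nat \<Rightarrow> nat) \<Rightarrow> bool" where
  "refines_via M A \<alpha> B \<beta> \<pi> \<longleftrightarrow> \<pi> \<in> B \<rightarrow> A \<and> (AE x in M. \<pi> (\<beta> x) = \<alpha> x)"

definition itinerary ::
    "('g, 'z) monoid_scheme \<Rightarrow> ('g \<Rightarrow> 'a \<Rightarrow> 'a) \<Rightarrow> ('a \<Rightarrow> nat) \<Rightarrow> 'g set \<Rightarrow> 'a \<Rightarrow> 'g \<Rightarrow> nat" where
  "itinerary G act \<beta> F x = (\<lambda>g\<in>F. \<beta> (act (inv\<^bsub>G\<^esub> g) x))"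

text \<open>
  Maps from \<open>{1..d}\<close> to \<open>B\<^sup>F\<close> are extensional functions. Of the permutation \<open>s g\<close> only the
  restriction to \<open>{1..d}\<close> is inverted.
\<close>

definition AP ::
    "('g, 'z) monoid_scheme \<Rightarrow> 'a measure \<Rightarrow> ('g \<Rightarrow> 'a \<Rightarrow> 'a) \<Rightarrow> nat set \<Rightarrow> ('a \<Rightarrow> nat) \<Rightarrow>
     'g set \<Rightarrow> real \<Rightarrow> nat \<Rightarrow> ('g \<Rightarrow> nat \<Rightarrow> nat) \<Rightarrow> (nat \<Rightarrow> 'g \<Rightarrow> nat) set" where
  "AP G M act B \<beta> F \<delta> d s =
     {\<phi> \<in> {1..d} \<rightarrow>\<^sub>E (F \<rightarrow>\<^sub>E B).
        (\<Sum>b \<in> F \<rightarrow>\<^sub>E B.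
           \<bar>unif d (\<phi> -` {b}) - measure M (itinerary G act \<beta> F -` {b} \<inter> space M)\<bar>) < \<delta> \<and>
        (\<forall>g\<in>F. unif d {j. \<phi> j g \<noteq> \<phi> (inv_into {1..d} (s g) j) \<one>\<^bsub>G\<^esub>} < \<delta>)}"

definition log_card :: "'b set \<Rightarrow> ereal" where
  "log_card S = (if card S = 0 then -\<infinity> else ereal (ln (real (card S))))"

text \<open>
  In the local quantities \<open>\<alpha>\<close> enters only through the map \<open>\<pi>\<close> with \<open>\<pi> \<circ> \<beta> = \<alpha>\<close> almost everywhere, so
  \<open>\<pi>\<close> is the parameter. It is determined by \<open>\<alpha>\<close> and \<open>\<beta>\<close> except at labels that \<open>\<beta>\<close> takes with
  probability zero.
\<close>

definition entropy_loc ::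
    "('g, 'z) monoid_scheme \<Rightarrow> (nat \<Rightarrow> nat) \<Rightarrow> (nat \<Rightarrow> 'g \<Rightarrow> nat \<Rightarrow> nat) \<Rightarrow>
     'a measure \<Rightarrow> ('g \<Rightarrow> 'a \<Rightarrow> 'a) \<Rightarrow> nat set \<Rightarrow> ('a \<Rightarrow> nat) \<Rightarrow> (nat \<Rightarrow> nat) \<Rightarrow>
     'g set \<Rightarrow> real \<Rightarrow> ereal" where
  "entropy_loc G d \<sigma> M act B \<beta> \<pi> F \<delta> =
     limsup (\<lambda>i. ereal (1 / real (d i)) *
       log_card ((\<lambda>\<phi>. \<lambda>j\<in>{1..d i}. \<pi> (\<phi> j \<one>\<^bsub>G\<^esub>)) ` AP G M act B \<beta> F \<delta> (d i) (\<sigma> i)))"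

definition entropy_rel ::
    "('g, 'z) monoid_scheme \<Rightarrow> (nat \<Rightarrow> nat) \<Rightarrow> (nat \<Rightarrow> 'g \<Rightarrow> nat \<Rightarrow> nat) \<Rightarrow>
     'a measure \<Rightarrow> ('g \<Rightarrow> 'a \<Rightarrow> 'a) \<Rightarrow> nat set \<Rightarrow> ('a \<Rightarrow> nat) \<Rightarrow> (nat \<Rightarrow> nat) \<Rightarrow> ereal" where
  "entropy_rel G d \<sigma> M act B \<beta> \<pi> =
     (INF (F, \<delta>) \<in> {(F, \<delta>). finite F \<and> F \<subseteq> carrier G \<and> \<one>\<^bsub>G\<^esub> \<in> F \<and> \<delta> > 0}.
        entropy_loc G d \<sigma> M act B \<beta> \<pi> F \<delta>)"

definition sofic_entropy ::
    "('g, 'z) monoid_scheme \<Rightarrow> (nat \<Rightarrow> nat) \<Rightarrow> (nat \<Rightarrow> 'g \<Rightarrow> nat \<Rightarrow> nat) \<Rightarrow>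
     'a measure \<Rightarrow> ('g \<Rightarrow> 'a \<Rightarrow> 'a) \<Rightarrow> ereal" where
  "sofic_entropy G d \<sigma> M act =
     (SUP (A, \<alpha>) \<in> {(A, \<alpha>). finite_observable M A \<alpha>}.
        INF (B, \<beta>, \<pi>) \<in> {(B, \<beta>, \<pi>). finite_observable M B \<beta> \<and> refines_via M A \<alpha> B \<beta> \<pi>}.
          entropy_rel G d \<sigma> M act B \<beta> \<pi>)"

text \<open>
  Factors are standard probability spaces. Quantification over them is expressed with spaces whose
  points are real numbers; as every standard Borel space is isomorphic to a Borel subset of the
  real line, this covers all factors up to isomorphism. The topology witnessing that \<open>N\<close> is
  standard is arbitrary and not tied to that of the reals.
\<close>

definition completely_positive_entropy ::
    "('g, 'z) monoid_scheme \<Rightarrow> (nat \<Rightarrow> nat) \<Rightarrow> (nat \<Rightarrow> 'g \<Rightarrow> nat \<Rightarrow> nat) \<Rightarrow>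
     'a measure \<Rightarrow> ('g \<Rightarrow> 'a \<Rightarrow> 'a) \<Rightarrow> bool" where
  "completely_positive_entropy G d \<sigma> M act \<longleftrightarrow>
     (\<forall>(N :: real measure) actN.
        standard_prob_space N \<longrightarrow> pmp_action G N actN \<longrightarrow> factor_of G N actN M act \<longrightarrow>
        \<not> one_atom N \<longrightarrow> sofic_entropy G d \<sigma> N actN > 0)"

end

theory Submission
  imports Defs "HOL-Library.Function_Algebras"
begin

text \<open>
  Suppose that \<open>\<zeta> \<noteq> 0\<close> in \<open>L\<^sup>2(X)\<close> has mean zero and is a limit of vectors \<open>F\<^sub>k \<xi>\<close>, with a fixed vector
  \<open>\<xi>\<close> and elements \<open>F\<^sub>k\<close> of the real group ring whose \<open>\<ell>\<^sup>2\<close>-norms tend to zero. Then the factor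
  generated by \<open>\<zeta>\<close> has entropy at most zero. Indeed \<open>\<xi>\<close> may be projected to the factor. In a sofic
  approximation by \<open>d\<close> points \<open>F\<^sub>k\<close> becomes a matrix whose Hilbert--Schmidt norm is small compared to
  \<open>\<surd>d\<close>, and a microstate of \<open>\<zeta>\<close> is close to the image of a microstate of \<open>\<xi>\<close>. If the level set
  patterns of the microstates of \<open>\<zeta>\<close> shattered a set of size proportional to \<open>d\<close>, pairing with all
  sign vectors on that set and averaging over the signs would contradict this. By the Sauer--Shelah
  lemma there are only subexponentially many patterns, and the level sets generate the factor.

  It remains to find \<open>\<zeta>\<close>. The convex sets of all \<open>F\<close> with \<open>\<parallel>F\<parallel>\<^sub>2 \<le> 1/k\<close> and \<open>\<langle>F \<xi>, v\<rangle> \<ge> c\<close> decrease with \<open>k\<close>,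
  and vectors \<open>F \<xi>\<close> of almost minimal norm in them converge, so it suffices that these sets are
  nonempty and contain vectors of bounded norm. If mixing fails, averages of many group elements with
  matrix coefficients bounded away from zero belong to them. If a nonamenable subgroup acts without
  spectral gap, let \<open>A\<close> be a symmetric average over it with \<open>\<parallel>A\<parallel> = \<rho> < 1\<close> in the regular
  representation; for an almost invariant \<open>\<xi>\<close> one takes \<open>F = 1 - (1 - A\<^sup>2\<^sup>n)\<^sup>k\<close> with \<open>k\<close> growing more
  slowly than \<open>\<rho>\<^sup>-\<^sup>2\<^sup>n\<close>, so that \<open>\<parallel>F\<parallel>\<^sub>2 \<le> k \<rho>\<^sup>2\<^sup>n\<close> is small while \<open>F \<xi>\<close> stays close to \<open>\<xi>\<close>.
\<close>

section \<open>Shattered sets\<close>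

text \<open>What a sofic approximation controls is the 2-norm of \<open>F\<close>: permutations of
  distinct group elements agree at few points, so the normalized Hilbert-Schmidt norm of the matrix
  of \<open>F\<close> tends to the 2-norm. The evident bound for its operator norm, the sum of
  \<open>\<bar>F g\<bar>\<close>, need not be small. So single microstates may well be stretched;
  only averaged over all sign directions is the matrix small, and this is why shattering, which
  offers all sign patterns at once, is the right notion of having many patterns. The error
  \<open>F \<xi> - \<zeta>\<close> reaches the microstates as a mean square, so it has to be small
  in norm; weak limits of the \<open>F \<xi>\<close> would not do, and the convex minimization is
  there to make them converge strongly. Entropy is defined by finite observables while
  \<open>\<zeta>\<close> is an unbounded function. Rounding and cutting at a level cost errors on
  sets of small measure. Smallness of entropy is therefore stated for single sets and up to small
  Hamming distance: in this form it passes to limits, and the sets that satisfy it form a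
  \<sigma>-algebra, which can be compared with the one generated by the translates of
  \<open>\<zeta>\<close>.\<close>

definition shatters :: "'a set set \<Rightarrow> 'a set \<Rightarrow> bool" where
  "shatters \<S> I \<longleftrightarrow> (\<forall>J\<subseteq>I. \<exists>S\<in>\<S>. S \<inter> I = J)"

text \<open>Pajor's form of the Sauer-Shelah lemma. Deleting \<open>x\<close> from all members gives
  \<open>\<A>\<close>, and a set is lost in this only if it occurs both with and without
  \<open>x\<close>; these doubles are counted by \<open>\<B>\<close>. What \<open>\<A>\<close>
  shatters is shattered by \<open>\<S>\<close>, and what \<open>\<B>\<close> shatters stays
  shattered after adding \<open>x\<close>, so the two bounds add without overlap.\<close>

lemma card_le_card_shattered:
  assumes "finite X" "\<S> \<subseteq> Pow X"
  shows "card \<S> \<le> card {I. I \<subseteq> X \<and> shatters \<S> I}"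
  using assms
proof (induction X arbitrary: \<S> rule: finite_induct)
  case empty
  show ?case
  proof (cases "\<S> = {}")
    case False
    then have "\<S> = {{}}" using empty by auto
    moreover have "{I. I \<subseteq> {} \<and> shatters \<S> I} = {{}}"
      using \<open>\<S> = {{}}\<close> by (auto simp: shatters_def)
    ultimately show ?thesis by simp
  qed simp
next
  case (insert x X)
  have fin: "finite \<S>" using insert.prems insert.hyps finite_subset by (metis finite.insertI finite_Pow_iff)
  define \<A> where "\<A> = (\<lambda>S. S - {x}) ` \<S>"
  define \<B> where "\<B> = {S. x \<notin> S \<and> S \<in> \<S> \<and> insert x S \<in> \<S>}"
  have A: "\<A> \<subseteq> Pow X" and B: "\<B> \<subseteq> Pow X"
    using insert.prems by (auto simp: \<A>_def \<B>_def)
  have finB: "finite \<B>" using B insert.hyps by (meson finite_Pow_iff finite_subset)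
  let ?N = "{S\<in>\<S>. x \<notin> S}" and ?Y = "{S\<in>\<S>. x \<in> S}"
  have "card \<S> = card ?N + card ?Y"
    by (subst card_Un_disjoint[symmetric]) (auto simp: fin intro!: arg_cong[where f = card])
  moreover have "card ?Y = card ((\<lambda>S. S - {x}) ` ?Y)"
    by (rule card_image[symmetric]) (auto simp: inj_on_def)
  moreover have "card ?N + card ((\<lambda>S. S - {x}) ` ?Y) =
      card (?N \<union> (\<lambda>S. S - {x}) ` ?Y) + card (?N \<inter> (\<lambda>S. S - {x}) ` ?Y)"
    by (rule card_Un_Int) (auto simp: fin)
  moreover have "?N \<union> (\<lambda>S. S - {x}) ` ?Y = \<A>"
  proof -
    have "(\<lambda>S. S - {x}) ` ?N = (\<lambda>S. S) ` ?N" by (rule image_cong) auto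
    moreover have "\<S> = ?N \<union> ?Y" by auto
    then have "\<A> = (\<lambda>S. S - {x}) ` ?N \<union> (\<lambda>S. S - {x}) ` ?Y" unfolding \<A>_def by blast
    ultimately show ?thesis by simp
  qed
  moreover have "?N \<inter> (\<lambda>S. S - {x}) ` ?Y = \<B>"
    by (auto simp: \<B>_def image_iff insert_absorb)
  ultimately have eq: "card \<S> = card \<A> + card \<B>" by simp
  let ?SA = "{I. I \<subseteq> X \<and> shatters \<A> I}" and ?SB = "{I. I \<subseteq> X \<and> shatters \<B> I}"
  have finS: "finite ?SA" "finite ?SB" using insert.hyps by auto
  have "card ?SA + card ?SB = card (?SA \<union> insert x ` ?SB)"
  proof (subst card_Un_disjoint)
    show "?SA \<inter> insert x ` ?SB = {}" using insert.hyps by auto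
    have "inj_on (insert x) ?SB"
      using insert.hyps(2) by (auto simp: inj_on_def)
    then show "card ?SA + card ?SB = card ?SA + card (insert x ` ?SB)" by (simp add: card_image)
  qed (use finS in auto)
  also have "\<dots> \<le> card {I. I \<subseteq> insert x X \<and> shatters \<S> I}"
  proof (rule card_mono)
    show "finite {I. I \<subseteq> insert x X \<and> shatters \<S> I}" using insert.hyps by auto
    have 1: "shatters \<S> I" if "I \<subseteq> X" "shatters \<A> I" for I
      unfolding shatters_def
    proof (intro allI impI)
      fix J assume "J \<subseteq> I"
      then have "\<exists>S\<in>\<A>. S \<inter> I = J" using that by (simp add: shatters_def)
      then obtain S where "S \<in> \<S>" "(S - {x}) \<inter> I = J" unfolding \<A>_def by blast
      moreover have "x \<notin> I" using that insert.hyps by auto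
      ultimately show "\<exists>S\<in>\<S>. S \<inter> I = J" by (intro bexI[of _ S]) auto
    qed
    have 2: "shatters \<S> (insert x I)" if "I \<subseteq> X" "shatters \<B> I" for I
      unfolding shatters_def
    proof (intro allI impI)
      fix J assume J: "J \<subseteq> insert x I"
      have xI: "x \<notin> I" using that insert.hyps by auto
      have "J - {x} \<subseteq> I" using J by auto
      then have "\<exists>S\<in>\<B>. S \<inter> I = J - {x}" using that by (simp add: shatters_def)
      then obtain S where S: "S \<in> \<B>" "S \<inter> I = J - {x}" by blast
      show "\<exists>S\<in>\<S>. S \<inter> insert x I = J"
      proof (cases "x \<in> J")
        case True
        then show ?thesis using S J by (intro bexI[of _ "insert x S"]) (auto simp: \<B>_def)
      next
        case False
        then show ?thesis using S J by (intro bexI[of _ S]) (auto simp: \<B>_def)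
      qed
    qed
    show "?SA \<union> insert x ` ?SB \<subseteq> {I. I \<subseteq> insert x X \<and> shatters \<S> I}"
      using 1 2 by auto
  qed
  finally show ?case using insert.IH[OF A] insert.IH[OF B] eq by linarith
qed

text \<open>Chooses the density \<open>a\<close> for the counting bound below with the weight
  \<open>x = min 1 (c / 2)\<close>: the two terms \<open>a * (- ln x)\<close> and \<open>x\<close>
  of the exponent get at most \<open>c / 2\<close> each. The denominator \<open>L + 1\<close> is
  positive also when \<open>L = 0\<close>.\<close>

lemma exp_bound_exponent:
  fixes c :: real assumes "c > 0"
  obtains a where "a > 0" "a \<le> c" "a * (- ln (min 1 (c / 2))) + c / 2 \<le> c"
proof -
  define L where "L = - ln (min 1 (c / 2))"
  have "L \<ge> 0" using assms by (auto simp: L_def min_def)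
  show ?thesis
  proof (rule that[of "min c (c / 2 / (L + 1))"])
    show "min c (c / 2 / (L + 1)) > 0" using assms \<open>L \<ge> 0\<close> by auto
    have "min c (c / 2 / (L + 1)) * L \<le> c / 2 / (L + 1) * L"
      using \<open>L \<ge> 0\<close> by (intro mult_right_mono) auto
    also have "\<dots> \<le> c / 2" using assms \<open>L \<ge> 0\<close> by (simp add: field_simps)
    finally show "min c (c / 2 / (L + 1)) * (- ln (min 1 (c / 2))) + c / 2 \<le> c" unfolding L_def by simp
  qed auto
qed

text \<open>Chernoff's argument: give a subset \<open>I\<close> the weight \<open>x ^ card I\<close>
  with \<open>x \<le> 1\<close>. Subsets of density at most \<open>a\<close> have weight at least
  \<open>x\<close> to the power \<open>a * card X\<close>, while all weights together make
  \<open>(1 + x) ^ card X\<close>, which is at most \<open>exp (x * card X)\<close>. The density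
  \<open>a\<close> depends on \<open>c\<close> alone.\<close>

lemma card_small_subsets_le:
  fixes c :: real assumes "c > 0"
  obtains a where "a > 0" "a \<le> c"
    "\<And>X. finite X \<Longrightarrow> real (card {I. I \<subseteq> X \<and> real (card I) \<le> a * card X}) \<le> exp (c * card X)"
proof -
  obtain a where a: "a > 0" "a \<le> c" "a * (- ln (min 1 (c / 2))) + c / 2 \<le> c"
    using exp_bound_exponent[OF assms] .
  define x where "x = min 1 (c / 2)"
  have x: "0 < x" "x \<le> 1" "x \<le> c / 2" using assms by (auto simp: x_def)
  show ?thesis
  proof (rule that[OF a(1,2)])
    fix X :: "'a set" assume X: "finite X"
    let ?d = "card X" and ?N = "{I. I \<subseteq> X \<and> real (card I) \<le> a * card X}"
    have finN: "finite ?N" using X by auto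
    have "real (card ?N) * exp (a * ?d * ln x) = (\<Sum>I\<in>?N. exp (a * ?d * ln x))" by simp
    also have "\<dots> \<le> (\<Sum>I\<in>?N. x ^ card I)"
    proof (rule sum_mono)
      fix I assume "I \<in> ?N"
      then have "a * ?d * ln x \<le> card I * ln x"
        using x by (intro mult_right_mono_neg) auto
      then show "exp (a * ?d * ln x) \<le> x ^ card I"
        using x by (metis exp_le_cancel_iff exp_ln exp_of_nat_mult)
    qed
    also have "\<dots> \<le> (\<Sum>I\<in>Pow X. x ^ card I)"
      using X x by (intro sum_mono2) auto
    also have "\<dots> = (\<Sum>I\<in>Pow X. (\<Prod>i\<in>I. x) * (\<Prod>i\<in>X - I. 1))" by simp
    also have "\<dots> = (\<Prod>i\<in>X. x + 1)" using X by (subst prod_add) auto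
    also have "\<dots> = (1 + x) ^ ?d" by (simp add: add.commute)
    also have "\<dots> \<le> exp x ^ ?d" using x by (intro power_mono exp_ge_add_one_self) auto
    also have "\<dots> = exp (?d * x)" by (simp add: exp_of_nat_mult)
    finally have "real (card ?N) \<le> exp (?d * x) / exp (a * ?d * ln x)" by (simp add: field_simps)
    also have "\<dots> = exp (?d * (x + a * (- ln x)))"
      by (simp add: exp_diff[symmetric] algebra_simps)
    also have "\<dots> \<le> exp (?d * c)"
      using a(3) x by (intro exp_le_cancel_iff[THEN iffD2] mult_left_mono) (auto simp: x_def)
    finally show "real (card ?N) \<le> exp (c * ?d)" by (simp add: mult.commute)
  qed
qed

section \<open>Semi-inner products and self-adjoint contractions\<close>

text \<open>Together with pointwise addition this turns functions on the space and functions on the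
  group into vectors, so that one locale serves square-integrable functions and the group
  ring.\<close>

instantiation "fun" :: (type, real_vector) real_vector
begin

definition scaleR_fun_def: "c *\<^sub>R f = (\<lambda>x. c *\<^sub>R f x)"

instance
  by standard (auto simp: scaleR_fun_def fun_eq_iff algebra_simps)

end

lemma scaleR_fun_apply [simp]: "(c *\<^sub>R f) x = c *\<^sub>R f x"
  by (simp add: scaleR_fun_def)

lemma sum_fun_apply: "(\<Sum>i\<in>I. f i) x = (\<Sum>i\<in>I. f i x)"
  by (induction I rule: infinite_finite_induct) auto

text \<open>The form is only semidefinite, so functions need not be identified modulo null sets, and
  the vectors are a subspace \<open>V\<close> of a type, since neither square integrability nor
  finite support is a property of the type.\<close>

locale semi_inner =
  fixes V :: "'v::real_vector set" and ip :: "'v \<Rightarrow> 'v \<Rightarrow> real"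
  assumes subspace: "subspace V"
    and ip_add_left: "\<And>x y z. x \<in> V \<Longrightarrow> y \<in> V \<Longrightarrow> z \<in> V \<Longrightarrow> ip (x + y) z = ip x z + ip y z"
    and ip_scale_left: "\<And>c x y. x \<in> V \<Longrightarrow> y \<in> V \<Longrightarrow> ip (c *\<^sub>R x) y = c * ip x y"
    and ip_commute: "\<And>x y. x \<in> V \<Longrightarrow> y \<in> V \<Longrightarrow> ip x y = ip y x"
    and ip_nonneg: "\<And>x. x \<in> V \<Longrightarrow> 0 \<le> ip x x"
begin

definition nrm :: "'v \<Rightarrow> real" where "nrm x = sqrt (ip x x)"

lemma add_mem [intro, simp]: "x \<in> V \<Longrightarrow> y \<in> V \<Longrightarrow> x + y \<in> V"
  and diff_mem [intro, simp]: "x \<in> V \<Longrightarrow> y \<in> V \<Longrightarrow> x - y \<in> V"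
  and scale_mem [intro, simp]: "x \<in> V \<Longrightarrow> c *\<^sub>R x \<in> V"
  and zero_mem [intro, simp]: "0 \<in> V"
  using subspace by (auto simp: subspace_add subspace_diff subspace_scale subspace_0)

lemma sum_mem: "(\<And>i. i \<in> I \<Longrightarrow> f i \<in> V) \<Longrightarrow> (\<Sum>i\<in>I. f i) \<in> V"
  using subspace by (rule subspace_sum)

lemma ip_add_right: "x \<in> V \<Longrightarrow> y \<in> V \<Longrightarrow> z \<in> V \<Longrightarrow> ip z (x + y) = ip z x + ip z y"
  using ip_add_left ip_commute by (metis add_mem)

lemma ip_scale_right: "x \<in> V \<Longrightarrow> y \<in> V \<Longrightarrow> ip y (c *\<^sub>R x) = c * ip y x"
  using ip_scale_left ip_commute by (metis scale_mem)

lemma ip_diff_left: "x \<in> V \<Longrightarrow> y \<in> V \<Longrightarrow> z \<in> V \<Longrightarrow> ip (x - y) z = ip x z - ip y z"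
  using ip_add_left[of x "(-1) *\<^sub>R y" z] ip_scale_left[of y z "-1"] scale_mem[of y "-1"] by simp

lemma ip_diff_right: "x \<in> V \<Longrightarrow> y \<in> V \<Longrightarrow> z \<in> V \<Longrightarrow> ip z (x - y) = ip z x - ip z y"
  using ip_diff_left ip_commute by (metis diff_mem)

lemma ip_zero [simp]: "x \<in> V \<Longrightarrow> ip 0 x = 0" "x \<in> V \<Longrightarrow> ip x 0 = 0"
  using ip_scale_left[of x x 0] ip_scale_right[of x x 0] by auto

lemma ip_sum_left:
  "(\<And>i. i \<in> I \<Longrightarrow> f i \<in> V) \<Longrightarrow> y \<in> V \<Longrightarrow> ip (\<Sum>i\<in>I. f i) y = (\<Sum>i\<in>I. ip (f i) y)"
  by (induction I rule: infinite_finite_induct) (auto simp: ip_add_left sum_mem)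

lemma nrm_nonneg [simp]: "x \<in> V \<Longrightarrow> 0 \<le> nrm x"
  by (simp add: nrm_def ip_nonneg)

lemma nrm_power2: "x \<in> V \<Longrightarrow> (nrm x)\<^sup>2 = ip x x"
  by (simp add: nrm_def ip_nonneg)

lemma nrm_zero [simp]: "nrm 0 = 0"
  by (simp add: nrm_def)

lemma nrm_add_power2: "x \<in> V \<Longrightarrow> y \<in> V \<Longrightarrow> (nrm (x + y))\<^sup>2 = (nrm x)\<^sup>2 + 2 * ip x y + (nrm y)\<^sup>2"
  by (simp add: nrm_power2 ip_add_left ip_add_right ip_commute[of y x])

lemma nrm_diff_power2: "x \<in> V \<Longrightarrow> y \<in> V \<Longrightarrow> (nrm (x - y))\<^sup>2 = (nrm x)\<^sup>2 - 2 * ip x y + (nrm y)\<^sup>2"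
  by (simp add: nrm_power2 ip_diff_left ip_diff_right ip_commute[of y x])

lemma nrm_scale: "x \<in> V \<Longrightarrow> nrm (c *\<^sub>R x) = \<bar>c\<bar> * nrm x"
  by (simp add: nrm_def ip_scale_left ip_scale_right real_sqrt_mult power2_eq_square[symmetric]
      mult.assoc[symmetric])

lemma nrm_minus_commute: "x \<in> V \<Longrightarrow> y \<in> V \<Longrightarrow> nrm (x - y) = nrm (y - x)"
  using nrm_scale[of "x - y" "-1"] by (simp add: algebra_simps)

lemma Cauchy_Schwarz:
  assumes "x \<in> V" "y \<in> V"
  shows "\<bar>ip x y\<bar> \<le> nrm x * nrm y"
proof -
  have quad: "0 \<le> ip y y * t\<^sup>2 + 2 * ip x y * t + ip x x" for t
    using ip_nonneg[of "x + t *\<^sub>R y"] assms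
    by (simp add: ip_add_left ip_add_right ip_scale_left ip_scale_right ip_commute[of y x]
        power2_eq_square algebra_simps)
  then have "(ip x y)\<^sup>2 \<le> ip x x * ip y y"
  proof (cases "ip y y = 0")
    \<comment> \<open>Here the quadratic is an affine function of \<open>t\<close> that is bounded
      below, so its slope \<open>2 * ip x y\<close> vanishes; the value of \<open>t\<close> below
      would make it equal to -1.\<close>
    case True
    have "ip x y = 0"
    proof (rule ccontr)
      assume "ip x y \<noteq> 0"
      then show False
        using True quad[of "- (ip x x + 1) / (2 * ip x y)"]
        by (simp add: field_simps)
    qed
    then show ?thesis using True by simp
  next
    case False
    then have pos: "ip y y > 0" using ip_nonneg[OF assms(2)] by simp
    have "0 \<le> ip y y * (ip y y * (- ip x y / ip y y)\<^sup>2 + 2 * ip x y * (- ip x y / ip y y) + ip x x)"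
      using mult_nonneg_nonneg[OF less_imp_le[OF pos] quad] .
    also have "\<dots> = ip x x * ip y y - (ip x y)\<^sup>2"
      using pos by (simp add: field_simps power2_eq_square)
    finally show ?thesis by simp
  qed
  then have "sqrt ((ip x y)\<^sup>2) \<le> sqrt (ip x x * ip y y)" by (rule real_sqrt_le_mono)
  then show ?thesis by (simp add: nrm_def real_sqrt_mult)
qed

lemma nrm_triangle:
  assumes "x \<in> V" "y \<in> V"
  shows "nrm (x + y) \<le> nrm x + nrm y"
proof (rule power2_le_imp_le)
  show "(nrm (x + y))\<^sup>2 \<le> (nrm x + nrm y)\<^sup>2"
    using Cauchy_Schwarz[OF assms] assms by (simp add: nrm_add_power2 power2_sum)
qed (use assms in simp)

lemma nrm_triangle_diff: "x \<in> V \<Longrightarrow> y \<in> V \<Longrightarrow> nrm (x - y) \<le> nrm x + nrm y"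
  using nrm_triangle[of x "(-1) *\<^sub>R y"] nrm_scale[of y "-1"] scale_mem[of y "-1"] by simp

lemma nrm_triangle_le: "x \<in> V \<Longrightarrow> y \<in> V \<Longrightarrow> nrm x \<le> nrm y + nrm (x - y)"
  using nrm_triangle[of y "x - y"] by simp

lemma nrm_sum_le: "(\<And>i. i \<in> I \<Longrightarrow> f i \<in> V) \<Longrightarrow> nrm (\<Sum>i\<in>I. f i) \<le> (\<Sum>i\<in>I. nrm (f i))"
proof (induction I rule: infinite_finite_induct)
  case (insert i I)
  then show ?case using nrm_triangle[of "f i" "\<Sum>i\<in>I. f i"] by (simp add: sum_mem)
qed auto

text \<open>
  Vectors of almost minimal length in a decreasing sequence of convex sets form a Cauchy sequence,
  by the parallelogram law.
\<close>

lemma minimizing_Cauchy: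
  fixes C :: "nat \<Rightarrow> 'v set"
  assumes C: "\<And>k. C k \<subseteq> V" "\<And>k. convex (C k)" "decseq C"
    and bound: "\<And>k. \<exists>x\<in>C k. nrm x \<le> b"
  obtains x where "\<And>k. x k \<in> C k" "\<And>k y. y \<in> C k \<Longrightarrow> (nrm (x k))\<^sup>2 \<le> (nrm y)\<^sup>2 + 1 / Suc k"
    "\<And>e. e > 0 \<Longrightarrow> \<exists>N. \<forall>m\<ge>N. \<forall>n\<ge>N. nrm (x m - x n) < e"
proof -
  define m where "m k = (INF x\<in>C k. ip x x)" for k
  have bdd: "bdd_below ((\<lambda>x. ip x x) ` C k)" for k
    using C(1) ip_nonneg by (intro bdd_belowI2[of _ 0]) auto
  have ne: "C k \<noteq> {}" for k using bound by blast
  have m_le: "m k \<le> ip y y" if "y \<in> C k" for k y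
    unfolding m_def using bdd that by (rule cINF_lower)
  have "incseq m"
    unfolding m_def incseq_def using C(3) ne bdd
    by (intro allI impI cINF_superset_mono) (auto simp: decseq_def)
  have "m k \<le> b\<^sup>2" for k
  proof -
    obtain x where x: "x \<in> C k" "nrm x \<le> b" using bound by blast
    then have "m k \<le> (nrm x)\<^sup>2" using m_le C(1) nrm_power2 by (metis subsetD)
    also have "\<dots> \<le> b\<^sup>2" using x C(1)[of k] by (intro power_mono nrm_nonneg) auto
    finally show ?thesis .
  qed
  then have "convergent m"
    using \<open>incseq m\<close> incseq_convergent[of m "b\<^sup>2"] unfolding convergent_def by metis
  then have "Cauchy m" by (simp add: convergent_Cauchy)
  have "\<exists>x. x \<in> C k \<and> ip x x < m k + 1 / Suc k" for k
  proof -
    have "(INF x\<in>C k. ip x x) < m k + 1 / Suc k" by (simp add: m_def)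
    then show ?thesis using cINF_less_iff[OF ne bdd] by blast
  qed
  then obtain x where x: "\<And>k. x k \<in> C k" "\<And>k. ip (x k) (x k) < m k + 1 / Suc k" by metis
  have xV: "x k \<in> V" for k using x C by blast
  \<comment> \<open>For \<open>k \<le> j\<close> both vectors lie in the convex set
    \<open>C k\<close>, hence so does their midpoint, whose squared norm is at least
    \<open>m k\<close>. Since \<open>m\<close> is increasing and bounded, the right-hand side
    becomes small.\<close>
  have key: "(nrm (x k - x j))\<^sup>2 \<le> 2 * (m j - m k) + 4 / Suc k" if "k \<le> j" for j k
  proof -
    have "x j \<in> C k" using x(1)[of j] C(3) that by (auto simp: decseq_def)
    then have "(1 / 2) *\<^sub>R x k + (1 / 2) *\<^sub>R x j \<in> C k"
      using x(1)[of k] C(2)[of k] by (intro convexD) auto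
    then have "m k \<le> ip ((1 / 2) *\<^sub>R x k + (1 / 2) *\<^sub>R x j) ((1 / 2) *\<^sub>R x k + (1 / 2) *\<^sub>R x j)"
      by (rule m_le)
    also have "\<dots> = (ip (x k) (x k) + 2 * ip (x k) (x j) + ip (x j) (x j)) / 4"
      using xV by (simp add: ip_add_left ip_add_right ip_scale_left ip_scale_right ip_commute[of "x j" "x k"] field_simps)
    finally have "- 2 * ip (x k) (x j) \<le> ip (x k) (x k) + ip (x j) (x j) - 4 * m k" by simp
    then have "(nrm (x k - x j))\<^sup>2 \<le> 2 * ip (x k) (x k) + 2 * ip (x j) (x j) - 4 * m k"
      using nrm_diff_power2[OF xV[of k] xV[of j]] nrm_power2[OF xV[of k]] nrm_power2[OF xV[of j]]
      by linarith
    also have "\<dots> \<le> 2 * (m k + 1 / Suc k) + 2 * (m j + 1 / Suc j) - 4 * m k"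
      using x(2)[of k] x(2)[of j] by simp
    also have "\<dots> \<le> 2 * (m j - m k) + 4 / Suc k"
      using that frac_le[of 1 1 "Suc k" "Suc j"] by simp
    finally show ?thesis .
  qed
  show ?thesis
  proof (rule that[of x])
    show "x k \<in> C k" for k by (rule x)
    show "(nrm (x k))\<^sup>2 \<le> (nrm y)\<^sup>2 + 1 / Suc k" if "y \<in> C k" for k y
    proof -
      have "y \<in> V" using that C(1) by blast
      then show ?thesis using x(2)[of k] m_le[OF that] xV[of k] by (simp add: nrm_power2)
    qed
    show "\<exists>N. \<forall>i\<ge>N. \<forall>n\<ge>N. nrm (x i - x n) < e" if "e > 0" for e
    proof -
      obtain N1 where N1: "\<And>i n. i \<ge> N1 \<Longrightarrow> n \<ge> N1 \<Longrightarrow> dist (m i) (m n) < e\<^sup>2 / 4"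
        using \<open>Cauchy m\<close> \<open>e > 0\<close> unfolding Cauchy_def
        by (metis zero_less_divide_iff zero_less_numeral zero_less_power)
      obtain N2 where N2: "real N2 > 8 / e\<^sup>2" using reals_Archimedean2 by blast
      have le: "nrm (x i - x n) < e" if "i \<ge> max N1 N2" "i \<le> n" for i n
      proof -
        have "real (Suc i) > 8 / e\<^sup>2" using N2 that by linarith
        then have "8 < real (Suc i) * e\<^sup>2" using \<open>e > 0\<close> by (simp add: pos_divide_less_eq)
        then have "4 / Suc i < e\<^sup>2 / 2" by (simp add: pos_divide_less_eq mult.commute)
        moreover have "m n - m i < e\<^sup>2 / 4" using N1[of n i] that abs_ge_self[of "m n - m i"] unfolding dist_real_def by linarith
        then have "2 * (m n - m i) < e\<^sup>2 / 2" by simp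
        ultimately have "2 * (m n - m i) + 4 / Suc i < e\<^sup>2 / 2 + e\<^sup>2 / 2"
          by (intro add_strict_mono)
        then have "(nrm (x i - x n))\<^sup>2 < e\<^sup>2"
          using key[OF that(2)] unfolding field_sum_of_halves by (rule le_less_trans[rotated])
        then show ?thesis by (rule power2_less_imp_less) (use \<open>e > 0\<close> in simp)
      qed
      show ?thesis
      proof (intro exI[of _ "max N1 N2"] allI impI)
        fix i n assume "i \<ge> max N1 N2" "n \<ge> max N1 N2"
        then show "nrm (x i - x n) < e"
          using le[of i n] le[of n i] unfolding nrm_minus_commute[OF xV xV, of n i] by linarith
      qed
    qed
  qed
qed

end

section \<open>Polynomials of a self-adjoint contraction, for averages on the group ring and on
  \<open>L2\<close>\<close>

locale self_adjoint_contraction = semi_inner +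
  fixes A :: "'a \<Rightarrow> 'a"
  assumes A_mem [intro, simp]: "\<And>x. x \<in> V \<Longrightarrow> A x \<in> V"
    and A_diff: "\<And>x y. x \<in> V \<Longrightarrow> y \<in> V \<Longrightarrow> A (x - y) = A x - A y"
    and A_adjoint: "\<And>x y. x \<in> V \<Longrightarrow> y \<in> V \<Longrightarrow> ip (A x) y = ip x (A y)"
    and A_contraction: "\<And>x. x \<in> V \<Longrightarrow> nrm (A x) \<le> nrm x"
begin

text \<open>The factor \<open>1 - A^(2n)\<close>. It is written with two powers
  \<open>A ^^ n\<close> because moving one of them across the inner product turns the cross term
  into the square of the norm of \<open>(A ^^ n) x\<close>.\<close>

definition cut :: "nat \<Rightarrow> 'a \<Rightarrow> 'a" where
  "cut n x = x - (A ^^ n) ((A ^^ n) x)"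

lemma power_mem [intro, simp]: "x \<in> V \<Longrightarrow> (A ^^ n) x \<in> V"
  by (induction n) auto

lemma power_diff: "x \<in> V \<Longrightarrow> y \<in> V \<Longrightarrow> (A ^^ n) (x - y) = (A ^^ n) x - (A ^^ n) y"
  by (induction n) (auto simp: A_diff)

lemma power_adjoint: "x \<in> V \<Longrightarrow> y \<in> V \<Longrightarrow> ip ((A ^^ n) x) y = ip x ((A ^^ n) y)"
  by (induction n arbitrary: x y) (auto simp: A_adjoint funpow_swap1)

lemma power_contraction: "x \<in> V \<Longrightarrow> nrm ((A ^^ n) x) \<le> nrm x"
  by (induction n) (auto intro: order_trans[OF A_contraction])

lemma power_commute: "(A ^^ n) ((A ^^ m) x) = (A ^^ m) ((A ^^ n) x)"
  by (metis add.commute comp_apply funpow_add)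

lemma cut_mem [intro, simp]: "x \<in> V \<Longrightarrow> cut n x \<in> V"
  by (simp add: cut_def)

lemma cut_power_mem [intro, simp]: "x \<in> V \<Longrightarrow> (cut n ^^ k) x \<in> V"
  by (induction k) auto

lemma power_cut: "x \<in> V \<Longrightarrow> (A ^^ m) (cut n x) = cut n ((A ^^ m) x)"
  by (simp add: cut_def power_diff power_commute[of m n])

lemma power_cut_power: "x \<in> V \<Longrightarrow> (A ^^ m) ((cut n ^^ k) x) = (cut n ^^ k) ((A ^^ m) x)"
  by (induction k) (auto simp: power_cut)

lemma cut_diff: "x \<in> V \<Longrightarrow> y \<in> V \<Longrightarrow> cut n (x - y) = cut n x - cut n y"
  by (simp add: cut_def power_diff)

lemma cut_power_diff: "x \<in> V \<Longrightarrow> y \<in> V \<Longrightarrow> (cut n ^^ k) (x - y) = (cut n ^^ k) x - (cut n ^^ k) y"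
  by (induction k) (auto simp: cut_diff)

text \<open>In the expanded square the cross term contributes minus twice the squared norm of
  \<open>(A ^^ n) x\<close>, and the last term gives back at most once that amount, as
  \<open>A\<close> is a contraction.\<close>

lemma nrm_cut_power2: "x \<in> V \<Longrightarrow> (nrm (cut n x))\<^sup>2 \<le> (nrm x)\<^sup>2 - (nrm ((A ^^ n) x))\<^sup>2"
proof -
  assume x: "x \<in> V"
  have "(nrm ((A ^^ n) ((A ^^ n) x)))\<^sup>2 \<le> (nrm ((A ^^ n) x))\<^sup>2"
    using power_contraction[of "(A ^^ n) x" n] x by (intro power_mono) auto
  moreover have "ip x ((A ^^ n) ((A ^^ n) x)) = (nrm ((A ^^ n) x))\<^sup>2"
    using x by (simp add: power_adjoint[symmetric] nrm_power2)
  ultimately show ?thesis using x by (simp add: cut_def nrm_diff_power2)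
qed

lemma cut_contraction: "x \<in> V \<Longrightarrow> nrm (cut n x) \<le> nrm x"
  using nrm_cut_power2[of x n] zero_le_power2[of "nrm ((A ^^ n) x)"]
  by (intro power2_le_imp_le[of "nrm (cut n x)" "nrm x"]) (linarith, simp)

lemma cut_power_contraction: "x \<in> V \<Longrightarrow> nrm ((cut n ^^ k) x) \<le> nrm x"
  by (induction k) (auto intro: order_trans[OF cut_contraction])

text \<open>Each application of \<open>cut n\<close> lowers the squared norm by at least the squared
  norm of the image under \<open>A ^^ n\<close>. These losses decrease from step to step because
  \<open>cut n\<close> is a contraction commuting with \<open>A\<close>, and their sum is at most
  the initial squared norm; so the last of them is at most a \<open>k\<close>-th part. This replaces
  the spectral theorem.\<close>

lemma power_cut_power_bound:
  assumes "x \<in> V"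
  shows "k * (nrm ((A ^^ n) ((cut n ^^ k) x)))\<^sup>2 \<le> (nrm x)\<^sup>2"
proof -
  let ?c = "\<lambda>i. (nrm ((A ^^ n) ((cut n ^^ i) x)))\<^sup>2"
  have "?c (Suc i) \<le> ?c i" for i
    using cut_contraction[of "(A ^^ n) ((cut n ^^ i) x)" n] assms by (simp add: power_cut power_mono)
  then have dec: "?c k \<le> ?c i" if "i \<le> k" for i
    using that by (rule lift_Suc_antimono_le)
  have "k * ?c k + (nrm ((cut n ^^ k) x))\<^sup>2 \<le> (\<Sum>i<k. ?c i) + (nrm ((cut n ^^ k) x))\<^sup>2"
    using dec sum_mono[of "{..<k}" "\<lambda>_. ?c k" ?c] by simp
  also have "\<dots> \<le> (nrm x)\<^sup>2"
  proof (induction k)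
    case (Suc k)
    then show ?case using nrm_cut_power2[of "(cut n ^^ k) x" n] assms by simp
  qed simp
  finally show ?thesis by (smt (verit) zero_le_power2)
qed

text \<open>Self-adjointness and the Cauchy-Schwarz inequality give
  \<open>(nrm (A y))^2 \<le> nrm y * nrm (A (A y))\<close>, so the norms of the powers are
  logarithmically convex: the ratio of consecutive norms, at least \<open>q\<close> at the start,
  never decreases.\<close>

lemma power_lower_bound:
  assumes x: "x \<in> V" "q * nrm x \<le> nrm (A x)" "q \<ge> 0" "nrm x > 0"
  shows "q ^ n * nrm x \<le> nrm ((A ^^ n) x)"
proof (cases "q = 0")
  case True
  then show ?thesis using x by (cases n) auto
next
  case False
  then have q: "q > 0" using x by simp
  have "nrm ((A ^^ n) x) > 0 \<and> q * nrm ((A ^^ n) x) \<le> nrm ((A ^^ Suc n) x)" for n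
  proof (induction n)
    case (Suc n)
    let ?y = "(A ^^ n) x"
    have y: "?y \<in> V" using x by simp
    have pos: "nrm ?y > 0" "q * nrm ?y \<le> nrm (A ?y)" using Suc by auto
    then have pos2: "nrm (A ?y) > 0" using q by (smt (verit) mult_pos_pos)
    have "(nrm (A ?y))\<^sup>2 = ip ?y (A (A ?y))" using y by (simp add: nrm_power2 A_adjoint)
    also have "\<dots> \<le> nrm ?y * nrm (A (A ?y))" using Cauchy_Schwarz[of ?y "A (A ?y)"] y by simp
    finally have "nrm (A ?y) * nrm (A ?y) \<le> nrm ?y * nrm (A (A ?y))" by (simp add: power2_eq_square)
    moreover have "q * nrm ?y * nrm (A ?y) \<le> nrm (A ?y) * nrm (A ?y)"
      using pos pos2 by (intro mult_right_mono) auto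
    ultimately have "nrm ?y * (q * nrm (A ?y)) \<le> nrm ?y * nrm (A (A ?y))" by (simp add: mult_ac)
    then show ?case using pos pos2 by simp
  qed (use x in simp)
  then show ?thesis
  proof (induction n)
    case (Suc n)
    have "q ^ Suc n * nrm x = q * (q ^ n * nrm x)" by simp
    also have "\<dots> \<le> q * nrm ((A ^^ n) x)" using Suc q by (intro mult_left_mono) auto
    also have "\<dots> \<le> nrm ((A ^^ Suc n) x)" using Suc by blast
    finally show ?case .
  qed simp
qed

text \<open>
  The polynomial \<open>(1 - t\<^sup>2\<^sup>n)\<^sup>k\<close> is small near \<open>t = 1\<close> as soon as \<open>k\<close> exceeds \<open>t\<^sup>-\<^sup>2\<^sup>n\<close>;
  so it almost annihilates a vector that is almost fixed by \<open>A\<close>.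
\<close>

lemma nrm_cut_power_le_half:
  assumes x: "x \<in> V" "nrm x = 1" "nrm (x - A x) \<le> \<tau>" and \<tau>: "\<tau> < 1 / 2"
    and k: "4 < k * (1 - 2 * \<tau>) ^ (2 * n)"
  shows "nrm ((cut n ^^ k) x) \<le> 1 / 2"
proof (rule ccontr)
  let ?v = "(cut n ^^ k) x"
  assume "\<not> nrm ?v \<le> 1 / 2"
  \<comment> \<open>As \<open>?v\<close> is longer than 1/2, the absolute error
    \<open>\<tau>\<close> between \<open>?v\<close> and \<open>A ?v\<close> is a relative error of
    at most \<open>2 * \<tau>\<close>. Hence the powers of \<open>A\<close> shrink \<open>?v\<close>
    slowly, too slowly for the bound of order 1/\<open>k\<close> on the image of \<open>?v\<close>
    under \<open>A ^^ n\<close>. The 4 in the hypothesis on \<open>k\<close> is the square of the 2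
    in this lower bound.\<close>
  then have v: "nrm ?v > 1 / 2" by simp
  have \<tau>0: "\<tau> \<ge> 0" using x nrm_nonneg[of "x - A x"] by (meson A_mem diff_mem order_trans)
  have "A ?v = (cut n ^^ k) (A x)" using power_cut_power[of x 1 k n] x by simp
  then have "?v - A ?v = (cut n ^^ k) (x - A x)" using x by (simp add: cut_power_diff)
  then have "nrm (?v - A ?v) \<le> \<tau>" using cut_power_contraction[of "x - A x" k n] x by simp
  then have "nrm ?v \<le> nrm (A ?v) + \<tau>" using nrm_triangle_le[of ?v "A ?v"] x by simp
  moreover have "\<tau> \<le> 2 * \<tau> * nrm ?v" using v \<tau>0 mult_left_mono[of "1/2" "nrm ?v" "2 * \<tau>"] by simp
  ultimately have "(1 - 2 * \<tau>) * nrm ?v \<le> nrm (A ?v)" by (simp add: algebra_simps)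
  then have "(1 - 2 * \<tau>) ^ n * nrm ?v \<le> nrm ((A ^^ n) ?v)"
    using x \<tau> v by (intro power_lower_bound) auto
  moreover have "(1 - 2 * \<tau>) ^ n * (1 / 2) \<le> (1 - 2 * \<tau>) ^ n * nrm ?v"
    using v \<tau> by (intro mult_left_mono) auto
  ultimately have "(1 - 2 * \<tau>) ^ n * (1 / 2) \<le> nrm ((A ^^ n) ?v)"
    by (rule order_trans[rotated])
  then have "((1 - 2 * \<tau>) ^ n * (1 / 2))\<^sup>2 \<le> (nrm ((A ^^ n) ?v))\<^sup>2"
    using \<tau> by (intro power_mono) auto
  then have "(1 - 2 * \<tau>) ^ (2 * n) / 4 \<le> (nrm ((A ^^ n) ?v))\<^sup>2"
    by (simp add: power_mult_distrib power_divide power_mult[symmetric] mult.commute)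
  then have "k * ((1 - 2 * \<tau>) ^ (2 * n) / 4) \<le> k * (nrm ((A ^^ n) ?v))\<^sup>2"
    by (intro mult_left_mono) auto
  also have "\<dots> \<le> 1" using power_cut_power_bound[of x k n] x by simp
  finally show False using k by simp
qed

text \<open>Consecutive iterates differ by \<open>A^(2n)\<close> applied to a vector no longer than
  \<open>x\<close>, and there are \<open>k\<close> steps. Here \<open>\<rho>\<close> bounds the
  operator norm of \<open>A\<close>.\<close>

lemma nrm_diff_cut_power:
  assumes x: "x \<in> V" and \<rho>: "0 \<le> \<rho>" "\<And>x. x \<in> V \<Longrightarrow> nrm (A x) \<le> \<rho> * nrm x"
  shows "nrm (x - (cut n ^^ k) x) \<le> k * \<rho> ^ (2 * n) * nrm x"
proof (induction k)
  case (Suc k)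
  have pow: "nrm ((A ^^ m) y) \<le> \<rho> ^ m * nrm y" if "y \<in> V" for y m
  proof (induction m)
    case (Suc m)
    have "nrm ((A ^^ Suc m) y) \<le> \<rho> * nrm ((A ^^ m) y)" using that \<rho> by simp
    also have "\<dots> \<le> \<rho> * (\<rho> ^ m * nrm y)" using Suc \<rho> by (intro mult_left_mono) auto
    finally show ?case by (simp add: mult_ac)
  qed simp
  let ?y = "(cut n ^^ k) x"
  have "x - (cut n ^^ Suc k) x = (x - ?y) + (A ^^ (n + n)) ?y"
    by (simp add: cut_def funpow_add)
  then have "nrm (x - (cut n ^^ Suc k) x) \<le> nrm (x - ?y) + nrm ((A ^^ (n + n)) ?y)"
    using x by (simp only:) (intro nrm_triangle; simp)
  also have "nrm ((A ^^ (n + n)) ?y) \<le> \<rho> ^ (n + n) * nrm ?y" using pow x by simp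
  also have "\<dots> \<le> \<rho> ^ (n + n) * nrm x" using cut_power_contraction x \<rho> by (intro mult_left_mono) auto
  finally show ?case using Suc by (simp add: algebra_simps mult_2 mult_2_right)
qed simp

end

section \<open>Square-integrable functions\<close>

definition L2 :: "'a measure \<Rightarrow> ('a \<Rightarrow> real) set" where
  "L2 M = {f \<in> borel_measurable M. integrable M (\<lambda>x. (f x)\<^sup>2)}"

definition l2ip :: "'a measure \<Rightarrow> ('a \<Rightarrow> real) \<Rightarrow> ('a \<Rightarrow> real) \<Rightarrow> real" where
  "l2ip M f g = (\<integral>x. f x * g x \<partial>M)"

lemma L2_measurable [measurable_dest, intro]: "f \<in> L2 M \<Longrightarrow> f \<in> borel_measurable M"
  by (simp add: L2_def)

lemma L2_integrable_power2: "f \<in> L2 M \<Longrightarrow> integrable M (\<lambda>x. (f x)\<^sup>2)"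
  by (simp add: L2_def)

lemma L2_integrable_mult:
  assumes "f \<in> L2 M" "g \<in> L2 M"
  shows "integrable M (\<lambda>x. f x * g x)"
proof (rule Bochner_Integration.integrable_bound)
  show "integrable M (\<lambda>x. (f x)\<^sup>2 + (g x)\<^sup>2)"
    using assms by (auto simp: L2_def)
  have "\<bar>a * b\<bar> \<le> a\<^sup>2 + b\<^sup>2" for a b :: real
    using sum_squares_bound[of a b] sum_squares_bound[of a "- b"] zero_le_power2[of a] zero_le_power2[of b]
    unfolding power2_minus by linarith
  then show "AE x in M. norm (f x * g x) \<le> norm ((f x)\<^sup>2 + (g x)\<^sup>2)" by simp
qed (use assms in measurable)

lemma L2_add: "f \<in> L2 M \<Longrightarrow> g \<in> L2 M \<Longrightarrow> f + g \<in> L2 M"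
proof -
  assume fg: "f \<in> L2 M" "g \<in> L2 M"
  have "integrable M (\<lambda>x. (f x)\<^sup>2 + 2 * (f x * g x) + (g x)\<^sup>2)"
    using fg L2_integrable_mult[OF fg] by (auto simp: L2_def)
  also have "(\<lambda>x. (f x)\<^sup>2 + 2 * (f x * g x) + (g x)\<^sup>2) = (\<lambda>x. ((f + g) x)\<^sup>2)"
    by (auto simp: power2_eq_square algebra_simps)
  finally show ?thesis using fg by (auto simp: L2_def plus_fun_def)
qed

lemma L2_scale: "f \<in> L2 M \<Longrightarrow> c *\<^sub>R f \<in> L2 M"
  by (auto simp: L2_def scaleR_fun_def power_mult_distrib)

interpretation L2: semi_inner "L2 M" "l2ip M" for M :: "'a measure"
proof
  show "subspace (L2 M)"
    by (rule subspaceI) (auto simp: L2_add L2_scale, simp add: L2_def zero_fun_def)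
  fix x y z :: "'a \<Rightarrow> real" and c :: real
  assume x: "x \<in> L2 M"
  show "0 \<le> l2ip M x x" by (simp add: l2ip_def)
  assume y: "y \<in> L2 M"
  show "l2ip M (c *\<^sub>R x) y = c * l2ip M x y" by (simp add: l2ip_def mult.assoc)
  show "l2ip M x y = l2ip M y x" by (simp add: l2ip_def mult.commute)
  assume z: "z \<in> L2 M"
  show "l2ip M (x + y) z = l2ip M x z + l2ip M y z"
    using L2_integrable_mult[OF x z] L2_integrable_mult[OF y z]
    by (simp add: l2ip_def distrib_right)
qed

lemma l2ip_cong:
  "(\<And>x. x \<in> space M \<Longrightarrow> f x = f' x) \<Longrightarrow> (\<And>x. x \<in> space M \<Longrightarrow> g x = g' x) \<Longrightarrow> l2ip M f g = l2ip M f' g'"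
  unfolding l2ip_def by (intro Bochner_Integration.integral_cong) auto

lemma L2_nrm_cong: "(\<And>x. x \<in> space M \<Longrightarrow> f x = f' x) \<Longrightarrow> L2.nrm M f = L2.nrm M f'"
  unfolding L2.nrm_def by (simp cong: l2ip_cong)

lemma L2_nrm_power2: "(L2.nrm M f)\<^sup>2 = (\<integral>x. (f x)\<^sup>2 \<partial>M)"
  by (simp add: L2.nrm_def l2ip_def power2_eq_square[symmetric])

lemma (in finite_measure) L2_bounded:
  assumes "f \<in> borel_measurable M" "\<And>x. x \<in> space M \<Longrightarrow> \<bar>f x\<bar> \<le> B"
  shows "f \<in> L2 M"
  unfolding L2_def
proof (safe intro!: integrable_const_bound[where B = "B\<^sup>2"])
  have "(f x)\<^sup>2 \<le> B\<^sup>2" if "x \<in> space M" for x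
    using assms(2)[OF that] by (metis abs_ge_zero power2_abs power_mono)
  then show "AE x in M. norm ((f x)\<^sup>2) \<le> B\<^sup>2" by (intro AE_I2) simp
qed (use assms in measurable)

lemma (in finite_measure) L2_integrable: "f \<in> L2 M \<Longrightarrow> integrable M f"
  by (rule square_integrable_imp_integrable) (auto simp: L2_def)

lemma (in prob_space) integral_abs_le_L2_nrm:
  assumes "f \<in> L2 M"
  shows "(\<integral>x. \<bar>f x\<bar> \<partial>M) \<le> L2.nrm M f"
proof -
  have a: "(\<lambda>x. \<bar>f x\<bar>) \<in> L2 M" using assms by (auto simp: L2_def)
  have o: "(\<lambda>_. 1) \<in> L2 M" by (rule L2_bounded[of _ 1]) auto
  have "(\<integral>x. \<bar>f x\<bar> \<partial>M) = l2ip M (\<lambda>x. \<bar>f x\<bar>) (\<lambda>_. 1)" by (simp add: l2ip_def)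
  also have "\<dots> \<le> L2.nrm M (\<lambda>x. \<bar>f x\<bar>) * L2.nrm M (\<lambda>_. 1)"
    using L2.Cauchy_Schwarz[OF a o] by simp
  also have "L2.nrm M (\<lambda>_. 1) = 1" by (simp add: L2.nrm_def l2ip_def prob_space)
  also have "L2.nrm M (\<lambda>x. \<bar>f x\<bar>) = L2.nrm M f" by (simp add: L2.nrm_def l2ip_def)
  finally show ?thesis by simp
qed

text \<open>Riesz-Fischer: along a subsequence the successive differences have summable norms, so
  the subsequence converges almost everywhere, and Fatou's lemma carries the Cauchy estimates over
  to the limit.\<close>

lemma (in prob_space) L2_complete:
  assumes f: "\<And>n. f n \<in> L2 M"
    and Cauchy: "\<And>e. e > 0 \<Longrightarrow> \<exists>N. \<forall>m\<ge>N. \<forall>n\<ge>N. L2.nrm M (f m - f n) < e"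
  obtains g where "g \<in> L2 M" "(\<lambda>n. L2.nrm M (f n - g)) \<longlonglongrightarrow> 0"
proof -
  have "\<forall>k. \<exists>N. \<forall>m\<ge>N. \<forall>n\<ge>N. L2.nrm M (f m - f n) < (1 / 2) ^ k" using Cauchy by simp
  then obtain N where N: "\<And>k m n. m \<ge> N k \<Longrightarrow> n \<ge> N k \<Longrightarrow> L2.nrm M (f m - f n) < (1 / 2) ^ k" by metis
  \<comment> \<open>The partial sums make the indices nondecreasing and at least \<open>N k\<close>;
    the summand \<open>k\<close> makes them tend to infinity.\<close>
  define r where "r k = (\<Sum>i\<le>k. N i) + k" for k
  have r: "r k \<ge> N k" "r k \<ge> k" "r (Suc k) \<ge> r k" for k
    by (auto simp: r_def intro: member_le_sum[of k "{..k}" N, THEN trans_le_add1])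
  define h where "h k = f (r (Suc k)) - f (r k)" for k
  have h: "h k \<in> L2 M" for k using f by (simp add: h_def)
  have h_small: "L2.nrm M (h k) \<le> (1 / 2) ^ k" for k
    unfolding h_def using N[of k "r (Suc k)" "r k"] r[of k] by (simp add: less_imp_le)
  have [measurable]: "f n \<in> borel_measurable M" "h n \<in> borel_measurable M" for n
    using f h by auto
  have nn: "(\<integral>\<^sup>+x. ennreal \<bar>h k x\<bar> \<partial>M) \<le> ennreal ((1 / 2) ^ k)" for k
    using integral_abs_le_L2_nrm[OF h, of k] h_small[of k] L2_integrable[OF h, of k]
    by (subst nn_integral_eq_integral) (auto intro: ennreal_leI)
  have "(\<integral>\<^sup>+x. (\<Sum>k. ennreal \<bar>h k x\<bar>) \<partial>M) = (\<Sum>k. \<integral>\<^sup>+x. ennreal \<bar>h k x\<bar> \<partial>M)"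
    by (rule nn_integral_suminf) measurable
  also have "\<dots> \<le> (\<Sum>k. ennreal ((1 / 2) ^ k))"
    using nn by (intro suminf_le) auto
  also have "\<dots> = ennreal (\<Sum>k. (1 / 2) ^ k)"
    by (rule suminf_ennreal2) (auto simp: summable_geometric)
  finally have "(\<integral>\<^sup>+x. (\<Sum>k. ennreal \<bar>h k x\<bar>) \<partial>M) < \<infinity>"
    by (rule le_less_trans) simp
  then have "(\<integral>\<^sup>+x. (\<Sum>k. ennreal \<bar>h k x\<bar>) \<partial>M) \<noteq> \<infinity>" by simp
  then have "AE x in M. (\<Sum>k. ennreal \<bar>h k x\<bar>) \<noteq> \<infinity>"
    by (intro nn_integral_PInf_AE) measurable
  then have conv: "AE x in M. (\<lambda>k. f (r k) x) \<longlonglongrightarrow> lim (\<lambda>k. f (r k) x)"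
  proof (rule AE_mp, intro AE_I2 impI)
    fix x assume "(\<Sum>k. ennreal \<bar>h k x\<bar>) \<noteq> \<infinity>"
    then have "summable (\<lambda>k. \<bar>h k x\<bar>)" by (intro summable_suminf_not_top) auto
    then have "summable (\<lambda>k. h k x)" by (rule summable_rabs_cancel)
    then have "convergent (\<lambda>n. \<Sum>k<n. h k x)" by (simp add: summable_iff_convergent)
    moreover have "(\<Sum>k<n. h k x) = f (r n) x - f (r 0) x" for n
      by (simp add: h_def sum_lessThan_telescope[of "\<lambda>k. f (r k) x"])
    ultimately have "convergent (\<lambda>n. f (r n) x - f (r 0) x)" by simp
    then have "convergent (\<lambda>n. f (r n) x)"
      using convergent_add[OF _ convergent_const[of "f (r 0) x"]] by fastforce
    then show "(\<lambda>k. f (r k) x) \<longlonglongrightarrow> lim (\<lambda>k. f (r k) x)" by (simp add: convergent_LIMSEQ_iff)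
  qed
  \<comment> \<open>Where the subsequence diverges, which is a null set, \<open>lim\<close> is some
    unspecified value, but the function is measurable all the same.\<close>
  define g where "g x = lim (\<lambda>k. f (r k) x)" for x
  have [measurable]: "g \<in> borel_measurable M" unfolding g_def by measurable
  \<comment> \<open>Fatou's lemma, applied to the squares of \<open>f n - f (r k)\<close> as
    \<open>k\<close> grows.\<close>
  have key: "f n - g \<in> L2 M \<and> L2.nrm M (f n - g) \<le> e"
    if e: "e > 0" and n: "\<And>m. m \<ge> n \<Longrightarrow> L2.nrm M (f n - f m) < e" for n e
  proof -
    have "(\<integral>\<^sup>+x. ennreal ((f n x - g x)\<^sup>2) \<partial>M) = (\<integral>\<^sup>+x. liminf (\<lambda>k. ennreal ((f n x - f (r k) x)\<^sup>2)) \<partial>M)"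
    proof (rule nn_integral_cong_AE, use conv in eventually_elim)
      case (elim x)
      then have "(\<lambda>k. ennreal ((f n x - f (r k) x)\<^sup>2)) \<longlonglongrightarrow> ennreal ((f n x - g x)\<^sup>2)"
        unfolding g_def by (intro tendsto_intros)
      then show ?case by (rule lim_imp_Liminf[OF sequentially_bot, symmetric])
    qed
    also have "\<dots> \<le> liminf (\<lambda>k. \<integral>\<^sup>+x. ennreal ((f n x - f (r k) x)\<^sup>2) \<partial>M)"
      by (rule nn_integral_liminf) measurable
    also have "\<dots> \<le> limsup (\<lambda>k. \<integral>\<^sup>+x. ennreal ((f n x - f (r k) x)\<^sup>2) \<partial>M)"
      by (rule Liminf_le_Limsup) simp
    also have "\<dots> \<le> ennreal (e\<^sup>2)"
    proof (rule Limsup_bounded, rule eventually_sequentiallyI[of n])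
      fix k assume "n \<le> k"
      then have "r k \<ge> n" using r(2)[of k] by linarith
      then have "L2.nrm M (f n - f (r k)) < e" by (rule n)
      then have "(L2.nrm M (f n - f (r k)))\<^sup>2 \<le> e\<^sup>2" using f by (intro power_mono) auto
      moreover have "(\<integral>\<^sup>+x. ennreal ((f n x - f (r k) x)\<^sup>2) \<partial>M) = ennreal ((L2.nrm M (f n - f (r k)))\<^sup>2)"
        using L2_integrable_power2[of "f n - f (r k)" M] f
        by (subst nn_integral_eq_integral) (auto simp: L2_nrm_power2)
      ultimately show "(\<integral>\<^sup>+x. ennreal ((f n x - f (r k) x)\<^sup>2) \<partial>M) \<le> ennreal (e\<^sup>2)"
        by (simp add: ennreal_leI)
    qed
    finally have le: "(\<integral>\<^sup>+x. ennreal ((f n x - g x)\<^sup>2) \<partial>M) \<le> ennreal (e\<^sup>2)" .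
    then have int: "integrable M (\<lambda>x. (f n x - g x)\<^sup>2)"
      by (intro integrableI_bounded) (auto intro: le_less_trans)
    then have L: "f n - g \<in> L2 M" by (auto simp: L2_def fun_diff_def)
    have "ennreal (\<integral>x. (f n x - g x)\<^sup>2 \<partial>M) \<le> ennreal (e\<^sup>2)"
      using le int by (simp add: nn_integral_eq_integral)
    then have "(\<integral>x. (f n x - g x)\<^sup>2 \<partial>M) \<le> e\<^sup>2" by simp
    then have "(L2.nrm M (f n - g))\<^sup>2 \<le> e\<^sup>2" by (simp add: L2_nrm_power2)
    then have "L2.nrm M (f n - g) \<le> e" by (rule power2_le_imp_le) (use e in simp)
    then show ?thesis using L by blast
  qed
  show ?thesis
  proof (rule that[of g])
    obtain K where K: "\<And>m n. m \<ge> K \<Longrightarrow> n \<ge> K \<Longrightarrow> L2.nrm M (f m - f n) < 1" using Cauchy[of 1] by auto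
    have "f K - g \<in> L2 M" using key[of 1 K] K by auto
    then show g: "g \<in> L2 M" using L2.diff_mem[OF f[of K], of "f K - g"] by simp
    show "(\<lambda>n. L2.nrm M (f n - g)) \<longlonglongrightarrow> 0"
    proof (rule LIMSEQ_I)
      fix e :: real assume "e > 0"
      then obtain K where K: "\<And>m n. m \<ge> K \<Longrightarrow> n \<ge> K \<Longrightarrow> L2.nrm M (f m - f n) < e / 2"
        using Cauchy[of "e / 2"] by auto
      have "norm (L2.nrm M (f n - g) - 0) < e" if "n \<ge> K" for n
        using key[of "e / 2" n] K that \<open>e > 0\<close> f g by simp
      then show "\<exists>K. \<forall>n\<ge>K. norm (L2.nrm M (f n - g) - 0) < e" by blast
    qed
  qed
qed

section \<open>The group ring acting on square-integrable functions\<close>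

text \<open>The real group ring; off the carrier its elements vanish.\<close>

definition fin_supp :: "('g, 'z) monoid_scheme \<Rightarrow> ('g \<Rightarrow> real) set" where
  "fin_supp G = {F. finite {g. F g \<noteq> 0} \<and> {g. F g \<noteq> 0} \<subseteq> carrier G}"

text \<open>Summing over the support of the first argument keeps the sum finite without reference to
  the group; on \<open>fin_supp G\<close> the form is symmetric.\<close>

definition fsip :: "('g \<Rightarrow> real) \<Rightarrow> ('g \<Rightarrow> real) \<Rightarrow> real" where
  "fsip F F' = (\<Sum>g | F g \<noteq> 0. F g * F' g)"

lemma fsip_superset:
  assumes "finite E" "{g. F g \<noteq> 0} \<subseteq> E"
  shows "fsip F F' = (\<Sum>g\<in>E. F g * F' g)"
  unfolding fsip_def using assms by (intro sum.mono_neutral_left) auto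

lemma fin_supp_add: "F \<in> fin_supp G \<Longrightarrow> F' \<in> fin_supp G \<Longrightarrow> F + F' \<in> fin_supp G"
proof -
  assume "F \<in> fin_supp G" "F' \<in> fin_supp G"
  moreover have "{g. (F + F') g \<noteq> 0} \<subseteq> {g. F g \<noteq> 0} \<union> {g. F' g \<noteq> 0}" by auto
  ultimately show ?thesis unfolding fin_supp_def by (blast intro: finite_subset)
qed

lemma fin_supp_scale: "F \<in> fin_supp G \<Longrightarrow> c *\<^sub>R F \<in> fin_supp G"
  unfolding fin_supp_def
  by (auto intro: finite_subset[of _ "{g. F g \<noteq> 0}"])

interpretation FS: semi_inner "fin_supp G" fsip for G :: "('g, 'z) monoid_scheme"
proof
  show "subspace (fin_supp G)"
    by (rule subspaceI) (auto simp: fin_supp_add fin_supp_scale, simp add: fin_supp_def)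
  fix x y z :: "'g \<Rightarrow> real" and c :: real
  assume x: "x \<in> fin_supp G"
  show "0 \<le> fsip x x" by (simp add: fsip_def sum_nonneg)
  assume y: "y \<in> fin_supp G"
  define E where "E = {g. x g \<noteq> 0} \<union> {g. y g \<noteq> 0}"
  have E: "finite E" "{g. x g \<noteq> 0} \<subseteq> E" "{g. y g \<noteq> 0} \<subseteq> E" "{g. (c *\<^sub>R x) g \<noteq> 0} \<subseteq> E"
      "{g. (x + y) g \<noteq> 0} \<subseteq> E"
    using x y by (auto simp: E_def fin_supp_def)
  show "fsip (c *\<^sub>R x) y = c * fsip x y"
    by (simp add: fsip_superset[OF E(1,2)] fsip_superset[OF E(1,4)] sum_distrib_left mult.assoc)
  show "fsip x y = fsip y x"
    by (simp add: fsip_superset[OF E(1,2)] fsip_superset[OF E(1,3)] mult.commute)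
  show "fsip (x + y) z = fsip x z + fsip y z"
    by (simp add: fsip_superset[OF E(1,2)] fsip_superset[OF E(1,3)] fsip_superset[OF E(1,5)]
        sum.distrib distrib_right)
qed

lemma fsnrm_power2: "F \<in> fin_supp G \<Longrightarrow> finite E \<Longrightarrow> {g. F g \<noteq> 0} \<subseteq> E \<Longrightarrow> (FS.nrm F)\<^sup>2 = (\<Sum>g\<in>E. (F g)\<^sup>2)"
  by (subst FS.nrm_power2) (auto simp: fsip_superset power2_eq_square)

text \<open>Multiplication by the group element \<open>h\<close> from the left in the group ring.
  The value 0 off the carrier keeps the support inside it, where the group operation is
  meaningful.\<close>

definition ltrans :: "('g, 'z) monoid_scheme \<Rightarrow> 'g \<Rightarrow> ('g \<Rightarrow> real) \<Rightarrow> 'g \<Rightarrow> real" where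
  "ltrans G h F = (\<lambda>g. if g \<in> carrier G then F (inv\<^bsub>G\<^esub> h \<otimes>\<^bsub>G\<^esub> g) else 0)"

context group
begin

lemma ltrans_supp:
  assumes "F \<in> fin_supp G" "h \<in> carrier G"
  shows "{g. ltrans G h F g \<noteq> 0} = (\<lambda>g. h \<otimes> g) ` {g. F g \<noteq> 0}"
proof (intro equalityI subsetI)
  fix g assume "g \<in> {g. ltrans G h F g \<noteq> 0}"
  then have "g \<in> carrier G" "F (inv h \<otimes> g) \<noteq> 0" by (auto simp: ltrans_def split: if_splits)
  moreover from this have "g = h \<otimes> (inv h \<otimes> g)" using assms by (simp add: m_assoc[symmetric])
  ultimately show "g \<in> (\<lambda>g. h \<otimes> g) ` {g. F g \<noteq> 0}" by blast
next
  fix g assume "g \<in> (\<lambda>g. h \<otimes> g) ` {g. F g \<noteq> 0}"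
  then obtain k where k: "F k \<noteq> 0" "g = h \<otimes> k" by auto
  then have "k \<in> carrier G" using assms by (auto simp: fin_supp_def)
  then show "g \<in> {g. ltrans G h F g \<noteq> 0}" using assms k by (simp add: ltrans_def m_assoc[symmetric])
qed

lemma ltrans_mem: "F \<in> fin_supp G \<Longrightarrow> h \<in> carrier G \<Longrightarrow> ltrans G h F \<in> fin_supp G"
  using ltrans_supp[of F h] by (auto simp: fin_supp_def)

lemma sum_ltrans:
  fixes c :: "'a \<Rightarrow> 'v::real_vector"
  assumes "F \<in> fin_supp G" "h \<in> carrier G"
  shows "(\<Sum>g | ltrans G h F g \<noteq> 0. ltrans G h F g *\<^sub>R c g) = (\<Sum>g | F g \<noteq> 0. F g *\<^sub>R c (h \<otimes> g))"
proof -
  have sub: "{g. F g \<noteq> 0} \<subseteq> carrier G" using assms by (simp add: fin_supp_def)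
  then have "inj_on (\<lambda>g. h \<otimes> g) {g. F g \<noteq> 0}"
    using inj_on_subset[OF inj_on_cmult[OF assms(2)]] by blast
  then show ?thesis
    unfolding ltrans_supp[OF assms]
    using sub assms by (subst sum.reindex) (auto simp: ltrans_def m_assoc[symmetric] intro!: sum.cong)
qed

lemma fsip_ltrans:
  assumes "F \<in> fin_supp G" "F' \<in> fin_supp G" "h \<in> carrier G"
  shows "fsip (ltrans G h F) F' = fsip F (ltrans G (inv h) F')"
  using sum_ltrans[OF assms(1,3), of F'] assms
  unfolding fsip_def real_scaleR_def by (auto simp: ltrans_def fin_supp_def intro!: sum.cong)

lemma ltrans_ltrans:
  "F \<in> fin_supp G \<Longrightarrow> h \<in> carrier G \<Longrightarrow> k \<in> carrier G \<Longrightarrow> ltrans G h (ltrans G k F) = ltrans G (h \<otimes> k) F"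
  by (auto simp: ltrans_def inv_mult_group m_assoc)

lemma ltrans_one: "F \<in> fin_supp G \<Longrightarrow> ltrans G \<one> F = F"
  by (rule ext) (auto simp: ltrans_def fin_supp_def)

lemma fsnrm_ltrans: "F \<in> fin_supp G \<Longrightarrow> h \<in> carrier G \<Longrightarrow> FS.nrm (ltrans G h F) = FS.nrm F"
  by (simp add: FS.nrm_def fsip_ltrans ltrans_mem ltrans_ltrans ltrans_one)

lemma ltrans_diff: "ltrans G h (F - F') = ltrans G h F - ltrans G h F'"
  and ltrans_scale: "ltrans G h (c *\<^sub>R F) = c *\<^sub>R ltrans G h F"
  by (auto simp: ltrans_def fun_eq_iff sum_fun_apply)

end

section \<open>The Koopman representation and the action of the group ring through it\<close>

definition koop :: "('g, 'z) monoid_scheme \<Rightarrow> ('g \<Rightarrow> 'a \<Rightarrow> 'a) \<Rightarrow> 'g \<Rightarrow> ('a \<Rightarrow> real) \<Rightarrow> 'a \<Rightarrow> real" where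
  "koop G act g f = (\<lambda>x. f (act (inv\<^bsub>G\<^esub> g) x))"

definition conv ::
    "('g, 'z) monoid_scheme \<Rightarrow> ('g \<Rightarrow> 'a \<Rightarrow> 'a) \<Rightarrow> ('g \<Rightarrow> real) \<Rightarrow> ('a \<Rightarrow> real) \<Rightarrow> 'a \<Rightarrow> real" where
  "conv G act F f = (\<Sum>g | F g \<noteq> 0. F g *\<^sub>R koop G act g f)"

lemma koop_diff: "koop G act g (f - f') = koop G act g f - koop G act g f'"
  and koop_scale: "koop G act g (c *\<^sub>R f) = c *\<^sub>R koop G act g f"
  and koop_sum: "koop G act g (\<Sum>i\<in>I. h i) = (\<Sum>i\<in>I. koop G act g (h i))"
  by (auto simp: koop_def fun_eq_iff sum_fun_apply)

lemma conv_superset: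
  assumes "finite E" "{g. F g \<noteq> 0} \<subseteq> E"
  shows "conv G act F f = (\<Sum>g\<in>E. F g *\<^sub>R koop G act g f)"
  unfolding conv_def using assms by (intro sum.mono_neutral_left) auto

lemma conv_add_left:
  assumes "F \<in> fin_supp G" "F' \<in> fin_supp G"
  shows "conv G act (F + F') f = conv G act F f + conv G act F' f"
proof -
  define E where "E = {g. F g \<noteq> 0} \<union> {g. F' g \<noteq> 0}"
  have E: "finite E" "{g. F g \<noteq> 0} \<subseteq> E" "{g. F' g \<noteq> 0} \<subseteq> E" "{g. (F + F') g \<noteq> 0} \<subseteq> E"
    using assms by (auto simp: E_def fin_supp_def)
  show ?thesis
    by (simp only: conv_superset[OF E(1,2)] conv_superset[OF E(1,3)] conv_superset[OF E(1,4)]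
        plus_fun_apply scaleR_add_left sum.distrib)
qed

lemma conv_scale_left: "conv G act (c *\<^sub>R F) f = c *\<^sub>R conv G act F f"
  by (cases "c = 0") (auto simp: conv_def scaleR_sum_right)

lemma conv_diff_left:
  assumes "F \<in> fin_supp G" "F' \<in> fin_supp G"
  shows "conv G act (F - F') f = conv G act F f - conv G act F' f"
  using conv_add_left[OF assms(1) FS.scale_mem[OF assms(2)], of act "-1" f]
    conv_scale_left[of G act "-1" F' f]
  by simp

lemma conv_sum_left:
  assumes "\<And>i. i \<in> I \<Longrightarrow> F i \<in> fin_supp G"
  shows "conv G act (\<Sum>i\<in>I. F i) f = (\<Sum>i\<in>I. conv G act (F i) f)"
  using assms
proof (induction I rule: infinite_finite_induct)
  case (insert i I)
  have "conv G act (F i + sum F I) f = conv G act (F i) f + conv G act (sum F I) f"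
    using insert.prems by (intro conv_add_left[of _ G] FS.sum_mem) auto
  also have "conv G act (sum F I) f = (\<Sum>i\<in>I. conv G act (F i) f)"
    using insert.prems by (intro insert.IH) auto
  finally show ?case unfolding sum.insert[OF insert.hyps] .
qed (auto simp: conv_def)

lemma conv_diff_right: "conv G act F (f - f') = conv G act F f - conv G act F f'"
  by (simp add: conv_def koop_diff scaleR_diff_right sum_subtractf)

locale pmp_system = group G for G :: "('g, 'z) monoid_scheme" (structure) +
  fixes M :: "'a measure" and act :: "'g \<Rightarrow> 'a \<Rightarrow> 'a"
  assumes pmp: "pmp_action G M act"
begin

sublocale prob_space M
  using pmp by (simp add: pmp_action_def)

lemma group_action: "group_action G (space M) act"
  using pmp by (simp add: pmp_action_def)

lemma act_space [simp, intro]: "g \<in> carrier G \<Longrightarrow> x \<in> space M \<Longrightarrow> act g x \<in> space M"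
  using group_action.element_image[OF group_action] by blast

lemma act_one [simp]: "x \<in> space M \<Longrightarrow> act \<one> x = x"
  using group_action.id_eq_one[OF group_action] by (metis restrict_apply')

lemma act_mult: "g \<in> carrier G \<Longrightarrow> h \<in> carrier G \<Longrightarrow> x \<in> space M \<Longrightarrow> act (g \<otimes> h) x = act g (act h x)"
  using group_action.composition_rule[OF group_action] by blast

lemma act_measurable [measurable]: "g \<in> carrier G \<Longrightarrow> act g \<in> measurable M M"
  using pmp by (simp add: pmp_action_def)

lemma distr_act: "g \<in> carrier G \<Longrightarrow> distr M M (act g) = M"
  using pmp by (simp add: pmp_action_def)

lemma act_inv_cancel [simp]:
  "g \<in> carrier G \<Longrightarrow> x \<in> space M \<Longrightarrow> act g (act (inv g) x) = x"
  "g \<in> carrier G \<Longrightarrow> x \<in> space M \<Longrightarrow> act (inv g) (act g x) = x"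
  using act_mult[of g "inv g" x] act_mult[of "inv g" g x] by auto

lemma act_image_eq: "g \<in> carrier G \<Longrightarrow> A \<subseteq> space M \<Longrightarrow> act g ` A = act (inv g) -` A \<inter> space M"
  by (force simp: image_iff)

lemma integral_act:
  fixes f :: "'a \<Rightarrow> real"
  assumes "g \<in> carrier G" "f \<in> borel_measurable M"
  shows "(\<integral>x. f (act g x) \<partial>M) = (\<integral>x. f x \<partial>M)"
proof -
  have "(\<integral>x. f x \<partial>M) = (\<integral>x. f x \<partial>distr M M (act g))" by (simp add: distr_act assms)
  also have "\<dots> = (\<integral>x. f (act g x) \<partial>M)" using assms by (intro integral_distr) auto
  finally show ?thesis by simp
qed

lemma integrable_act:
  fixes f :: "'a \<Rightarrow> real"
  assumes "g \<in> carrier G" "integrable M f"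
  shows "integrable M (\<lambda>x. f (act g x))"
  using integrable_distr[of "act g" M M f] assms by (simp add: distr_act)

lemma koop_L2: "g \<in> carrier G \<Longrightarrow> f \<in> L2 M \<Longrightarrow> koop G act g f \<in> L2 M"
  using integrable_act[of "inv g" "\<lambda>x. (f x)\<^sup>2"] by (auto simp: L2_def koop_def)

lemma koop_ip:
  assumes "g \<in> carrier G" "f \<in> L2 M" "f' \<in> L2 M"
  shows "l2ip M (koop G act g f) (koop G act g f') = l2ip M f f'"
proof -
  have [measurable]: "f \<in> borel_measurable M" "f' \<in> borel_measurable M" using assms by auto
  show ?thesis
    using integral_act[of "inv g" "\<lambda>x. f x * f' x"] assms unfolding l2ip_def koop_def by simp
qed

lemma koop_nrm: "g \<in> carrier G \<Longrightarrow> f \<in> L2 M \<Longrightarrow> L2.nrm M (koop G act g f) = L2.nrm M f"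
  by (simp add: L2.nrm_def koop_ip)

lemma koop_koop:
  assumes "g \<in> carrier G" "h \<in> carrier G" "x \<in> space M"
  shows "koop G act g (koop G act h f) x = koop G act (g \<otimes> h) f x"
  using assms by (simp add: koop_def act_mult inv_mult_group)

lemma koop_adjoint:
  assumes "g \<in> carrier G" "f \<in> L2 M" "f' \<in> L2 M"
  shows "l2ip M (koop G act g f) f' = l2ip M f (koop G act (inv g) f')"
proof -
  have "l2ip M (koop G act g f) f' = l2ip M (koop G act g f) (koop G act g (koop G act (inv g) f'))"
    using assms by (intro l2ip_cong) (auto simp: koop_koop, simp add: koop_def)
  also have "\<dots> = l2ip M f (koop G act (inv g) f')" using assms by (intro koop_ip) (auto intro: koop_L2)
  finally show ?thesis .
qed

lemma integral_koop: "g \<in> carrier G \<Longrightarrow> f \<in> borel_measurable M \<Longrightarrow> (\<integral>x. koop G act g f x \<partial>M) = (\<integral>x. f x \<partial>M)"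
  unfolding koop_def by (rule integral_act) auto

lemma conv_L2: "F \<in> fin_supp G \<Longrightarrow> f \<in> L2 M \<Longrightarrow> conv G act F f \<in> L2 M"
  unfolding conv_def by (intro L2.sum_mem L2.scale_mem koop_L2) (auto simp: fin_supp_def)

lemma integral_conv:
  assumes "F \<in> fin_supp G" "f \<in> L2 M"
  shows "(\<integral>x. conv G act F f x \<partial>M) = (\<Sum>g | F g \<noteq> 0. F g) * (\<integral>x. f x \<partial>M)"
proof -
  have c: "F g \<noteq> 0 \<Longrightarrow> g \<in> carrier G" for g using assms by (auto simp: fin_supp_def)
  have "(\<integral>x. conv G act F f x \<partial>M) = (\<Sum>g | F g \<noteq> 0. F g * (\<integral>x. koop G act g f x \<partial>M))"
    unfolding conv_def sum_fun_apply
  proof (subst Bochner_Integration.integral_sum)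
    show "integrable M ((F g *\<^sub>R koop G act g f))" if "g \<in> {g. F g \<noteq> 0}" for g
      using c that assms(2) by (intro L2_integrable L2.scale_mem koop_L2) auto
  qed (simp add: scaleR_fun_def)
  also have "\<dots> = (\<Sum>g | F g \<noteq> 0. F g * (\<integral>x. f x \<partial>M))"
    using c assms by (intro sum.cong) (auto simp: integral_koop)
  finally show ?thesis by (simp add: sum_distrib_right)
qed

text \<open>Translates of \<open>F \<xi>\<close> are of the same form, with coefficients of the same
  2-norm. In this way an approximation of one vector is at once an approximation of all its
  translates.\<close>

lemma conv_ltrans:
  assumes "F \<in> fin_supp G" "h \<in> carrier G" "x \<in> space M"
  shows "conv G act (ltrans G h F) f x = koop G act h (conv G act F f) x"
proof -
  have "conv G act (ltrans G h F) f x = (\<Sum>g | ltrans G h F g \<noteq> 0. ltrans G h F g *\<^sub>R koop G act g f x)"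
    by (simp add: conv_def sum_fun_apply)
  also have "\<dots> = (\<Sum>g | F g \<noteq> 0. F g *\<^sub>R koop G act (h \<otimes> g) f x)"
    using assms by (rule_tac sum_ltrans)
  also have "\<dots> = (\<Sum>g | F g \<noteq> 0. F g *\<^sub>R koop G act h (koop G act g f) x)"
    using assms by (intro sum.cong) (auto simp: koop_koop fin_supp_def)
  finally show ?thesis by (simp add: conv_def koop_sum koop_scale sum_fun_apply)
qed

end

section \<open>Averaging over signs\<close>

text \<open>The terms for \<open>J\<close> and \<open>insert i J\<close>, where \<open>i\<close> is
  not in \<open>J\<close>, cancel.\<close>

lemma sum_Pow_flip_eq_0:
  fixes f :: "'a set \<Rightarrow> real"
  assumes "i \<in> I" "\<And>J. J \<subseteq> I \<Longrightarrow> i \<notin> J \<Longrightarrow> f (insert i J) = - f J" "finite I"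
  shows "(\<Sum>J\<in>Pow I. f J) = 0"
proof -
  have fin: "finite (Pow (I - {i}))" using assms by simp
  have "Pow I = Pow (I - {i}) \<union> insert i ` Pow (I - {i})"
    using assms(1) Pow_insert[of i "I - {i}"] by (simp add: insert_absorb)
  moreover have "Pow (I - {i}) \<inter> insert i ` Pow (I - {i}) = {}" by auto
  moreover have "inj_on (insert i) (Pow (I - {i}))" by (auto simp: inj_on_def)
  ultimately have "(\<Sum>J\<in>Pow I. f J) = (\<Sum>J\<in>Pow (I - {i}). f J) + (\<Sum>J\<in>Pow (I - {i}). f (insert i J))"
    using fin by (simp add: sum.union_disjoint sum.reindex)
  also have "(\<Sum>J\<in>Pow (I - {i}). f (insert i J)) = (\<Sum>J\<in>Pow (I - {i}). - f J)"
    using assms(2) by (intro sum.cong) auto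
  finally show ?thesis by (simp add: sum_negf)
qed

text \<open>A sign vector coded by the set of its positive coordinates. For a uniformly random
  subset \<open>J\<close> of \<open>I\<close> the coordinates in \<open>I\<close> are independent
  Rademacher signs.\<close>

definition sgn_of :: "'a set \<Rightarrow> 'a \<Rightarrow> real" where
  "sgn_of J j = (if j \<in> J then 1 else -1)"

lemma sgn_of_power2 [simp]: "(sgn_of J j)\<^sup>2 = 1" "sgn_of J j * sgn_of J j = 1"
  by (auto simp: sgn_of_def)

lemma sum_sgn_of: "finite I \<Longrightarrow> i \<in> I \<Longrightarrow> (\<Sum>J\<in>Pow I. sgn_of J i) = 0"
  by (rule sum_Pow_flip_eq_0[of i]) (auto simp: sgn_of_def)

lemma sum_sgn_of_mult:
  "finite I \<Longrightarrow> i \<in> I \<Longrightarrow> j \<in> I \<Longrightarrow>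
     (\<Sum>J\<in>Pow I. sgn_of J i * sgn_of J j) = (if i = j then 2 ^ card I else 0)"
proof (cases "i = j")
  case True
  then show "finite I \<Longrightarrow> ?thesis" by (simp add: card_Pow)
next
  case False
  then show "finite I \<Longrightarrow> i \<in> I \<Longrightarrow> j \<in> I \<Longrightarrow> ?thesis"
    by (subst sum_Pow_flip_eq_0[of i]) (auto simp: sgn_of_def)
qed

lemma mult_le_weighted_squares:
  fixes a b e :: real
  assumes "e > 0"
  shows "a * b \<le> e / 2 * a\<^sup>2 + b\<^sup>2 / (2 * e)"
proof -
  have "0 \<le> (e * a - b)\<^sup>2 / (2 * e)" using assms by simp
  also have "\<dots> = e / 2 * a\<^sup>2 + b\<^sup>2 / (2 * e) - a * b"
    using assms by (simp add: power2_eq_square field_simps)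
  finally show ?thesis by simp
qed

text \<open>
  Vectors close to the image under \<open>T\<close> of a bounded set cannot realize all sign patterns on a large
  set \<open>I\<close> when \<open>T\<close> has small Hilbert--Schmidt norm: pair them with the signs and average over all
  signs.
\<close>

lemma sign_patterns_bound:
  fixes T :: "'a \<Rightarrow> 'a \<Rightarrow> real" and x y :: "'a set \<Rightarrow> 'a \<Rightarrow> real" and b C t \<epsilon> \<kappa> :: real
  assumes X: "finite X" "I \<subseteq> X" and \<epsilon>: "\<epsilon> > 0" and \<kappa>: "\<kappa> \<ge> 0"
    and near: "\<And>J. J \<subseteq> I \<Longrightarrow> (\<Sum>j\<in>X. ((\<Sum>k\<in>X. T j k * y J k) - x J j)\<^sup>2) \<le> 4 * \<epsilon>\<^sup>2 * card X"
    and bounded: "\<And>J. J \<subseteq> I \<Longrightarrow> (\<Sum>k\<in>X. (y J k)\<^sup>2) \<le> C * card X"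
    and signs: "\<And>J j. J \<subseteq> I \<Longrightarrow> j \<in> I \<Longrightarrow> 0 \<le> sgn_of J j * (x J j - t)"
    and gap: "\<And>J. J \<subseteq> I \<Longrightarrow> card {j \<in> I. sgn_of J j * (x J j - t) < \<kappa>} \<le> b * card X"
    and HS: "(\<Sum>j\<in>X. \<Sum>k\<in>X. (T j k)\<^sup>2) \<le> 4 * \<epsilon>\<^sup>2 * card X"
  shows "\<kappa> * (card I - b * card X) \<le> \<epsilon> * (C / 2 + 5) * card X"
proof -
  have fI: "finite I" using X finite_subset by blast
  \<comment> \<open>The transpose of \<open>T\<close> applied to the sign vector of
    \<open>J\<close>. For a single \<open>J\<close> it may be long; its mean square over all
    \<open>J\<close> is at most the squared Hilbert-Schmidt norm of \<open>T\<close>.\<close>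
  define v where "v J k = (\<Sum>j\<in>I. sgn_of J j * T j k)" for J k
  let ?n = "real (card X)"
  \<comment> \<open>By \<open>signs\<close> every term is nonnegative, and by \<open>gap\<close> all
    but \<open>b * card X\<close> of them are at least \<open>\<kappa>\<close>.\<close>
  have lower: "\<kappa> * (card I - b * ?n) \<le> (\<Sum>j\<in>I. sgn_of J j * (x J j - t))" if J: "J \<subseteq> I" for J
  proof -
    let ?bad = "{j \<in> I. sgn_of J j * (x J j - t) < \<kappa>}"
    have "card I = card ?bad + card (I - ?bad)" using fI by (simp add: card_Diff_subset card_mono)
    then have "real (card I) - b * ?n \<le> card (I - ?bad)" using gap[OF J] by simp
    then have "\<kappa> * (card I - b * ?n) \<le> \<kappa> * card (I - ?bad)" using \<kappa> by (rule mult_left_mono)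
    also have "\<dots> = (\<Sum>j\<in>I - ?bad. \<kappa>)" by simp
    also have "\<dots> \<le> (\<Sum>j\<in>I - ?bad. sgn_of J j * (x J j - t))" by (rule sum_mono) auto
    also have "\<dots> \<le> (\<Sum>j\<in>I. sgn_of J j * (x J j - t))"
      using fI signs[OF J] by (intro sum_mono2) auto
    finally show ?thesis .
  qed
  \<comment> \<open>Split \<open>x J\<close> into the error \<open>x J - T (y J)\<close> and
    \<open>T (y J)\<close>, move \<open>T\<close> to the signs in the second part, and apply Young's
    inequality with weight \<open>\<epsilon>\<close> to both pairings. The choice of weight makes
    every term of order \<open>\<epsilon>\<close>.\<close>
  have upper: "(\<Sum>j\<in>I. sgn_of J j * x J j) \<le> \<epsilon> / 2 * ?n + 2 * \<epsilon> * ?n + \<epsilon> / 2 * (C * ?n) + (\<Sum>k\<in>X. (v J k)\<^sup>2) / (2 * \<epsilon>)"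
    if J: "J \<subseteq> I" for J
  proof -
    let ?Ty = "\<lambda>j. \<Sum>k\<in>X. T j k * y J k"
    have "(\<Sum>j\<in>I. sgn_of J j * x J j) = (\<Sum>j\<in>I. sgn_of J j * (x J j - ?Ty j)) + (\<Sum>j\<in>I. sgn_of J j * ?Ty j)"
      by (simp add: sum.distrib[symmetric] algebra_simps)
    also have "(\<Sum>j\<in>I. sgn_of J j * ?Ty j) = (\<Sum>k\<in>X. y J k * v J k)"
      unfolding v_def sum_distrib_left by (subst sum.swap) (simp add: mult_ac)
    also have "(\<Sum>j\<in>I. sgn_of J j * (x J j - ?Ty j)) \<le> (\<Sum>j\<in>I. \<epsilon> / 2 + (?Ty j - x J j)\<^sup>2 / (2 * \<epsilon>))"
    proof (rule sum_mono)
      fix j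
      show "sgn_of J j * (x J j - ?Ty j) \<le> \<epsilon> / 2 + (?Ty j - x J j)\<^sup>2 / (2 * \<epsilon>)"
        using mult_le_weighted_squares[OF \<epsilon>, of "sgn_of J j" "x J j - ?Ty j"]
        by (simp add: power2_commute)
    qed
    also have "\<dots> \<le> (\<Sum>j\<in>X. \<epsilon> / 2 + (?Ty j - x J j)\<^sup>2 / (2 * \<epsilon>))"
      using X \<epsilon> by (intro sum_mono2) auto
    also have "\<dots> = \<epsilon> / 2 * ?n + (\<Sum>j\<in>X. (?Ty j - x J j)\<^sup>2) / (2 * \<epsilon>)"
      by (simp add: sum.distrib sum_divide_distrib)
    also have "\<dots> \<le> \<epsilon> / 2 * ?n + (4 * \<epsilon>\<^sup>2 * ?n) / (2 * \<epsilon>)"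
      using near[OF J] \<epsilon> by (intro add_left_mono divide_right_mono) auto
    also have "(4 * \<epsilon>\<^sup>2 * ?n) / (2 * \<epsilon>) = 2 * \<epsilon> * ?n" using \<epsilon> by (simp add: power2_eq_square)
    also have "(\<Sum>k\<in>X. y J k * v J k) \<le> (\<Sum>k\<in>X. \<epsilon> / 2 * (y J k)\<^sup>2 + (v J k)\<^sup>2 / (2 * \<epsilon>))"
      using mult_le_weighted_squares[OF \<epsilon>] by (intro sum_mono)
    also have "\<dots> = \<epsilon> / 2 * (\<Sum>k\<in>X. (y J k)\<^sup>2) + (\<Sum>k\<in>X. (v J k)\<^sup>2) / (2 * \<epsilon>)"
      by (simp add: sum.distrib sum_distrib_left sum_divide_distrib)
    also have "\<dots> \<le> \<epsilon> / 2 * (C * ?n) + (\<Sum>k\<in>X. (v J k)\<^sup>2) / (2 * \<epsilon>)"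
      using bounded[OF J] \<epsilon> by (intro add_right_mono mult_left_mono) auto
    finally show ?thesis by simp
  qed
  let ?P = "(2::real) ^ card I"
  have "(\<Sum>J\<in>Pow I. \<Sum>k\<in>X. (v J k)\<^sup>2) = (\<Sum>k\<in>X. \<Sum>J\<in>Pow I. (v J k)\<^sup>2)" by (rule sum.swap)
  also have "\<dots> = (\<Sum>k\<in>X. \<Sum>i\<in>I. \<Sum>j\<in>I. T i k * T j k * (\<Sum>J\<in>Pow I. sgn_of J i * sgn_of J j))"
  proof (rule sum.cong[OF refl])
    fix k
    have "(\<Sum>J\<in>Pow I. (v J k)\<^sup>2) = (\<Sum>J\<in>Pow I. \<Sum>i\<in>I. \<Sum>j\<in>I. T i k * T j k * (sgn_of J i * sgn_of J j))"
      unfolding v_def power2_eq_square sum_product by (intro sum.cong refl) (simp add: mult_ac)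
    also have "\<dots> = (\<Sum>i\<in>I. \<Sum>J\<in>Pow I. \<Sum>j\<in>I. T i k * T j k * (sgn_of J i * sgn_of J j))"
      by (rule sum.swap)
    also have "\<dots> = (\<Sum>i\<in>I. \<Sum>j\<in>I. \<Sum>J\<in>Pow I. T i k * T j k * (sgn_of J i * sgn_of J j))"
      by (rule sum.cong[OF refl], rule sum.swap)
    finally show "(\<Sum>J\<in>Pow I. (v J k)\<^sup>2) = (\<Sum>i\<in>I. \<Sum>j\<in>I. T i k * T j k * (\<Sum>J\<in>Pow I. sgn_of J i * sgn_of J j))"
      by (simp add: sum_distrib_left)
  qed
  \<comment> \<open>Signs at distinct points are uncorrelated, so only the diagonal terms
    survive.\<close>
  also have "\<dots> = (\<Sum>k\<in>X. \<Sum>i\<in>I. ?P * (T i k)\<^sup>2)"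
  proof (intro sum.cong refl)
    fix k i assume "i \<in> I"
    then have "(\<Sum>j\<in>I. T i k * T j k * (\<Sum>J\<in>Pow I. sgn_of J i * sgn_of J j)) =
        (\<Sum>j\<in>I. if i = j then ?P * (T i k)\<^sup>2 else 0)"
      using fI by (intro sum.cong refl) (auto simp: sum_sgn_of_mult power2_eq_square)
    also have "\<dots> = ?P * (T i k)\<^sup>2" using fI \<open>i \<in> I\<close> by simp
    finally show "(\<Sum>j\<in>I. T i k * T j k * (\<Sum>J\<in>Pow I. sgn_of J i * sgn_of J j)) = ?P * (T i k)\<^sup>2" .
  qed
  also have "\<dots> = ?P * (\<Sum>i\<in>I. \<Sum>k\<in>X. (T i k)\<^sup>2)" by (subst sum.swap) (simp add: sum_distrib_left)
  also have "\<dots> \<le> ?P * (\<Sum>i\<in>X. \<Sum>k\<in>X. (T i k)\<^sup>2)"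
    using X by (intro mult_left_mono sum_mono2) (auto intro: sum_nonneg)
  also have "\<dots> \<le> ?P * (4 * \<epsilon>\<^sup>2 * ?n)" using HS by (intro mult_left_mono) auto
  finally have v_sum: "(\<Sum>J\<in>Pow I. \<Sum>k\<in>X. (v J k)\<^sup>2) \<le> ?P * (4 * \<epsilon>\<^sup>2 * ?n)" .
  have "?P * (\<kappa> * (card I - b * ?n)) = (\<Sum>J\<in>Pow I. \<kappa> * (card I - b * ?n))"
    using fI by (simp add: card_Pow)
  also have "\<dots> \<le> (\<Sum>J\<in>Pow I. \<Sum>j\<in>I. sgn_of J j * (x J j - t))"
    using lower by (intro sum_mono) auto
  also have "\<dots> = (\<Sum>J\<in>Pow I. \<Sum>j\<in>I. sgn_of J j * x J j) - (\<Sum>j\<in>I. (\<Sum>J\<in>Pow I. sgn_of J j) * t)"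
    unfolding sum_distrib_right by (subst (3) sum.swap) (simp add: sum_subtractf[symmetric] algebra_simps)
  \<comment> \<open>The threshold \<open>t\<close> does not depend on \<open>J\<close>, so averaging
    over the signs removes it.\<close>
  also have "(\<Sum>j\<in>I. (\<Sum>J\<in>Pow I. sgn_of J j) * t) = 0" using fI by (simp add: sum_sgn_of)
  also have "(\<Sum>J\<in>Pow I. \<Sum>j\<in>I. sgn_of J j * x J j) \<le>
      (\<Sum>J\<in>Pow I. \<epsilon> / 2 * ?n + 2 * \<epsilon> * ?n + \<epsilon> / 2 * (C * ?n) + (\<Sum>k\<in>X. (v J k)\<^sup>2) / (2 * \<epsilon>))"
    using upper by (intro sum_mono) auto
  also have "\<dots> = ?P * (\<epsilon> / 2 * ?n + 2 * \<epsilon> * ?n + \<epsilon> / 2 * (C * ?n)) + (\<Sum>J\<in>Pow I. \<Sum>k\<in>X. (v J k)\<^sup>2) / (2 * \<epsilon>)"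
    using fI by (simp add: sum.distrib card_Pow sum_divide_distrib)
  also have "\<dots> \<le> ?P * (\<epsilon> / 2 * ?n + 2 * \<epsilon> * ?n + \<epsilon> / 2 * (C * ?n)) + ?P * (4 * \<epsilon>\<^sup>2 * ?n) / (2 * \<epsilon>)"
    using v_sum \<epsilon> by (intro add_left_mono divide_right_mono) auto
  \<comment> \<open>The coefficients 1/2 and 2 come from the error term, and 2 from the
    Hilbert-Schmidt norm; 9/2 is then rounded up to 5.\<close>
  also have "\<dots> = ?P * (\<epsilon> * (C / 2 + 9 / 2) * ?n)"
    using \<epsilon> by (simp add: field_simps power2_eq_square)
  also have "\<dots> \<le> ?P * (\<epsilon> * (C / 2 + 5) * ?n)"
    using \<epsilon> by (intro mult_left_mono mult_right_mono) auto
  finally show ?thesis by simp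
qed

section \<open>Microstates\<close>

lemma unif_eq_card: "0 < n \<Longrightarrow> unif n S = real (card ({1..n} \<inter> S)) / real n"
  by (subst measure_pmf_of_set) auto

lemma sum_fibers:
  fixes f :: "'b \<Rightarrow> real" and g :: "'a \<Rightarrow> 'b"
  assumes "finite A" "finite B" "g ` A \<subseteq> B"
  shows "(\<Sum>x\<in>A. f (g x)) = (\<Sum>y\<in>B. f y * card {x \<in> A. g x = y})"
proof -
  have "(\<Sum>x\<in>A. f (g x)) = (\<Sum>y\<in>B. \<Sum>x\<in>{x \<in> A. g x = y}. f (g x))"
    using assms by (intro sum.group[symmetric])
  also have "\<dots> = (\<Sum>y\<in>B. f y * card {x \<in> A. g x = y})"
    by (intro sum.cong refl) simp
  finally show ?thesis .
qed

text \<open>The trace that a microstate leaves of the set of all \<open>x\<close> with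
  \<open>\<beta> x \<in> P\<close>.\<close>

definition pat :: "('g, 'z) monoid_scheme \<Rightarrow> nat \<Rightarrow> nat set \<Rightarrow> (nat \<Rightarrow> 'g \<Rightarrow> nat) \<Rightarrow> nat set" where
  "pat G n P \<phi> = {j \<in> {1..n}. \<phi> j \<one>\<^bsub>G\<^esub> \<in> P}"

lemma finite_pat [simp]: "finite (pat G n P \<phi>)"
  by (auto simp: pat_def)

context pmp_system
begin

lemma itinerary_mem:
  "finite_observable M B \<beta> \<Longrightarrow> F \<subseteq> carrier G \<Longrightarrow> x \<in> space M \<Longrightarrow> itinerary G act \<beta> F x \<in> F \<rightarrow>\<^sub>E B"
  unfolding itinerary_def finite_observable_def
  by (auto simp: subset_eq intro: measurable_space[of \<beta> M "count_space B", simplified])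

lemma itinerary_sets:
  assumes "finite_observable M B \<beta>" "finite F" "F \<subseteq> carrier G" "b \<in> F \<rightarrow>\<^sub>E B"
  shows "itinerary G act \<beta> F -` {b} \<inter> space M \<in> sets M"
proof -
  have "itinerary G act \<beta> F -` {b} \<inter> space M = {x \<in> space M. \<forall>g\<in>F. \<beta> (act (inv g) x) = b g}"
    using assms(4) by (auto simp: itinerary_def fun_eq_iff PiE_def extensional_def)
  also have "\<dots> \<in> sets M"
  proof (rule sets.sets_Collect_finite_All)
    fix g assume g: "g \<in> F"
    have "(\<lambda>x. \<beta> (act (inv g) x)) \<in> measurable M (count_space B)"
      using assms g by (intro measurable_compose[OF act_measurable]) (auto simp: finite_observable_def)
    then have "(\<lambda>x. \<beta> (act (inv g) x)) -` {b g} \<inter> space M \<in> sets M"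
      using assms g by (intro measurable_sets) (auto simp: PiE_def)
    also have "(\<lambda>x. \<beta> (act (inv g) x)) -` {b g} \<inter> space M = {x \<in> space M. \<beta> (act (inv g) x) = b g}" by auto
    finally show "{x \<in> space M. \<beta> (act (inv g) x) = b g} \<in> sets M" .
  qed (use assms in simp)
  finally show ?thesis .
qed

lemma integral_itinerary:
  fixes Q :: "('g \<Rightarrow> nat) \<Rightarrow> real"
  assumes "finite_observable M B \<beta>" "finite F" "F \<subseteq> carrier G"
  shows "integrable M (\<lambda>x. Q (itinerary G act \<beta> F x))"
    and "(\<integral>x. Q (itinerary G act \<beta> F x) \<partial>M) =
      (\<Sum>b\<in>F \<rightarrow>\<^sub>E B. Q b * measure M (itinerary G act \<beta> F -` {b} \<inter> space M))"
proof -
  let ?S = "\<lambda>b. itinerary G act \<beta> F -` {b} \<inter> space M"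
  have fin: "finite (F \<rightarrow>\<^sub>E B)" using assms by (intro finite_PiE) (auto simp: finite_observable_def)
  have eq: "Q (itinerary G act \<beta> F x) = (\<Sum>b\<in>F \<rightarrow>\<^sub>E B. Q b * indicator (?S b) x)" if "x \<in> space M" for x
  proof -
    have "(\<Sum>b\<in>F \<rightarrow>\<^sub>E B. Q b * indicator (?S b) x) =
        (\<Sum>b\<in>F \<rightarrow>\<^sub>E B. if itinerary G act \<beta> F x = b then Q b else 0)"
      using that by (intro sum.cong) (auto simp: indicator_def)
    then show ?thesis using fin itinerary_mem[OF assms(1,3) that] by simp
  qed
  have int: "integrable M (\<lambda>x. Q b * indicator (?S b) x)" if "b \<in> F \<rightarrow>\<^sub>E B" for b
    using itinerary_sets[OF assms that] by (simp add: emeasure_eq_measure)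
  have "integrable M (\<lambda>x. \<Sum>b\<in>F \<rightarrow>\<^sub>E B. Q b * indicator (?S b) x)"
    using int by (rule Bochner_Integration.integrable_sum)
  then show "integrable M (\<lambda>x. Q (itinerary G act \<beta> F x))"
    by (subst Bochner_Integration.integrable_cong[OF refl eq]) auto
  have "(\<integral>x. Q (itinerary G act \<beta> F x) \<partial>M) = (\<integral>x. (\<Sum>b\<in>F \<rightarrow>\<^sub>E B. Q b * indicator (?S b) x) \<partial>M)"
    by (intro Bochner_Integration.integral_cong refl eq)
  also have "\<dots> = (\<Sum>b\<in>F \<rightarrow>\<^sub>E B. \<integral>x. Q b * indicator (?S b) x \<partial>M)"
    using int by (rule Bochner_Integration.integral_sum)
  also have "\<dots> = (\<Sum>b\<in>F \<rightarrow>\<^sub>E B. Q b * measure M (?S b))"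
    using itinerary_sets[OF assms] by (intro sum.cong refl) (simp add: Int_absorb2)
  finally show "(\<integral>x. Q (itinerary G act \<beta> F x) \<partial>M) = (\<Sum>b\<in>F \<rightarrow>\<^sub>E B. Q b * measure M (?S b))" .
qed

text \<open>The first condition in \<open>AP\<close> bounds the sum of the absolute differences
  between the empirical distribution of the microstate and the distribution of itineraries by
  \<open>\<delta>\<close>; so the averages of a function bounded by \<open>K\<close> differ by at
  most \<open>K * \<delta>\<close>.\<close>

lemma AP_expectation:
  fixes Q :: "('g \<Rightarrow> nat) \<Rightarrow> real"
  assumes "finite_observable M B \<beta>" "finite F" "F \<subseteq> carrier G"
    and \<phi>: "\<phi> \<in> AP G M act B \<beta> F \<delta> n s" and n: "n > 0"
    and Q: "\<And>b. b \<in> F \<rightarrow>\<^sub>E B \<Longrightarrow> \<bar>Q b\<bar> \<le> K" and K: "K \<ge> 0"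
  shows "(\<Sum>j\<in>{1..n}. Q (\<phi> j)) \<le> ((\<integral>x. Q (itinerary G act \<beta> F x) \<partial>M) + K * \<delta>) * n"
proof -
  let ?S = "\<lambda>b. itinerary G act \<beta> F -` {b} \<inter> space M"
  have fin: "finite (F \<rightarrow>\<^sub>E B)" using assms by (intro finite_PiE) (auto simp: finite_observable_def)
  have mem: "\<phi> ` {1..n} \<subseteq> F \<rightarrow>\<^sub>E B" using \<phi> by (auto simp: AP_def)
  have "(\<Sum>j\<in>{1..n}. Q (\<phi> j)) = (\<Sum>b\<in>F \<rightarrow>\<^sub>E B. Q b * card {j \<in> {1..n}. \<phi> j = b})"
    using mem fin by (intro sum_fibers) auto
  also have "\<dots> = (\<Sum>b\<in>F \<rightarrow>\<^sub>E B. Q b * unif n (\<phi> -` {b})) * n"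
    unfolding sum_distrib_right unif_eq_card[OF n] using n
    by (intro sum.cong refl) (auto intro!: arg_cong[where f = card])
  also have "(\<Sum>b\<in>F \<rightarrow>\<^sub>E B. Q b * unif n (\<phi> -` {b})) \<le> (\<integral>x. Q (itinerary G act \<beta> F x) \<partial>M) + K * \<delta>"
  proof -
    have "(\<Sum>b\<in>F \<rightarrow>\<^sub>E B. Q b * unif n (\<phi> -` {b})) - (\<Sum>b\<in>F \<rightarrow>\<^sub>E B. Q b * measure M (?S b)) =
        (\<Sum>b\<in>F \<rightarrow>\<^sub>E B. Q b * (unif n (\<phi> -` {b}) - measure M (?S b)))"
      by (simp add: sum_subtractf right_diff_distrib)
    also have "\<dots> \<le> (\<Sum>b\<in>F \<rightarrow>\<^sub>E B. K * \<bar>unif n (\<phi> -` {b}) - measure M (?S b)\<bar>)"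
    proof (rule sum_mono)
      fix b assume "b \<in> F \<rightarrow>\<^sub>E B"
      then have "\<bar>Q b * (unif n (\<phi> -` {b}) - measure M (?S b))\<bar> \<le> K * \<bar>unif n (\<phi> -` {b}) - measure M (?S b)\<bar>"
        unfolding abs_mult using Q by (intro mult_right_mono) auto
      then show "Q b * (unif n (\<phi> -` {b}) - measure M (?S b)) \<le> K * \<bar>unif n (\<phi> -` {b}) - measure M (?S b)\<bar>"
        by linarith
    qed
    also have "\<dots> \<le> K * \<delta>"
      unfolding sum_distrib_left[symmetric] using \<phi> K by (intro mult_left_mono) (auto simp: AP_def)
    finally show ?thesis by (simp add: integral_itinerary(2)[OF assms(1-3)])
  qed
  finally show ?thesis using n by simp
qed

text \<open>Coordinates outside \<open>F\<close> are dropped and labels are merged by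
  \<open>\<rho>\<close>. Merging does not increase the distance of distributions, and a coordinate
  that agreed with the shifted label still does.\<close>

lemma AP_refine:
  assumes obs: "finite_observable M B \<beta>" "finite_observable M B' \<beta>'"
    and F: "finite F'" "F \<subseteq> F'" "F' \<subseteq> carrier G" "\<one> \<in> F" and \<delta>: "\<delta>' \<le> \<delta>"
    and \<rho>: "\<rho> \<in> B' \<rightarrow> B" "\<And>x. x \<in> space M \<Longrightarrow> \<rho> (\<beta>' x) = \<beta> x"
    and n: "n > 0" and s: "\<And>g. g \<in> F \<Longrightarrow> s g permutes {1..n}"
    and \<phi>: "\<phi> \<in> AP G M act B' \<beta>' F' \<delta>' n s"
  shows "(\<lambda>j\<in>{1..n}. \<lambda>g\<in>F. \<rho> (\<phi> j g)) \<in> AP G M act B \<beta> F \<delta> n s"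
proof -
  define r where "r b = (\<lambda>g\<in>F. \<rho> (b g))" for b :: "'g \<Rightarrow> nat"
  define \<psi> where "\<psi> = (\<lambda>j\<in>{1..n}. r (\<phi> j))"
  let ?S = "\<lambda>b. itinerary G act \<beta> F -` {b} \<inter> space M"
  let ?S' = "\<lambda>b. itinerary G act \<beta>' F' -` {b} \<inter> space M"
  have finF: "finite F" "F \<subseteq> carrier G" using F finite_subset by auto
  have fin: "finite (F \<rightarrow>\<^sub>E B)" "finite (F' \<rightarrow>\<^sub>E B')"
    using obs F finF by (auto intro!: finite_PiE simp: finite_observable_def)
  have mem: "\<phi> \<in> {1..n} \<rightarrow>\<^sub>E (F' \<rightarrow>\<^sub>E B')" using \<phi> by (simp add: AP_def)
  then have \<phi>j: "\<phi> j \<in> F' \<rightarrow>\<^sub>E B'" if "j \<in> {1..n}" for j using that by (auto simp: PiE_def)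
  have rmem: "r b \<in> F \<rightarrow>\<^sub>E B" if "b \<in> F' \<rightarrow>\<^sub>E B'" for b
    using that \<rho>(1) F by (auto simp: r_def PiE_def Pi_def)
  have \<psi>mem: "\<psi> \<in> {1..n} \<rightarrow>\<^sub>E (F \<rightarrow>\<^sub>E B)" using rmem \<phi>j by (auto simp: \<psi>_def)
  have r_it: "r (itinerary G act \<beta>' F' x) = itinerary G act \<beta> F x" if "x \<in> space M" for x
    using that \<rho>(2) F finF by (auto simp: r_def itinerary_def fun_eq_iff)
  let ?fib = "\<lambda>b. {b' \<in> F' \<rightarrow>\<^sub>E B'. r b' = b}"
  have u: "unif n (\<psi> -` {b}) = (\<Sum>b'\<in>?fib b. unif n (\<phi> -` {b'}))" if "b \<in> F \<rightarrow>\<^sub>E B" for b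
  proof -
    have "{1..n} \<inter> \<psi> -` {b} = (\<Union>b'\<in>?fib b. {1..n} \<inter> \<phi> -` {b'})"
      using \<phi>j by (auto simp: \<psi>_def)
    also have "card \<dots> = (\<Sum>b'\<in>?fib b. card ({1..n} \<inter> \<phi> -` {b'}))"
      using fin by (intro card_UN_disjoint) auto
    finally show ?thesis by (simp only: unif_eq_card[OF n] sum_divide_distrib of_nat_sum)
  qed
  have m: "measure M (?S b) = (\<Sum>b'\<in>?fib b. measure M (?S' b'))" if "b \<in> F \<rightarrow>\<^sub>E B" for b
  proof -
    have "?S b = (\<Union>b'\<in>?fib b. ?S' b')"
      using r_it itinerary_mem[OF obs(2) F(3)] by auto
    also have "measure M \<dots> = (\<Sum>b'\<in>?fib b. measure M (?S' b'))"
      using fin itinerary_sets[OF obs(2) F(1,3)]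
      by (intro finite_measure_finite_Union) (auto simp: disjoint_family_on_def)
    finally show ?thesis .
  qed
  have "(\<Sum>b\<in>F \<rightarrow>\<^sub>E B. \<bar>unif n (\<psi> -` {b}) - measure M (?S b)\<bar>) \<le>
      (\<Sum>b\<in>F \<rightarrow>\<^sub>E B. \<Sum>b'\<in>?fib b. \<bar>unif n (\<phi> -` {b'}) - measure M (?S' b')\<bar>)"
    using u m by (intro sum_mono) (auto simp: sum_subtractf[symmetric])
  also have "\<dots> = (\<Sum>b'\<in>F' \<rightarrow>\<^sub>E B'. \<bar>unif n (\<phi> -` {b'}) - measure M (?S' b')\<bar>)"
    using fin rmem by (intro sum.group) auto
  also have "\<dots> < \<delta>'" using \<phi> by (simp add: AP_def)
  finally have 1: "(\<Sum>b\<in>F \<rightarrow>\<^sub>E B. \<bar>unif n (\<psi> -` {b}) - measure M (?S b)\<bar>) < \<delta>" using \<delta> by simp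
  have 2: "unif n {j. \<psi> j g \<noteq> \<psi> (inv_into {1..n} (s g) j) \<one>} < \<delta>" if g: "g \<in> F" for g
  proof -
    have inv: "inv_into {1..n} (s g) j \<in> {1..n}" if "j \<in> {1..n}" for j
      using s[OF g] that by (metis inv_into_into permutes_image)
    have "{1..n} \<inter> {j. \<psi> j g \<noteq> \<psi> (inv_into {1..n} (s g) j) \<one>} \<subseteq>
        {1..n} \<inter> {j. \<phi> j g \<noteq> \<phi> (inv_into {1..n} (s g) j) \<one>}"
    proof (intro subsetI IntI CollectI)
      fix j assume j: "j \<in> {1..n} \<inter> {j. \<psi> j g \<noteq> \<psi> (inv_into {1..n} (s g) j) \<one>}"
      then show "j \<in> {1..n}" by blast
      then have "\<psi> j g = \<rho> (\<phi> j g)"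
          "\<psi> (inv_into {1..n} (s g) j) \<one> = \<rho> (\<phi> (inv_into {1..n} (s g) j) \<one>)"
        using inv[of j] g F(4) unfolding \<psi>_def r_def by (simp_all only: restrict_apply')
      then show "\<phi> j g \<noteq> \<phi> (inv_into {1..n} (s g) j) \<one>" using j by auto
    qed
    then have "unif n {j. \<psi> j g \<noteq> \<psi> (inv_into {1..n} (s g) j) \<one>} \<le>
        unif n {j. \<phi> j g \<noteq> \<phi> (inv_into {1..n} (s g) j) \<one>}"
      unfolding unif_eq_card[OF n] using n by (intro divide_right_mono of_nat_mono card_mono) auto
    also have "\<dots> < \<delta>'" using \<phi> g F by (auto simp: AP_def)
    finally show ?thesis using \<delta> by simp
  qed
  have "\<psi> \<in> AP G M act B \<beta> F \<delta> n s" unfolding AP_def using \<psi>mem 1 2 by blast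
  then show ?thesis by (simp add: \<psi>_def r_def)
qed

end

lemma finite_observable_pair:
  assumes "finite_observable M B \<beta>" "finite_observable M B' \<beta>'"
  shows "finite_observable M (prod_encode ` (B \<times> B')) (\<lambda>x. prod_encode (\<beta> x, \<beta>' x))"
proof -
  have fin: "finite B" "finite B'" and m: "\<beta> \<in> measurable M (count_space B)" "\<beta>' \<in> measurable M (count_space B')"
    using assms by (auto simp: finite_observable_def)
  have sp: "\<beta> x \<in> B" "\<beta>' x \<in> B'" if "x \<in> space M" for x
    using m that by (auto dest: measurable_space)
  have "(\<lambda>x. prod_encode (\<beta> x, \<beta>' x)) -` {a} \<inter> space M \<in> sets M" if a: "a \<in> prod_encode ` (B \<times> B')" for a
  proof -
    obtain b b' where b: "b \<in> B" "b' \<in> B'" "a = prod_encode (b, b')" using a by blast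
    have "(\<lambda>x. prod_encode (\<beta> x, \<beta>' x)) -` {a} \<inter> space M = (\<beta> -` {b} \<inter> space M) \<inter> (\<beta>' -` {b'} \<inter> space M)"
      using b by auto
    also have "\<dots> \<in> sets M" using m b by (intro sets.Int measurable_sets) auto
    finally show ?thesis .
  qed
  then show ?thesis unfolding finite_observable_def
    using fin sp by (subst measurable_count_space_eq2) auto
qed

section \<open>Sets of entropy zero\<close>

locale sofic_system = pmp_system G M act for G :: "('g, 'z) monoid_scheme" (structure)
    and M :: "'a measure" and act :: "'g \<Rightarrow> 'a \<Rightarrow> 'a" +
  fixes d :: "nat \<Rightarrow> nat" and \<sigma> :: "nat \<Rightarrow> 'g \<Rightarrow> nat \<Rightarrow> nat"
  assumes sofic: "sofic_approximation G d \<sigma>"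
begin

lemma d_pos [simp]: "0 < d i"
  using sofic by (simp add: sofic_approximation_def)

lemma \<sigma>_permutes: "g \<in> carrier G \<Longrightarrow> \<sigma> i g permutes {1..d i}"
  using sofic by (simp add: sofic_approximation_def)

definition valid :: "nat set \<Rightarrow> ('a \<Rightarrow> nat) \<Rightarrow> 'g set \<Rightarrow> real \<Rightarrow> bool" where
  "valid B \<beta> F \<delta> \<longleftrightarrow> finite_observable M B \<beta> \<and> finite F \<and> F \<subseteq> carrier G \<and> \<one> \<in> F \<and> \<delta> > 0"

text \<open>
  Eventually the patterns lie within Hamming distance \<open>c d\<^sub>i\<close> of a family of at most \<open>exp (c d\<^sub>i)\<close> sets.
  A set is a \<open>zero_set\<close> if this can be achieved for every \<open>c\<close>; such sets form a \<open>\<sigma>\<close>-algebra.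
\<close>

definition few :: "real \<Rightarrow> nat set \<Rightarrow> ('a \<Rightarrow> nat) \<Rightarrow> 'g set \<Rightarrow> real \<Rightarrow> nat set \<Rightarrow> bool" where
  "few c B \<beta> F \<delta> P \<longleftrightarrow>
     (\<forall>\<^sub>F i in sequentially. \<exists>\<S>. \<S> \<subseteq> Pow {1..d i} \<and> real (card \<S>) \<le> exp (c * d i) \<and>
        (\<forall>\<phi>\<in>AP G M act B \<beta> F \<delta> (d i) (\<sigma> i). \<exists>S\<in>\<S>. real (card (sym_diff S (pat G (d i) P \<phi>))) \<le> c * d i))"

definition zero_set :: "'a set \<Rightarrow> bool" where
  "zero_set D \<longleftrightarrow> D \<in> sets M \<and> (\<forall>c>0. \<exists>B \<beta> F \<delta> P. valid B \<beta> F \<delta> \<and>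
      (\<forall>x\<in>space M. \<beta> x \<in> P \<longleftrightarrow> x \<in> D) \<and> few c B \<beta> F \<delta> P)"

lemma zero_set_sets: "zero_set D \<Longrightarrow> D \<in> sets M"
  by (simp add: zero_set_def)

text \<open>A microstate of the finer observable becomes a microstate of the coarser one with the
  same pattern, so the same family of sets serves.\<close>

lemma few_refine:
  assumes "valid B \<beta> F \<delta>" "valid B' \<beta>' F' \<delta>'" "F \<subseteq> F'" "\<delta>' \<le> \<delta>"
    and \<rho>: "\<rho> \<in> B' \<rightarrow> B" "\<And>x. x \<in> space M \<Longrightarrow> \<rho> (\<beta>' x) = \<beta> x"
    and few: "few c B \<beta> F \<delta> P"
  shows "few c B' \<beta>' F' \<delta>' (\<rho> -` P)"
  using few unfolding few_def
proof (rule eventually_mono, elim exE conjE)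
  fix i \<S>
  assume S: "\<S> \<subseteq> Pow {1..d i}" "real (card \<S>) \<le> exp (c * d i)"
    "\<forall>\<phi>\<in>AP G M act B \<beta> F \<delta> (d i) (\<sigma> i). \<exists>S\<in>\<S>. real (card (sym_diff S (pat G (d i) P \<phi>))) \<le> c * d i"
  have "\<exists>S\<in>\<S>. real (card (sym_diff S (pat G (d i) (\<rho> -` P) \<phi>))) \<le> c * d i"
    if "\<phi> \<in> AP G M act B' \<beta>' F' \<delta>' (d i) (\<sigma> i)" for \<phi>
  proof -
    let ?\<psi> = "\<lambda>j\<in>{1..d i}. \<lambda>g\<in>F. \<rho> (\<phi> j g)"
    have "?\<psi> \<in> AP G M act B \<beta> F \<delta> (d i) (\<sigma> i)"
    proof (rule AP_refine[where \<beta> = \<beta> and \<beta>' = \<beta>' and B = B and B' = B' and F' = F' and \<delta>' = \<delta>'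
          and \<rho> = \<rho> and \<phi> = \<phi>])
      show "\<sigma> i g permutes {1..d i}" if "g \<in> F" for g
        using that assms(1) by (intro \<sigma>_permutes) (auto simp: valid_def)
    qed (use assms(1-6) that in \<open>simp_all add: valid_def\<close>)
    moreover have "pat G (d i) P ?\<psi> = pat G (d i) (\<rho> -` P) \<phi>"
      using assms(1) by (auto simp: pat_def valid_def)
    ultimately show ?thesis using S(3) by metis
  qed
  then show "\<exists>\<S>. \<S> \<subseteq> Pow {1..d i} \<and> real (card \<S>) \<le> exp (c * d i) \<and>
      (\<forall>\<phi>\<in>AP G M act B' \<beta>' F' \<delta>' (d i) (\<sigma> i). \<exists>S\<in>\<S>. real (card (sym_diff S (pat G (d i) (\<rho> -` P) \<phi>))) \<le> c * d i)"
    using S by blast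
qed

lemma observable_vimage_sets:
  assumes "finite_observable M B \<beta>"
  shows "{x \<in> space M. \<beta> x \<in> P} \<in> sets M"
proof -
  have "{x \<in> space M. \<beta> x \<in> P} = \<beta> -` (P \<inter> B) \<inter> space M"
    using assms by (auto simp: finite_observable_def dest: measurable_space)
  also have "\<dots> \<in> sets M"
    using assms unfolding finite_observable_def by (intro measurable_sets[of _ M "count_space B"]) auto
  finally show ?thesis .
qed

lemma card_pat_le:
  assumes "valid B \<beta> F \<delta>" "\<phi> \<in> AP G M act B \<beta> F \<delta> n s" "0 < n"
  shows "card (pat G n P \<phi>) \<le> (measure M {x \<in> space M. \<beta> x \<in> P} + \<delta>) * n"
proof -
  define Q where "Q b = (indicator P (b \<one>) :: real)" for b :: "'g \<Rightarrow> nat"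
  have "real (card (pat G n P \<phi>)) = (\<Sum>j\<in>{1..n}. Q (\<phi> j))"
    unfolding Q_def pat_def indicator_def by (simp add: sum.If_cases Int_def)
  also have "\<dots> \<le> ((\<integral>x. Q (itinerary G act \<beta> F x) \<partial>M) + 1 * \<delta>) * n"
    using assms by (intro AP_expectation) (auto simp: valid_def Q_def indicator_def)
  also have "(\<integral>x. Q (itinerary G act \<beta> F x) \<partial>M) = (\<integral>x. indicator {x \<in> space M. \<beta> x \<in> P} x \<partial>M)"
    using assms(1) by (intro Bochner_Integration.integral_cong refl)
      (auto simp: Q_def itinerary_def valid_def indicator_def)
  also have "\<dots> = measure M {x \<in> space M. \<beta> x \<in> P}"
    using observable_vimage_sets assms(1) by (simp add: valid_def Int_absorb2)
  finally show ?thesis by simp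
qed

lemma card_sym_diff_triangle:
  assumes "finite A" "finite B" "finite C"
  shows "card (sym_diff A C) \<le> card (sym_diff A B) + card (sym_diff B C)"
proof -
  have "sym_diff A C \<subseteq> sym_diff A B \<union> sym_diff B C" by auto
  then have "card (sym_diff A C) \<le> card (sym_diff A B \<union> sym_diff B C)"
    using assms by (intro card_mono) auto
  also have "\<dots> \<le> card (sym_diff A B) + card (sym_diff B C)" by (rule card_Un_le)
  finally show ?thesis .
qed

text \<open>The two patterns of a microstate differ by its pattern for the symmetric difference of
  \<open>P\<close> and \<open>P'\<close>, whose density is at most the measure of the corresponding
  set plus \<open>\<delta>\<close>.\<close>

lemma few_change:
  assumes v: "valid B \<beta> F \<delta>" and few: "few c B \<beta> F \<delta> P" and "e \<ge> 0"
    and e: "measure M {x \<in> space M. (\<beta> x \<in> P) \<noteq> (\<beta> x \<in> P')} + \<delta> \<le> e"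
  shows "few (c + e) B \<beta> F \<delta> P'"
  using few unfolding few_def
proof (rule eventually_mono, elim exE conjE)
  fix i \<S>
  assume S: "\<S> \<subseteq> Pow {1..d i}" "real (card \<S>) \<le> exp (c * d i)"
    "\<forall>\<phi>\<in>AP G M act B \<beta> F \<delta> (d i) (\<sigma> i). \<exists>S\<in>\<S>. real (card (sym_diff S (pat G (d i) P \<phi>))) \<le> c * d i"
  have "\<exists>S\<in>\<S>. real (card (sym_diff S (pat G (d i) P' \<phi>))) \<le> (c + e) * d i"
    if \<phi>: "\<phi> \<in> AP G M act B \<beta> F \<delta> (d i) (\<sigma> i)" for \<phi>
  proof -
    obtain S where S': "S \<in> \<S>" "real (card (sym_diff S (pat G (d i) P \<phi>))) \<le> c * d i" using S(3) \<phi> by blast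
    have "finite S" using S(1) S'(1) by (meson PowD finite_atLeastAtMost finite_subset subsetD)
    have "sym_diff (pat G (d i) P \<phi>) (pat G (d i) P' \<phi>) = pat G (d i) (sym_diff P P') \<phi>"
      by (auto simp: pat_def)
    also have "real (card \<dots>) \<le> (measure M {x \<in> space M. \<beta> x \<in> sym_diff P P'} + \<delta>) * d i"
      using v \<phi> by (intro card_pat_le) auto
    also have "{x \<in> space M. \<beta> x \<in> sym_diff P P'} = {x \<in> space M. (\<beta> x \<in> P) \<noteq> (\<beta> x \<in> P')}" by auto
    also have "(measure M \<dots> + \<delta>) * d i \<le> e * d i" using e by (intro mult_right_mono) auto
    finally have "card (sym_diff (pat G (d i) P \<phi>) (pat G (d i) P' \<phi>)) \<le> e * d i" .
    then have "real (card (sym_diff S (pat G (d i) P' \<phi>))) \<le> (c + e) * d i"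
      using S'(2) card_sym_diff_triangle[of S "pat G (d i) P \<phi>" "pat G (d i) P' \<phi>"] \<open>finite S\<close>
      by (simp add: distrib_right)
    then show ?thesis using S' by blast
  qed
  moreover have "c * d i \<le> (c + e) * d i" using \<open>e \<ge> 0\<close> by (intro mult_right_mono) auto
  then have "real (card \<S>) \<le> exp ((c + e) * d i)" using S(2) by (meson exp_le_cancel_iff order_trans)
  ultimately show "\<exists>\<S>. \<S> \<subseteq> Pow {1..d i} \<and> real (card \<S>) \<le> exp ((c + e) * d i) \<and>
      (\<forall>\<phi>\<in>AP G M act B \<beta> F \<delta> (d i) (\<sigma> i). \<exists>S\<in>\<S>. real (card (sym_diff S (pat G (d i) P' \<phi>))) \<le> (c + e) * d i)"
    using S(1) by (intro exI[of _ \<S>]) simp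
qed

text \<open>Different zero sets come with different observables, windows and tolerances. Joining the
  witness for \<open>D\<close> to given data makes it possible to treat several sets by the same
  microstates.\<close>

lemma zero_set_refine:
  assumes "zero_set D" "valid B0 \<beta>0 F0 \<delta>0" "c > 0"
  obtains B \<beta> F \<delta> \<rho> P where "valid B \<beta> F \<delta>" "F0 \<subseteq> F" "\<delta> \<le> \<delta>0" "\<rho> \<in> B \<rightarrow> B0"
    "\<And>x. x \<in> space M \<Longrightarrow> \<rho> (\<beta> x) = \<beta>0 x" "\<And>x. x \<in> space M \<Longrightarrow> \<beta> x \<in> P \<longleftrightarrow> x \<in> D" "few c B \<beta> F \<delta> P"
proof -
  obtain B1 \<beta>1 F1 \<delta>1 P1 where 1: "valid B1 \<beta>1 F1 \<delta>1" "\<forall>x\<in>space M. \<beta>1 x \<in> P1 \<longleftrightarrow> x \<in> D"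
      "few c B1 \<beta>1 F1 \<delta>1 P1"
    using assms(1,3) unfolding zero_set_def by meson
  define B where "B = prod_encode ` (B0 \<times> B1)"
  define \<beta> where "\<beta> x = prod_encode (\<beta>0 x, \<beta>1 x)" for x
  have v: "valid B \<beta> (F0 \<union> F1) (min \<delta>0 \<delta>1)"
    using assms(2) 1(1) finite_observable_pair[of M B0 \<beta>0 B1 \<beta>1]
    unfolding valid_def B_def \<beta>_def by auto
  show ?thesis
  proof (rule that[OF v, of "fst \<circ> prod_decode" "(snd \<circ> prod_decode) -` P1"])
    show "few c B \<beta> (F0 \<union> F1) (min \<delta>0 \<delta>1) ((snd \<circ> prod_decode) -` P1)"
      by (rule few_refine[OF 1(1) v _ _ _ _ 1(3)]) (auto simp: B_def \<beta>_def)
  qed (use 1(2) in \<open>auto simp: B_def \<beta>_def\<close>)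
qed

lemma zero_set_Compl:
  assumes "zero_set D"
  shows "zero_set (space M - D)"
  unfolding zero_set_def
proof (intro conjI allI impI)
  show "space M - D \<in> sets M" using assms by (auto simp: zero_set_def)
  fix c :: real assume "c > 0"
  then obtain B \<beta> F \<delta> P where 1: "valid B \<beta> F \<delta>" "\<forall>x\<in>space M. \<beta> x \<in> P \<longleftrightarrow> x \<in> D" "few c B \<beta> F \<delta> P"
    using assms unfolding zero_set_def by meson
  have "few c B \<beta> F \<delta> (- P)"
    using 1(3) unfolding few_def
  proof (rule eventually_mono, elim exE conjE)
    fix i \<S>
    assume S: "\<S> \<subseteq> Pow {1..d i}" "real (card \<S>) \<le> exp (c * d i)"
      "\<forall>\<phi>\<in>AP G M act B \<beta> F \<delta> (d i) (\<sigma> i). \<exists>S\<in>\<S>. real (card (sym_diff S (pat G (d i) P \<phi>))) \<le> c * d i"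
    let ?C = "\<lambda>S. {1..d i} - S"
    have fin: "finite \<S>" using S(1) by (meson finite_Pow_iff finite_atLeastAtMost finite_subset)
    have "\<exists>S\<in>?C ` \<S>. real (card (sym_diff S (pat G (d i) (- P) \<phi>))) \<le> c * d i"
      if phi: "\<phi> \<in> AP G M act B \<beta> F \<delta> (d i) (\<sigma> i)" for \<phi>
    proof -
      obtain S where S': "S \<in> \<S>" "real (card (sym_diff S (pat G (d i) P \<phi>))) \<le> c * d i" using S(3) phi by blast
      have "S \<subseteq> {1..d i}" using S(1) S'(1) by blast
      then have "sym_diff (?C S) (pat G (d i) (- P) \<phi>) = sym_diff S (pat G (d i) P \<phi>)"
        by (auto simp: pat_def)
      then show ?thesis using S' by (intro bexI[of _ "?C S"]) auto
    qed
    moreover have "real (card (?C ` \<S>)) \<le> exp (c * d i)"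
      using card_image_le[OF fin, of ?C] S(2) by linarith
    ultimately show "\<exists>\<S>. \<S> \<subseteq> Pow {1..d i} \<and> real (card \<S>) \<le> exp (c * d i) \<and>
        (\<forall>\<phi>\<in>AP G M act B \<beta> F \<delta> (d i) (\<sigma> i). \<exists>S\<in>\<S>. real (card (sym_diff S (pat G (d i) (- P) \<phi>))) \<le> c * d i)"
      by (intro exI[of _ "?C ` \<S>"]) auto
  qed
  then show "\<exists>B \<beta> F \<delta> P. valid B \<beta> F \<delta> \<and> (\<forall>x\<in>space M. \<beta> x \<in> P \<longleftrightarrow> x \<in> space M - D) \<and> few c B \<beta> F \<delta> P"
    using 1 by (intro exI[of _ B] exI[of _ \<beta>] exI[of _ F] exI[of _ \<delta>] exI[of _ "- P"]) auto
qed

lemma zero_set_empty: "zero_set {}"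
  unfolding zero_set_def
proof (intro conjI allI impI)
  fix c :: real assume "c > 0"
  have "valid {0} (\<lambda>_. 0) {\<one>} 1"
    by (auto simp: valid_def finite_observable_def)
  moreover have "few c {0} (\<lambda>_. 0) {\<one>} 1 {}"
    unfolding few_def
  proof (intro always_eventually allI)
    fix i
    show "\<exists>\<S>. \<S> \<subseteq> Pow {1..d i} \<and> real (card \<S>) \<le> exp (c * d i) \<and>
        (\<forall>\<phi>\<in>AP G M act {0} (\<lambda>_. 0) {\<one>} 1 (d i) (\<sigma> i). \<exists>S\<in>\<S>. real (card (sym_diff S (pat G (d i) {} \<phi>))) \<le> c * d i)"
      using \<open>c > 0\<close> by (intro exI[of _ "{{}}"]) (auto simp: pat_def)
  qed
  ultimately show "\<exists>B \<beta> F \<delta> P. valid B \<beta> F \<delta> \<and> (\<forall>x\<in>space M. \<beta> x \<in> P \<longleftrightarrow> x \<in> {}) \<and> few c B \<beta> F \<delta> P"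
    by (intro exI[of _ "{0}"] exI[of _ "\<lambda>_. 0"] exI[of _ "{\<one>}"] exI[of _ 1] exI[of _ "{}"]) auto
qed simp

text \<open>Over a joint observable both sets have families for \<open>c / 2\<close>. The unions of
  a member of one with a member of the other number at most the product of the two bounds, and the
  Hamming errors add.\<close>

lemma zero_set_Un:
  assumes "zero_set D" "zero_set E"
  shows "zero_set (D \<union> E)"
  unfolding zero_set_def
proof (intro conjI allI impI)
  show "D \<union> E \<in> sets M" using assms by (auto simp: zero_set_def)
  fix c :: real assume "c > 0"
  then have c2: "c / 2 > 0" by simp
  then obtain B0 \<beta>0 F0 \<delta>0 P0 where 0: "valid B0 \<beta>0 F0 \<delta>0" "\<forall>x\<in>space M. \<beta>0 x \<in> P0 \<longleftrightarrow> x \<in> D"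
      "few (c / 2) B0 \<beta>0 F0 \<delta>0 P0"
    using assms(1) unfolding zero_set_def by meson
  obtain B \<beta> F \<delta> \<rho> P where 1: "valid B \<beta> F \<delta>" "F0 \<subseteq> F" "\<delta> \<le> \<delta>0" "\<rho> \<in> B \<rightarrow> B0"
    "\<And>x. x \<in> space M \<Longrightarrow> \<rho> (\<beta> x) = \<beta>0 x" "\<And>x. x \<in> space M \<Longrightarrow> \<beta> x \<in> P \<longleftrightarrow> x \<in> E" "few (c / 2) B \<beta> F \<delta> P"
    by (rule zero_set_refine[OF assms(2) 0(1) c2]) (rule that)
  have few0: "few (c / 2) B \<beta> F \<delta> (\<rho> -` P0)"
    by (rule few_refine[OF 0(1) 1(1) 1(2) 1(3) 1(4) _ 0(3)]) (use 1 in auto)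
  have "few c B \<beta> F \<delta> (\<rho> -` P0 \<union> P)"
    using eventually_conj[OF few0[unfolded few_def] 1(7)[unfolded few_def]] unfolding few_def
  proof (rule eventually_mono, elim exE conjE)
    fix i \<S> \<T>
    let ?AP = "AP G M act B \<beta> F \<delta> (d i) (\<sigma> i)"
    assume S: "\<S> \<subseteq> Pow {1..d i}" "real (card \<S>) \<le> exp (c / 2 * d i)"
      "\<forall>\<phi>\<in>?AP. \<exists>S\<in>\<S>. real (card (sym_diff S (pat G (d i) (\<rho> -` P0) \<phi>))) \<le> c / 2 * d i"
      and T: "\<T> \<subseteq> Pow {1..d i}" "real (card \<T>) \<le> exp (c / 2 * d i)"
      "\<forall>\<phi>\<in>?AP. \<exists>S\<in>\<T>. real (card (sym_diff S (pat G (d i) P \<phi>))) \<le> c / 2 * d i"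
    let ?U = "(\<lambda>(S, T). S \<union> T) ` (\<S> \<times> \<T>)"
    have fin: "finite \<S>" "finite \<T>" using S(1) T(1) by (meson finite_Pow_iff finite_atLeastAtMost finite_subset)+
    have "\<exists>S\<in>?U. real (card (sym_diff S (pat G (d i) (\<rho> -` P0 \<union> P) \<phi>))) \<le> c * d i" if phi: "\<phi> \<in> ?AP" for \<phi>
    proof -
      obtain S where S': "S \<in> \<S>" "real (card (sym_diff S (pat G (d i) (\<rho> -` P0) \<phi>))) \<le> c / 2 * d i" using S(3) phi by blast
      obtain T where T': "T \<in> \<T>" "real (card (sym_diff T (pat G (d i) P \<phi>))) \<le> c / 2 * d i" using T(3) phi by blast
      have finST: "finite S" "finite T"
        using S(1) S'(1) T(1) T'(1) by (meson PowD finite_atLeastAtMost finite_subset subsetD)+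
      have "sym_diff (S \<union> T) (pat G (d i) (\<rho> -` P0 \<union> P) \<phi>) \<subseteq>
          sym_diff S (pat G (d i) (\<rho> -` P0) \<phi>) \<union> sym_diff T (pat G (d i) P \<phi>)"
        by (auto simp: pat_def)
      then have "card (sym_diff (S \<union> T) (pat G (d i) (\<rho> -` P0 \<union> P) \<phi>)) \<le>
          card (sym_diff S (pat G (d i) (\<rho> -` P0) \<phi>) \<union> sym_diff T (pat G (d i) P \<phi>))"
        using finST by (intro card_mono) auto
      also have "\<dots> \<le> card (sym_diff S (pat G (d i) (\<rho> -` P0) \<phi>)) + card (sym_diff T (pat G (d i) P \<phi>))"
        by (rule card_Un_le)
      finally have "card (sym_diff (S \<union> T) (pat G (d i) (\<rho> -` P0 \<union> P) \<phi>)) \<le> c * d i"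
        using S'(2) T'(2) by linarith
      then show ?thesis using S'(1) T'(1) by (intro bexI[of _ "S \<union> T"]) auto
    qed
    moreover have "real (card ?U) \<le> exp (c * d i)"
    proof -
      have "card ?U \<le> card \<S> * card \<T>"
        using card_image_le[of "\<S> \<times> \<T>" "\<lambda>(S, T). S \<union> T"] fin by (simp add: card_cartesian_product)
      then have "real (card ?U) \<le> real (card \<S>) * real (card \<T>)"
        using of_nat_mono[where 'a = real] unfolding of_nat_mult[symmetric] by blast
      also have "\<dots> \<le> exp (c / 2 * d i) * exp (c / 2 * d i)" using S(2) T(2) by (intro mult_mono) auto
      finally show ?thesis by (simp add: exp_add[symmetric])
    qed
    ultimately show "\<exists>\<S>. \<S> \<subseteq> Pow {1..d i} \<and> real (card \<S>) \<le> exp (c * d i) \<and>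
        (\<forall>\<phi>\<in>?AP. \<exists>S\<in>\<S>. real (card (sym_diff S (pat G (d i) (\<rho> -` P0 \<union> P) \<phi>))) \<le> c * d i)"
      using S(1) T(1) by (intro exI[of _ ?U]) auto
  qed
  then show "\<exists>B \<beta> F \<delta> P. valid B \<beta> F \<delta> \<and> (\<forall>x\<in>space M. \<beta> x \<in> P \<longleftrightarrow> x \<in> D \<union> E) \<and> few c B \<beta> F \<delta> P"
    using 0 1 by (intro exI[of _ B] exI[of _ \<beta>] exI[of _ F] exI[of _ \<delta>] exI[of _ "\<rho> -` P0 \<union> P"]) auto
qed

text \<open>The Hamming tolerance pays for the passage to the limit: the measure of the difference
  and the tolerance \<open>\<delta>\<close> cost at most \<open>c / 4\<close> each, and the family
  for \<open>E\<close> is taken for \<open>c / 2\<close>. The indicator \<open>\<beta>0\<close> of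
  \<open>D\<close> is joined to the observable so that it sees \<open>D\<close> at all.\<close>

lemma zero_set_limit:
  assumes D: "D \<in> sets M" and lim: "\<And>e. e > 0 \<Longrightarrow> \<exists>E. zero_set E \<and> measure M (sym_diff D E) < e"
  shows "zero_set D"
  unfolding zero_set_def
proof (intro conjI allI impI)
  fix c :: real assume "c > 0"
  then obtain E where E: "zero_set E" "measure M (sym_diff D E) < c / 4" using lim[of "c / 4"] by auto
  define \<beta>0 :: "'a \<Rightarrow> nat" where "\<beta>0 x = (if x \<in> D then 1 else 0)" for x
  have "finite_observable M {0, 1} \<beta>0"
    unfolding finite_observable_def
  proof (intro conjI, simp, subst measurable_count_space_eq2)
    have "\<beta>0 -` {0} \<inter> space M = space M - D" "\<beta>0 -` {1} \<inter> space M = D"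
      using sets.sets_into_space[OF D] by (auto simp: \<beta>0_def split: if_splits)
    then show "\<beta>0 \<in> space M \<rightarrow> {0, 1} \<and> (\<forall>a\<in>{0, 1}. \<beta>0 -` {a} \<inter> space M \<in> sets M)"
      using D by (auto simp: \<beta>0_def)
  qed simp
  then have v: "valid {0, 1} \<beta>0 {\<one>} (c / 4)" using \<open>c > 0\<close> by (simp add: valid_def)
  have c2: "c / 2 > 0" using \<open>c > 0\<close> by simp
  obtain B \<beta> F \<delta> \<rho> P where 1: "valid B \<beta> F \<delta>" "{\<one>} \<subseteq> F" "\<delta> \<le> c / 4" "\<rho> \<in> B \<rightarrow> {0, 1}"
    "\<And>x. x \<in> space M \<Longrightarrow> \<rho> (\<beta> x) = \<beta>0 x" "\<And>x. x \<in> space M \<Longrightarrow> \<beta> x \<in> P \<longleftrightarrow> x \<in> E" "few (c / 2) B \<beta> F \<delta> P"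
    by (rule zero_set_refine[OF E(1) v c2]) (rule that)
  have "{x \<in> space M. (\<beta> x \<in> P) \<noteq> (\<beta> x \<in> \<rho> -` {1})} = sym_diff D E"
    using 1(5,6) sets.sets_into_space[OF D] sets.sets_into_space[of E M] E(1)
    by (auto simp: \<beta>0_def zero_set_def split: if_splits)
  then have "few (c / 2 + c / 2) B \<beta> F \<delta> (\<rho> -` {1})"
    using 1(3) E(2) \<open>c > 0\<close> by (intro few_change[OF 1(1,7)]) auto
  then show "\<exists>B \<beta> F \<delta> P. valid B \<beta> F \<delta> \<and> (\<forall>x\<in>space M. \<beta> x \<in> P \<longleftrightarrow> x \<in> D) \<and> few c B \<beta> F \<delta> P"
    using 1(1,5) by (intro exI[of _ B] exI[of _ \<beta>] exI[of _ F] exI[of _ \<delta>] exI[of _ "\<rho> -` {1}"])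
      (auto simp: \<beta>0_def)
qed (rule D)

lemma zero_set_UN:
  fixes D :: "nat \<Rightarrow> 'a set"
  assumes D: "\<And>n. zero_set (D n)"
  shows "zero_set (\<Union>n. D n)"
proof (rule zero_set_limit)
  have sets: "D n \<in> sets M" for n using D by (simp add: zero_set_def)
  then show "(\<Union>n. D n) \<in> sets M" by auto
  have fin: "zero_set (\<Union>n<k. D n)" for k
  proof (induction k)
    case (Suc k)
    then show ?case using zero_set_Un[OF D[of k]] by (simp add: lessThan_Suc)
  qed (simp add: zero_set_empty)
  fix e :: real assume "e > 0"
  let ?R = "\<lambda>k. (\<Union>n. D n) - (\<Union>n<k. D n)"
  have "(\<lambda>k. measure M (?R k)) \<longlonglongrightarrow> measure M (\<Inter>k. ?R k)"
    using sets by (intro finite_Lim_measure_decseq) (auto simp: decseq_def)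
  moreover have "(\<Inter>k. ?R k) = {}" by auto
  ultimately have "(\<lambda>k. measure M (?R k)) \<longlonglongrightarrow> 0" by (simp only: measure_empty)
  then have "\<forall>\<^sub>F k in sequentially. measure M (?R k) < e" using \<open>e > 0\<close> by (rule order_tendstoD)
  then obtain k where "measure M (?R k) < e" by (auto simp: eventually_sequentially)
  moreover have "sym_diff (\<Union>n. D n) (\<Union>n<k. D n) = ?R k" by auto
  ultimately show "\<exists>E. zero_set E \<and> measure M (sym_diff (\<Union>n. D n) E) < e" using fin[of k] by metis
qed

lemma sigma_algebra_zero_set: "sigma_algebra (space M) {D. zero_set D}"
  unfolding sigma_algebra_iff2
proof (intro conjI ballI allI impI)
  show "{D. zero_set D} \<subseteq> Pow (space M)"
    using zero_set_sets sets.sets_into_space by blast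
  show "(\<Union>i. A i) \<in> {D. zero_set D}" if "range A \<subseteq> {D. zero_set D}" for A :: "nat \<Rightarrow> 'a set"
    using zero_set_UN[of A] that by blast
qed (use zero_set_empty zero_set_Compl in auto)

text \<open>Returns from approximate families to exact counts: every pattern is a member of the
  family changed on a set of density at most \<open>c \<le> a\<close>, and there are at most
  \<open>exp (e * d i)\<close> such sets.\<close>

lemma few_count:
  fixes a c e :: real
  assumes few: "few c B \<beta> F \<delta> P" and "c \<le> a"
    and a: "\<And>X :: nat set. finite X \<Longrightarrow> real (card {I. I \<subseteq> X \<and> real (card I) \<le> a * card X}) \<le> exp (e * card X)"
  shows "\<forall>\<^sub>F i in sequentially.
    real (card (pat G (d i) P ` AP G M act B \<beta> F \<delta> (d i) (\<sigma> i))) \<le> exp ((c + e) * d i)"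
  using few unfolding few_def
proof (rule eventually_mono, elim exE conjE)
  fix i \<S>
  let ?AP = "AP G M act B \<beta> F \<delta> (d i) (\<sigma> i)"
  assume S: "\<S> \<subseteq> Pow {1..d i}" "real (card \<S>) \<le> exp (c * d i)"
    "\<forall>\<phi>\<in>?AP. \<exists>S\<in>\<S>. real (card (sym_diff S (pat G (d i) P \<phi>))) \<le> c * d i"
  let ?N = "{I. I \<subseteq> {1..d i} \<and> real (card I) \<le> a * card {1..d i}}"
  have fin: "finite \<S>" "finite ?N" using S(1) by (auto intro: finite_subset)
  have "pat G (d i) P ` ?AP \<subseteq> (\<Union>S\<in>\<S>. (\<lambda>I. sym_diff S I) ` ?N)"
  proof
    fix T assume "T \<in> pat G (d i) P ` ?AP"
    then obtain \<phi> where \<phi>: "\<phi> \<in> ?AP" "T = pat G (d i) P \<phi>" by blast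
    then obtain S where S': "S \<in> \<S>" "real (card (sym_diff S T)) \<le> c * d i" using S(3) by blast
    have cd: "card {1..d i} = d i" by simp
    have ca: "c * d i \<le> a * d i" using \<open>c \<le> a\<close> by (intro mult_right_mono) auto
    have "real (card (sym_diff S T)) \<le> a * card {1..d i}"
      unfolding cd using S'(2) ca by linarith
    moreover have "sym_diff S T \<subseteq> {1..d i}" using S'(1) S(1) \<phi>(2) by (auto simp: pat_def)
    ultimately have "sym_diff S T \<in> ?N" by blast
    moreover have "T = sym_diff S (sym_diff S T)" by auto
    ultimately show "T \<in> (\<Union>S\<in>\<S>. (\<lambda>I. sym_diff S I) ` ?N)" using S'(1) by blast
  qed
  then have "card (pat G (d i) P ` ?AP) \<le> card (\<Union>S\<in>\<S>. (\<lambda>I. sym_diff S I) ` ?N)"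
    using fin by (intro card_mono) auto
  also have "\<dots> \<le> (\<Sum>S\<in>\<S>. card ((\<lambda>I. sym_diff S I) ` ?N))" using fin(1) by (rule card_UN_le)
  also have "\<dots> \<le> (\<Sum>S\<in>\<S>. card ?N)" using fin(2) by (intro sum_mono card_image_le)
  also have "\<dots> = card \<S> * card ?N" by simp
  finally have nat: "card (pat G (d i) P ` ?AP) \<le> card \<S> * card ?N" .
  have "real (card (pat G (d i) P ` ?AP)) \<le> real (card \<S>) * real (card ?N)"
    using of_nat_mono[OF nat, where 'a = real] unfolding of_nat_mult .
  also have "\<dots> \<le> exp (c * d i) * exp (e * d i)"
    using S(2) a[of "{1..d i}"] by (intro mult_mono) auto
  finally show "real (card (pat G (d i) P ` ?AP)) \<le> exp ((c + e) * d i)"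
    by (simp add: exp_add[symmetric] distrib_right)
qed

text \<open>The labels are treated one after the other, each by a further refinement, which keeps
  what was achieved for the earlier ones. The bound on \<open>\<delta>\<close> is carried along
  because every new label uses it up once.\<close>

lemma common_refinement:
  assumes zero: "\<And>D. D \<in> sets M \<Longrightarrow> zero_set D" and \<alpha>: "finite_observable M A \<alpha>" and "c > 0"
    and "finite \<A>"
  shows "\<exists>B \<beta> F \<delta> \<rho>. valid B \<beta> F \<delta> \<and> \<delta> \<le> c / 2 \<and> \<rho> \<in> B \<rightarrow> A \<and>
    (\<forall>x\<in>space M. \<rho> (\<beta> x) = \<alpha> x) \<and> (\<forall>a\<in>\<A>. few c B \<beta> F \<delta> (\<rho> -` {a}))"
  using \<open>finite \<A>\<close>
proof (induction \<A> rule: finite_induct)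
  case empty
  have "valid A \<alpha> {\<one>} (c / 2)" using \<alpha> \<open>c > 0\<close> by (simp add: valid_def)
  then show ?case by (intro exI[of _ A] exI[of _ \<alpha>] exI[of _ "{\<one>}"] exI[of _ "c / 2"] exI[of _ id]) auto
next
  case (insert a \<A>)
  from insert.IH obtain B \<beta> F \<delta> \<rho> where 1: "valid B \<beta> F \<delta>" "\<delta> \<le> c / 2" "\<rho> \<in> B \<rightarrow> A"
    "\<forall>x\<in>space M. \<rho> (\<beta> x) = \<alpha> x" "\<forall>a\<in>\<A>. few c B \<beta> F \<delta> (\<rho> -` {a})"
    by (elim exE conjE)
  have D: "zero_set {x \<in> space M. \<alpha> x \<in> {a}}"
    using zero observable_vimage_sets[OF \<alpha>] by blast
  have c2: "c / 2 > 0" using \<open>c > 0\<close> by simp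
  obtain B' \<beta>' F' \<delta>' \<rho>' P where 2: "valid B' \<beta>' F' \<delta>'" "F \<subseteq> F'" "\<delta>' \<le> \<delta>" "\<rho>' \<in> B' \<rightarrow> B"
    "\<And>x. x \<in> space M \<Longrightarrow> \<rho>' (\<beta>' x) = \<beta> x"
    "\<And>x. x \<in> space M \<Longrightarrow> \<beta>' x \<in> P \<longleftrightarrow> x \<in> {x \<in> space M. \<alpha> x \<in> {a}}" "few (c / 2) B' \<beta>' F' \<delta>' P"
    by (rule zero_set_refine[OF D 1(1) c2]) (rule that)
  \<comment> \<open>On \<open>space M\<close> the set \<open>P\<close> and the preimage of
    \<open>a\<close> select the same points, but they may differ at labels that are never taken. The
    change costs only the tolerance, and \<open>\<delta>' \<le> c / 2\<close>.\<close>
  have "few (c / 2 + c / 2) B' \<beta>' F' \<delta>' ((\<rho> \<circ> \<rho>') -` {a})"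
  proof (rule few_change[OF 2(1) 2(7)])
    have "{x \<in> space M. (\<beta>' x \<in> P) \<noteq> (\<beta>' x \<in> (\<rho> \<circ> \<rho>') -` {a})} = {}"
      using 2(5,6) 1(4) by auto
    then show "measure M {x \<in> space M. (\<beta>' x \<in> P) \<noteq> (\<beta>' x \<in> (\<rho> \<circ> \<rho>') -` {a})} + \<delta>' \<le> c / 2"
      using 1(2) 2(3) by (simp only: measure_empty)
  qed (use c2 in simp)
  moreover have "few c B' \<beta>' F' \<delta>' ((\<rho> \<circ> \<rho>') -` {a'})" if "a' \<in> \<A>" for a'
    using few_refine[OF 1(1) 2(1,2,3,4,5), of c "\<rho> -` {a'}"] 1(5) that by (simp add: vimage_comp)
  ultimately show ?case
    using 1 2 by (intro exI[of _ B'] exI[of _ \<beta>'] exI[of _ F'] exI[of _ \<delta>'] exI[of _ "\<rho> \<circ> \<rho>'"])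
      (auto simp: comp_def)
qed

text \<open>A labelling is determined by its level sets, hence by one pattern for each label in
  \<open>A\<close>; the number of labellings is at most the product of the numbers of
  patterns.\<close>

lemma entropy_loc_le:
  fixes c :: real
  assumes v: "valid B \<beta> F \<delta>" and \<rho>: "\<rho> \<in> B \<rightarrow> A" and A: "finite A" and "c > 0"
    and count: "\<And>a. a \<in> A \<Longrightarrow> \<forall>\<^sub>F i in sequentially.
      real (card (pat G (d i) (\<rho> -` {a}) ` AP G M act B \<beta> F \<delta> (d i) (\<sigma> i))) \<le> exp (c * d i)"
  shows "entropy_loc G d \<sigma> M act B \<beta> \<rho> F \<delta> \<le> ereal (card A * c)"
  unfolding entropy_loc_def
proof (rule Limsup_bounded)
  have "\<forall>\<^sub>F i in sequentially. \<forall>a\<in>A.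
      real (card (pat G (d i) (\<rho> -` {a}) ` AP G M act B \<beta> F \<delta> (d i) (\<sigma> i))) \<le> exp (c * d i)"
    using count A by (simp add: eventually_ball_finite_distrib)
  then show "\<forall>\<^sub>F i in sequentially. ereal (1 / real (d i)) *
       log_card ((\<lambda>\<phi>. \<lambda>j\<in>{1..d i}. \<rho> (\<phi> j \<one>)) ` AP G M act B \<beta> F \<delta> (d i) (\<sigma> i)) \<le> ereal (card A * c)"
  proof eventually_elim
    case (elim i)
    let ?AP = "AP G M act B \<beta> F \<delta> (d i) (\<sigma> i)" and ?n = "d i"
    let ?L = "(\<lambda>\<phi>. \<lambda>j\<in>{1..?n}. \<rho> (\<phi> j \<one>)) ` ?AP"
    let ?p = "\<lambda>a. pat G ?n (\<rho> -` {a}) ` ?AP"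
    define h where "h \<psi> = (\<lambda>a\<in>A. {j \<in> {1..?n}. \<psi> j = a})" for \<psi> :: "nat \<Rightarrow> nat"
    have finp: "finite (?p a)" for a
      by (rule finite_subset[of _ "Pow {1..?n}"]) (auto simp: pat_def)
    have inj: "inj_on h ?L"
    proof (rule inj_onI)
      fix \<psi> \<psi>' assume L: "\<psi> \<in> ?L" "\<psi>' \<in> ?L" and eq: "h \<psi> = h \<psi>'"
      have mem: "\<theta> j \<in> A" if "\<theta> \<in> ?L" "j \<in> {1..?n}" for \<theta> j
        using that v \<rho> by (auto simp: AP_def PiE_def Pi_def valid_def)
      show "\<psi> = \<psi>'"
      proof (rule extensionalityI[of _ "{1..?n}"])
        fix j assume j: "j \<in> {1..?n}"
        then have "h \<psi> (\<psi> j) = h \<psi>' (\<psi> j)" using eq by simp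
        then have sets: "{k \<in> {1..?n}. \<psi> k = \<psi> j} = {k \<in> {1..?n}. \<psi>' k = \<psi> j}"
          using mem[OF L(1) j] by (simp add: h_def)
        have "j \<in> {k \<in> {1..?n}. \<psi> k = \<psi> j}" using j by simp
        then have "j \<in> {k \<in> {1..?n}. \<psi>' k = \<psi> j}" unfolding sets .
        then show "\<psi> j = \<psi>' j" by simp
      qed (use L in auto)
    qed
    have "h ` ?L \<subseteq> (\<Pi>\<^sub>E a\<in>A. ?p a)"
    proof
      fix k assume "k \<in> h ` ?L"
      then obtain \<phi> where \<phi>: "\<phi> \<in> ?AP" "k = h (\<lambda>j\<in>{1..?n}. \<rho> (\<phi> j \<one>))" by blast
      have "k a = pat G ?n (\<rho> -` {a}) \<phi>" if "a \<in> A" for a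
        using that unfolding \<phi>(2) h_def pat_def by auto
      then show "k \<in> (\<Pi>\<^sub>E a\<in>A. ?p a)" using \<phi> by (auto simp: h_def)
    qed
    then have "card ?L \<le> card (\<Pi>\<^sub>E a\<in>A. ?p a)"
      using A finp inj by (intro card_inj_on_le[of h] finite_PiE) auto
    also have "\<dots> = (\<Prod>a\<in>A. card (?p a))" using A by (rule card_PiE)
    finally have nat: "card ?L \<le> (\<Prod>a\<in>A. card (?p a))" .
    have "real (card ?L) \<le> (\<Prod>a\<in>A. real (card (?p a)))"
      using of_nat_mono[OF nat, where 'a = real] unfolding of_nat_prod .
    also have "\<dots> \<le> (\<Prod>a\<in>A. exp (c * ?n))" using elim by (intro prod_mono) auto
    also have "\<dots> = exp (card A * c * ?n)" by (simp add: exp_of_nat_mult mult.assoc)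
    finally have le: "real (card ?L) \<le> exp (card A * c * ?n)" .
    show ?case
    proof (cases "card ?L = 0")
      case True
      then show ?thesis using \<open>c > 0\<close> by (simp add: log_card_def)
    next
      case False
      then have "ln (real (card ?L)) \<le> ln (exp (card A * c * ?n))"
        using le by (subst ln_le_cancel_iff) (simp_all only: of_nat_0_less_iff exp_gt_zero neq0_conv)
      then have "ln (real (card ?L)) \<le> card A * c * ?n" by (simp only: ln_exp)
      then have "1 / real ?n * ln (real (card ?L)) \<le> card A * c" by (simp add: field_simps)
      then show ?thesis using False by (simp add: log_card_def)
    qed
  qed
qed

lemma sofic_entropy_le_0:
  assumes zero: "\<And>D. D \<in> sets M \<Longrightarrow> zero_set D"
  shows "sofic_entropy G d \<sigma> M act \<le> 0"
  unfolding sofic_entropy_def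
proof (rule SUP_least, clarify)
  fix A \<alpha> assume \<alpha>: "finite_observable M A \<alpha>"
  then have A: "finite A" by (simp add: finite_observable_def)
  show "(INF (B, \<beta>, \<pi>)\<in>{(B, \<beta>, \<pi>). finite_observable M B \<beta> \<and> refines_via M A \<alpha> B \<beta> \<pi>}.
            entropy_rel G d \<sigma> M act B \<beta> \<pi>) \<le> 0" (is "?INF \<le> 0")
  proof (rule ereal_le_epsilon2)
    fix e :: real assume "e > 0"
    \<comment> \<open>There are \<open>card A\<close> factors, each of rate
      \<open>a + e' \<le> 2 * e'\<close>.\<close>
    define e' where "e' = e / (2 * (card A + 1))"
    have e': "e' > 0" using \<open>e > 0\<close> by (simp add: e'_def)
    obtain a where a: "a > 0" "a \<le> e'"
      "\<And>X :: nat set. finite X \<Longrightarrow> real (card {I. I \<subseteq> X \<and> real (card I) \<le> a * card X}) \<le> exp (e' * card X)"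
      using card_small_subsets_le[OF e'] by metis
    have "\<exists>B \<beta> F \<delta> \<rho>. valid B \<beta> F \<delta> \<and> \<delta> \<le> a / 2 \<and> \<rho> \<in> B \<rightarrow> A \<and>
        (\<forall>x\<in>space M. \<rho> (\<beta> x) = \<alpha> x) \<and> (\<forall>x\<in>A. few a B \<beta> F \<delta> (\<rho> -` {x}))"
      by (rule common_refinement[OF _ \<alpha> a(1) A]) (rule zero)
    then obtain B \<beta> F \<delta> \<rho> where 1: "valid B \<beta> F \<delta>" "\<delta> \<le> a / 2" "\<rho> \<in> B \<rightarrow> A" "\<forall>x\<in>space M. \<rho> (\<beta> x) = \<alpha> x"
        "\<forall>x\<in>A. few a B \<beta> F \<delta> (\<rho> -` {x})"
      by (elim exE conjE)
    have "?INF \<le> entropy_rel G d \<sigma> M act B \<beta> \<rho>"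
      using 1 by (intro INF_lower2[of "(B, \<beta>, \<rho>)"]) (auto simp: valid_def refines_via_def)
    also have "\<dots> \<le> entropy_loc G d \<sigma> M act B \<beta> \<rho> F \<delta>"
      unfolding entropy_rel_def using 1(1) by (intro INF_lower2[of "(F, \<delta>)"]) (auto simp: valid_def)
    also have "\<dots> \<le> ereal (card A * (a + e'))"
      using 1 A a e' by (intro entropy_loc_le few_count[where a = a]) auto
    also have "card A * (a + e') \<le> e"
    proof -
      have "card A * (a + e') \<le> card A * (2 * e')" using a by (intro mult_left_mono) auto
      also have "\<dots> = e * (card A / (card A + 1))" by (simp add: e'_def divide_simps)
      also have "\<dots> \<le> e * 1" using \<open>e > 0\<close> by (intro mult_left_mono) auto
      finally show ?thesis by simp
    qed
    finally show "?INF \<le> 0 + ereal e" by simp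
  qed
qed

section \<open>Matrices of group ring elements: sums of permutation matrices with weights
  \<open>F\<close>\<close>

definition perm_matrix :: "nat \<Rightarrow> ('g \<Rightarrow> real) \<Rightarrow> nat \<Rightarrow> nat \<Rightarrow> real" where
  "perm_matrix i F j k = (\<Sum>g | F g \<noteq> 0. F g * of_bool (\<sigma> i g k = j))"

lemma perm_matrix_apply:
  assumes F: "F \<in> fin_supp G" and j: "j \<in> {1..d i}"
  shows "(\<Sum>k\<in>{1..d i}. perm_matrix i F j k * y k) = (\<Sum>g | F g \<noteq> 0. F g * y (inv_into {1..d i} (\<sigma> i g) j))"
proof -
  have "(\<Sum>k\<in>{1..d i}. perm_matrix i F j k * y k) =
      (\<Sum>g | F g \<noteq> 0. \<Sum>k\<in>{1..d i}. F g * (of_bool (\<sigma> i g k = j) * y k))"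
    unfolding perm_matrix_def sum_distrib_right by (subst sum.swap) (simp add: mult.assoc)
  also have "\<dots> = (\<Sum>g | F g \<noteq> 0. F g * y (inv_into {1..d i} (\<sigma> i g) j))"
  proof (rule sum.cong[OF refl])
    fix g assume "g \<in> {g. F g \<noteq> 0}"
    then have perm: "\<sigma> i g permutes {1..d i}" using F \<sigma>_permutes by (auto simp: fin_supp_def)
    let ?k = "inv_into {1..d i} (\<sigma> i g) j"
    have im: "j \<in> \<sigma> i g ` {1..d i}" using j permutes_image[OF perm] by simp
    have k: "?k \<in> {1..d i}" "\<sigma> i g ?k = j"
      using inv_into_into[OF im] f_inv_into_f[OF im] by auto
    have iff: "\<sigma> i g k = j \<longleftrightarrow> k = ?k" for k
      using inj_eq[OF permutes_inj[OF perm], of k ?k] unfolding k(2) .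
    have "(\<Sum>k\<in>{1..d i}. F g * (of_bool (\<sigma> i g k = j) * y k)) = (\<Sum>k\<in>{1..d i}. if k = ?k then F g * y k else 0)"
      unfolding iff by (intro sum.cong) auto
    also have "\<dots> = F g * y ?k" using k(1) by simp
    finally show "(\<Sum>k\<in>{1..d i}. F g * (of_bool (\<sigma> i g k = j) * y k)) = F g * y ?k" .
  qed
  finally show ?thesis .
qed

text \<open>The normalized squared norm is the double sum of \<open>F g * F h\<close> times the
  proportion of points at which \<open>\<sigma> i g\<close> and \<open>\<sigma> i h\<close> agree.
  For distinct \<open>g\<close> and \<open>h\<close> this proportion tends to 0, so the limit is the
  squared 2-norm of \<open>F\<close>. The factor 4 is slack, in the form that
  \<open>sign_patterns_bound\<close> expects.\<close>

lemma perm_matrix_HS: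
  assumes F: "F \<in> fin_supp G" and \<epsilon>: "FS.nrm F < \<epsilon>"
  shows "\<forall>\<^sub>F i in sequentially. (\<Sum>j\<in>{1..d i}. \<Sum>k\<in>{1..d i}. (perm_matrix i F j k)\<^sup>2) \<le> 4 * \<epsilon>\<^sup>2 * card {1..d i}"
proof -
  let ?E = "{g. F g \<noteq> 0}"
  have E: "finite ?E" "?E \<subseteq> carrier G" using F by (auto simp: fin_supp_def)
  have HS: "(\<Sum>j\<in>{1..d i}. \<Sum>k\<in>{1..d i}. (perm_matrix i F j k)\<^sup>2) =
      (\<Sum>g\<in>?E. \<Sum>h\<in>?E. F g * F h * unif (d i) {k. \<sigma> i g k = \<sigma> i h k}) * d i" for i
  proof -
    have "(\<Sum>j\<in>{1..d i}. (perm_matrix i F j k)\<^sup>2) =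
        (\<Sum>g\<in>?E. \<Sum>h\<in>?E. F g * F h * of_bool (\<sigma> i g k = \<sigma> i h k))" if k: "k \<in> {1..d i}" for k
    proof -
      have "(\<Sum>j\<in>{1..d i}. (perm_matrix i F j k)\<^sup>2) =
          (\<Sum>j\<in>{1..d i}. \<Sum>g\<in>?E. \<Sum>h\<in>?E. F g * F h * (of_bool (\<sigma> i g k = j) * of_bool (\<sigma> i h k = j)))"
        unfolding perm_matrix_def power2_eq_square sum_product by (intro sum.cong refl) (simp add: mult_ac)
      also have "\<dots> = (\<Sum>g\<in>?E. \<Sum>j\<in>{1..d i}. \<Sum>h\<in>?E. F g * F h * (of_bool (\<sigma> i g k = j) * of_bool (\<sigma> i h k = j)))"
        by (rule sum.swap)
      also have "\<dots> = (\<Sum>g\<in>?E. \<Sum>h\<in>?E. \<Sum>j\<in>{1..d i}. F g * F h * (of_bool (\<sigma> i g k = j) * of_bool (\<sigma> i h k = j)))"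
        by (rule sum.cong[OF refl], rule sum.swap)
      also have "\<dots> = (\<Sum>g\<in>?E. \<Sum>h\<in>?E. F g * F h * of_bool (\<sigma> i g k = \<sigma> i h k))"
      proof (intro sum.cong refl)
        fix g h assume "g \<in> ?E"
        then have m: "\<sigma> i g k \<in> {1..d i}" using E k permutes_in_image[OF \<sigma>_permutes] by blast
        have "(\<Sum>j\<in>{1..d i}. F g * F h * (of_bool (\<sigma> i g k = j) * of_bool (\<sigma> i h k = j))) =
            (\<Sum>j\<in>{1..d i}. if \<sigma> i g k = j then F g * F h * of_bool (\<sigma> i g k = \<sigma> i h k) else 0)"
          by (intro sum.cong) auto
        then show "(\<Sum>j\<in>{1..d i}. F g * F h * (of_bool (\<sigma> i g k = j) * of_bool (\<sigma> i h k = j))) =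
            F g * F h * of_bool (\<sigma> i g k = \<sigma> i h k)" using m by simp
      qed
      finally show ?thesis .
    qed
    then have "(\<Sum>j\<in>{1..d i}. \<Sum>k\<in>{1..d i}. (perm_matrix i F j k)\<^sup>2) =
        (\<Sum>k\<in>{1..d i}. \<Sum>g\<in>?E. \<Sum>h\<in>?E. F g * F h * of_bool (\<sigma> i g k = \<sigma> i h k))"
      by (subst sum.swap) simp
    also have "\<dots> = (\<Sum>g\<in>?E. \<Sum>k\<in>{1..d i}. \<Sum>h\<in>?E. F g * F h * of_bool (\<sigma> i g k = \<sigma> i h k))"
      by (rule sum.swap)
    also have "\<dots> = (\<Sum>g\<in>?E. \<Sum>h\<in>?E. \<Sum>k\<in>{1..d i}. F g * F h * of_bool (\<sigma> i g k = \<sigma> i h k))"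
      by (rule sum.cong[OF refl], rule sum.swap)
    also have "\<dots> = (\<Sum>g\<in>?E. \<Sum>h\<in>?E. F g * F h * unif (d i) {k. \<sigma> i g k = \<sigma> i h k} * d i)"
    proof (intro sum.cong refl)
      fix g h
      have "(\<Sum>k\<in>{1..d i}. F g * F h * of_bool (\<sigma> i g k = \<sigma> i h k)) =
          F g * F h * card ({1..d i} \<inter> {k. \<sigma> i g k = \<sigma> i h k})"
        by (simp add: sum_distrib_left[symmetric] of_bool_def sum.If_cases)
      then show "(\<Sum>k\<in>{1..d i}. F g * F h * of_bool (\<sigma> i g k = \<sigma> i h k)) =
          F g * F h * unif (d i) {k. \<sigma> i g k = \<sigma> i h k} * d i"
        unfolding unif_eq_card[OF d_pos] by simp
    qed
    finally show ?thesis by (simp add: sum_distrib_right)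
  qed
  have u: "(\<lambda>i. unif (d i) {k. \<sigma> i g k = \<sigma> i h k}) \<longlonglongrightarrow> of_bool (g = h)" if "g \<in> ?E" "h \<in> ?E" for g h
  proof (cases "g = h")
    case False
    then have "(\<lambda>i. unif (d i) {k. \<sigma> i g k \<noteq> \<sigma> i h k}) \<longlonglongrightarrow> 1"
      using sofic E that unfolding sofic_approximation_def by blast
    then have "(\<lambda>i. 1 - unif (d i) {k. \<sigma> i g k \<noteq> \<sigma> i h k}) \<longlonglongrightarrow> 1 - 1" by (intro tendsto_intros)
    moreover have "1 - unif (d i) {k. \<sigma> i g k \<noteq> \<sigma> i h k} = unif (d i) {k. \<sigma> i g k = \<sigma> i h k}" for i
      using measure_pmf.prob_compl[of "{k. \<sigma> i g k \<noteq> \<sigma> i h k}" "pmf_of_set {1..d i}"]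
      by (simp add: Compl_eq_Diff_UNIV[symmetric] Collect_neg_eq[symmetric])
    ultimately show ?thesis using False by simp
  qed simp
  have "(\<lambda>i. \<Sum>g\<in>?E. \<Sum>h\<in>?E. F g * F h * unif (d i) {k. \<sigma> i g k = \<sigma> i h k}) \<longlonglongrightarrow>
      (\<Sum>g\<in>?E. \<Sum>h\<in>?E. F g * F h * of_bool (g = h))"
    by (intro tendsto_sum tendsto_mult tendsto_const u)
  also have "(\<Sum>g\<in>?E. \<Sum>h\<in>?E. F g * F h * of_bool (g = h)) = (FS.nrm F)\<^sup>2"
  proof -
    have "(\<Sum>h\<in>?E. F g * F h * of_bool (g = h)) = (F g)\<^sup>2" if "g \<in> ?E" for g
    proof -
      have "(\<Sum>h\<in>?E. F g * F h * of_bool (g = h)) = (\<Sum>h\<in>?E. if g = h then (F g)\<^sup>2 else 0)"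
        by (intro sum.cong) (auto simp: power2_eq_square)
      then show ?thesis using that E by simp
    qed
    then show ?thesis using fsnrm_power2[OF F E(1)] by simp
  qed
  finally have lim: "(\<lambda>i. \<Sum>g\<in>?E. \<Sum>h\<in>?E. F g * F h * unif (d i) {k. \<sigma> i g k = \<sigma> i h k}) \<longlonglongrightarrow> (FS.nrm F)\<^sup>2" .
  have "FS.nrm F \<ge> 0" using F by (rule FS.nrm_nonneg)
  then have "(FS.nrm F)\<^sup>2 < 4 * \<epsilon>\<^sup>2" using \<epsilon> power_strict_mono[of "FS.nrm F" \<epsilon> 2] by (smt (verit) zero_le_power2 zero_less_numeral pos2)
  then have "\<forall>\<^sub>F i in sequentially. (\<Sum>g\<in>?E. \<Sum>h\<in>?E. F g * F h * unif (d i) {k. \<sigma> i g k = \<sigma> i h k}) < 4 * \<epsilon>\<^sup>2"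
    using lim by (intro order_tendstoD)
  then show ?thesis
  proof (rule eventually_mono)
    fix i
    assume lt: "(\<Sum>g\<in>?E. \<Sum>h\<in>?E. F g * F h * unif (d i) {k. \<sigma> i g k = \<sigma> i h k}) < 4 * \<epsilon>\<^sup>2"
    have cd: "card {1..d i} = d i" by simp
    show "(\<Sum>j\<in>{1..d i}. \<Sum>k\<in>{1..d i}. (perm_matrix i F j k)\<^sup>2) \<le> 4 * \<epsilon>\<^sup>2 * card {1..d i}"
      unfolding HS cd by (intro mult_right_mono less_imp_le[OF lt]) auto
  qed
qed

end

section \<open>Level sets\<close>

text \<open>Rounding towards zero to multiples of 1/\<open>n\<close>, truncated at absolute value
  \<open>n\<close>, so that the range is finite. Rounding towards zero never reverses a sign and
  never increases the absolute value.\<close>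

definition rnd :: "nat \<Rightarrow> real \<Rightarrow> real" where
  "rnd n y = sgn y * min (real n) (of_int \<lfloor>real n * \<bar>y\<bar>\<rfloor> / real n)"

lemma rnd_measurable [measurable]: "rnd n \<in> borel_measurable borel"
  unfolding rnd_def by measurable

lemma finite_range_rnd: "finite (range (rnd n))"
proof (rule finite_subset)
  show "range (rnd n) \<subseteq> (\<lambda>(s, k). s * (real k / real n)) ` ({-1, 0, 1} \<times> {..n * n})"
  proof
    fix z assume "z \<in> range (rnd n)"
    then obtain y where z: "z = rnd n y" by blast
    define k where "k = min (n * n) (nat \<lfloor>real n * \<bar>y\<bar>\<rfloor>)"
    have "real (nat \<lfloor>real n * \<bar>y\<bar>\<rfloor>) = of_int \<lfloor>real n * \<bar>y\<bar>\<rfloor>" by simp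
    moreover have "real k = min (real n * real n) (real (nat \<lfloor>real n * \<bar>y\<bar>\<rfloor>))"
      unfolding k_def min_def of_nat_mult[symmetric] of_nat_le_iff by simp
    ultimately have k: "real k = min (real n * real n) (of_int \<lfloor>real n * \<bar>y\<bar>\<rfloor>)" by metis
    have "min (real n) (of_int \<lfloor>real n * \<bar>y\<bar>\<rfloor> / real n) = real k / real n"
      unfolding k by (cases "n = 0") (auto simp: min_def field_simps)
    then have "z = sgn y * (real k / real n)" by (simp add: z rnd_def)
    moreover have "sgn y \<in> {-1, 0, 1}" by (auto simp: sgn_if)
    moreover have "k \<le> n * n" by (simp add: k_def)
    ultimately show "z \<in> (\<lambda>(s, k). s * (real k / real n)) ` ({-1, 0, 1} \<times> {..n * n})" by force
  qed
qed simp

lemma abs_rnd: "\<bar>rnd n y\<bar> = (if y = 0 then 0 else min (real n) (of_int \<lfloor>real n * \<bar>y\<bar>\<rfloor> / real n))"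
  by (simp add: rnd_def abs_mult abs_sgn_eq)

lemma abs_rnd_le: "\<bar>rnd n y\<bar> \<le> \<bar>y\<bar>"
proof -
  have "of_int \<lfloor>real n * \<bar>y\<bar>\<rfloor> / real n \<le> \<bar>y\<bar>"
    by (cases "n = 0") (auto simp: divide_le_eq mult.commute)
  then show ?thesis unfolding abs_rnd by (auto simp: min.coboundedI2)
qed

lemma abs_rnd_ge: "n > 0 \<Longrightarrow> min (real n) (\<bar>y\<bar> - 1 / n) \<le> \<bar>rnd n y\<bar>"
proof -
  assume n: "n > 0"
  have "real n * \<bar>y\<bar> - 1 \<le> of_int \<lfloor>real n * \<bar>y\<bar>\<rfloor>" by linarith
  then have "(real n * \<bar>y\<bar> - 1) / n \<le> of_int \<lfloor>real n * \<bar>y\<bar>\<rfloor> / n" by (rule divide_right_mono) simp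
  moreover have "(real n * \<bar>y\<bar> - 1) / n = \<bar>y\<bar> - 1 / n" using n by (simp add: field_simps)
  ultimately have le: "\<bar>y\<bar> - 1 / n \<le> of_int \<lfloor>real n * \<bar>y\<bar>\<rfloor> / n" by simp
  show ?thesis
  proof (cases "y = 0")
    case True
    then show ?thesis by (intro min.coboundedI2) (simp add: abs_rnd)
  next
    case False
    then show ?thesis unfolding abs_rnd using le by (simp add: min.coboundedI1 min.coboundedI2)
  qed
qed

lemma rnd_eq: "rnd n y = sgn y * \<bar>rnd n y\<bar>"
  by (auto simp: rnd_def abs_mult abs_sgn_eq sgn_if)

lemma abs_diff_rnd: "\<bar>y - rnd n y\<bar> = \<bar>y\<bar> - \<bar>rnd n y\<bar>"
proof -
  have "y - rnd n y = sgn y * (\<bar>y\<bar> - \<bar>rnd n y\<bar>)"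
    using rnd_eq[of n y] by (simp add: right_diff_distrib mult_sgn_abs)
  then have "\<bar>y - rnd n y\<bar> = \<bar>sgn y\<bar> * \<bar>\<bar>y\<bar> - \<bar>rnd n y\<bar>\<bar>" by (simp only: abs_mult)
  also have "\<bar>\<bar>y\<bar> - \<bar>rnd n y\<bar>\<bar> = \<bar>y\<bar> - \<bar>rnd n y\<bar>" using abs_rnd_le[of n y] by simp
  finally show ?thesis by (cases "y = 0") (simp_all add: abs_sgn_eq abs_rnd)
qed

lemma rnd_tendsto: "(\<lambda>n. \<bar>y - rnd n y\<bar>) \<longlonglongrightarrow> 0"
proof (rule Lim_null_comparison[of _ "\<lambda>n. 1 / real n"])
  have "\<forall>\<^sub>F n in sequentially. n > nat \<lceil>\<bar>y\<bar>\<rceil>" by (rule eventually_gt_at_top)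
  then show "\<forall>\<^sub>F n in sequentially. norm \<bar>y - rnd n y\<bar> \<le> 1 / real n"
  proof eventually_elim
    case (elim n)
    then have ny: "real n \<ge> \<bar>y\<bar>" "n > 0" by linarith+
    have "\<bar>y\<bar> - 1 / n \<le> real n" by (rule order_trans[of _ "\<bar>y\<bar>"]) (use ny in simp_all)
    then have "min (real n) (\<bar>y\<bar> - 1 / n) = \<bar>y\<bar> - 1 / n" by (rule min.absorb2)
    then show ?case using abs_rnd_ge[of n y] ny abs_diff_rnd[of y n] by simp
  qed
qed (rule lim_1_over_n)

lemma rnd_L2:
  assumes "f \<in> L2 M"
  shows "(\<lambda>x. rnd n (f x)) \<in> L2 M" and "L2.nrm M (\<lambda>x. rnd n (f x)) \<le> L2.nrm M f"
proof -
  have [measurable]: "f \<in> borel_measurable M" using assms by auto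
  have le: "(rnd n (f x))\<^sup>2 \<le> (f x)\<^sup>2" for x
    using abs_rnd_le[of n "f x"] by (simp add: abs_le_square_iff)
  have int: "integrable M (\<lambda>x. (rnd n (f x))\<^sup>2)"
    using le by (intro Bochner_Integration.integrable_bound[OF L2_integrable_power2[OF assms]]) auto
  then show r: "(\<lambda>x. rnd n (f x)) \<in> L2 M" by (simp add: L2_def)
  have "(L2.nrm M (\<lambda>x. rnd n (f x)))\<^sup>2 \<le> (L2.nrm M f)\<^sup>2"
    unfolding L2_nrm_power2 using le int L2_integrable_power2[OF assms] by (intro integral_mono)
  then show "L2.nrm M (\<lambda>x. rnd n (f x)) \<le> L2.nrm M f"
    by (rule power2_le_imp_le) (rule L2.nrm_nonneg[OF assms])
qed

lemma rnd_L2_tendsto: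
  assumes "f \<in> L2 M"
  shows "(\<lambda>n. L2.nrm M (f - (\<lambda>x. rnd n (f x)))) \<longlonglongrightarrow> 0"
proof -
  have [measurable]: "f \<in> borel_measurable M" using assms by auto
  have "(\<lambda>n. \<integral>x. (f x - rnd n (f x))\<^sup>2 \<partial>M) \<longlonglongrightarrow> (\<integral>x. 0 \<partial>M)"
  proof (rule integral_dominated_convergence)
    show "integrable M (\<lambda>x. (f x)\<^sup>2)" by (rule L2_integrable_power2[OF assms])
    show "AE x in M. (\<lambda>n. (f x - rnd n (f x))\<^sup>2) \<longlonglongrightarrow> 0"
    proof (intro AE_I2)
      fix x
      show "(\<lambda>n. (f x - rnd n (f x))\<^sup>2) \<longlonglongrightarrow> 0"
        using tendsto_power[OF rnd_tendsto[of "f x"], of 2] by simp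
    qed
    have "\<bar>f x - rnd n (f x)\<bar> \<le> \<bar>f x\<bar>" for n x
      unfolding abs_diff_rnd using abs_ge_zero[of "rnd n (f x)"] by linarith
    then show "\<And>n. AE x in M. norm ((f x - rnd n (f x))\<^sup>2) \<le> (f x)\<^sup>2"
      by (intro AE_I2) (simp add: abs_le_square_iff)
  qed measurable
  then have "(\<lambda>n. sqrt (\<integral>x. (f x - rnd n (f x))\<^sup>2 \<partial>M)) \<longlonglongrightarrow> sqrt 0"
    by (intro tendsto_real_sqrt) simp
  then show ?thesis by (simp add: L2.nrm_def l2ip_def power2_eq_square)
qed

context pmp_system
begin

lemma conv_nrm_le:
  assumes F: "F \<in> fin_supp G" and f: "f \<in> L2 M"
  shows "L2.nrm M (conv G act F f) \<le> (\<Sum>g | F g \<noteq> 0. \<bar>F g\<bar>) * L2.nrm M f"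
proof -
  have c: "g \<in> carrier G" if "F g \<noteq> 0" for g using F that by (auto simp: fin_supp_def)
  have "L2.nrm M (conv G act F f) \<le> (\<Sum>g | F g \<noteq> 0. L2.nrm M (F g *\<^sub>R koop G act g f))"
    unfolding conv_def using c f by (intro L2.nrm_sum_le L2.scale_mem koop_L2) auto
  also have "\<dots> = (\<Sum>g | F g \<noteq> 0. \<bar>F g\<bar> * L2.nrm M f)"
    using c f by (intro sum.cong refl) (simp add: L2.nrm_scale koop_L2 koop_nrm)
  finally show ?thesis by (simp add: sum_distrib_right)
qed

text \<open>\<open>F\<close> is fixed before \<open>n\<close>, so the sum of its absolute values is
  a constant and the rounding errors tend to zero. The function \<open>w\<close> is rounded around
  \<open>t\<close> instead of 0 so that no value changes to the other side of the level
  \<open>t\<close>.\<close>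

lemma simple_approximation:
  assumes F: "F \<in> fin_supp G" and w: "w \<in> L2 M" and \<eta>: "\<eta> \<in> L2 M"
    and lt: "L2.nrm M (conv G act F \<eta> - w) < e"
  shows "\<forall>\<^sub>F n in sequentially.
    L2.nrm M (conv G act F (\<lambda>x. rnd n (\<eta> x)) - (\<lambda>x. t + rnd n (w x - t))) < e"
proof -
  have t: "(\<lambda>_. t) \<in> L2 M" by (rule L2_bounded[of _ "\<bar>t\<bar>"]) auto
  define w0 where "w0 = w - (\<lambda>_. t)"
  have w0: "w0 \<in> L2 M" using w t unfolding w0_def by (rule L2.diff_mem)
  let ?K = "\<Sum>g | F g \<noteq> 0. \<bar>F g\<bar>" and ?s = "L2.nrm M (conv G act F \<eta> - w)"
  let ?u = "\<lambda>n. ?K * L2.nrm M (\<eta> - (\<lambda>x. rnd n (\<eta> x))) + (?s + L2.nrm M (w0 - (\<lambda>x. rnd n (w0 x))))"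
  have "?u \<longlonglongrightarrow> ?K * 0 + (?s + 0)"
    by (intro tendsto_intros rnd_L2_tendsto w0 \<eta>)
  then have "\<forall>\<^sub>F n in sequentially. ?u n < e" using lt by (intro order_tendstoD(2)) auto
  then show ?thesis
  proof eventually_elim
    case (elim n)
    let ?\<eta> = "\<lambda>x. rnd n (\<eta> x)" and ?w = "\<lambda>x. rnd n (w0 x)"
    have \<eta>n: "\<eta> - ?\<eta> \<in> L2 M" and wn: "w0 - ?w \<in> L2 M"
      using \<eta> w0 rnd_L2(1)[OF \<eta>] rnd_L2(1)[OF w0] by (auto intro: L2.diff_mem)
    have m1: "conv G act F \<eta> - w \<in> L2 M" by (rule L2.diff_mem[OF conv_L2[OF F \<eta>] w])
    have eq: "conv G act F ?\<eta> - (\<lambda>x. t + rnd n (w x - t)) =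
        ((conv G act F \<eta> - w) + (w0 - ?w)) - conv G act F (\<eta> - ?\<eta>)"
      by (rule ext) (simp add: conv_diff_right w0_def)
    have "L2.nrm M (conv G act F ?\<eta> - (\<lambda>x. t + rnd n (w x - t))) \<le> L2.nrm M ((conv G act F \<eta> - w) + (w0 - ?w)) + L2.nrm M (conv G act F (\<eta> - ?\<eta>))"
      unfolding eq by (rule L2.nrm_triangle_diff[OF L2.add_mem[OF m1 wn] conv_L2[OF F \<eta>n]])
    also have "\<dots> \<le> (?s + L2.nrm M (w0 - ?w)) + ?K * L2.nrm M (\<eta> - ?\<eta>)"
      by (rule add_mono[OF L2.nrm_triangle[OF m1 wn] conv_nrm_le[OF F \<eta>n]])
    also have "\<dots> < e" using elim by (simp add: add_ac)
    finally show ?case .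
  qed
qed

end

section \<open>Microstates of rounded functions and of their level sets\<close>

lemma finite_range_observable:
  fixes f :: "'a \<Rightarrow> 'c"
  assumes fin: "finite (f ` space M)" and sets: "\<And>r. r \<in> f ` space M \<Longrightarrow> f -` {r} \<inter> space M \<in> sets M"
  defines "R \<equiv> f ` space M"
  shows "finite_observable M (to_nat_on R ` R) (\<lambda>x. to_nat_on R (f x))"
proof -
  have R: "finite R" "countable R" using fin by (auto simp: R_def countable_finite)
  have "(\<lambda>x. to_nat_on R (f x)) -` {a} \<inter> space M \<in> sets M" if a: "a \<in> to_nat_on R ` R" for a
  proof -
    obtain r where r: "r \<in> R" "a = to_nat_on R r" using a by blast
    have "(\<lambda>x. to_nat_on R (f x)) -` {a} \<inter> space M = f -` {r} \<inter> space M"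
      using r R(2) by (auto simp: R_def)
    then show ?thesis using sets r by (simp add: R_def)
  qed
  then show ?thesis
    unfolding finite_observable_def using R
    by (subst measurable_count_space_eq2) (auto simp: R_def)
qed

context sofic_system
begin

lemma AP_shift_card:
  assumes "\<phi> \<in> AP G M act B \<beta> E \<delta> n s" "g \<in> E" "n > 0"
  shows "real (card {j \<in> {1..n}. \<phi> j g \<noteq> \<phi> (inv_into {1..n} (s g) j) \<one>}) \<le> \<delta> * n"
proof -
  have "unif n {j. \<phi> j g \<noteq> \<phi> (inv_into {1..n} (s g) j) \<one>} < \<delta>"
    using assms(1,2) by (simp add: AP_def)
  then have "real (card ({1..n} \<inter> {j. \<phi> j g \<noteq> \<phi> (inv_into {1..n} (s g) j) \<one>})) < \<delta> * n"
    unfolding unif_eq_card[OF assms(3)] using assms(3) by (simp add: pos_divide_less_eq)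
  then show ?thesis unfolding Int_def by simp
qed

text \<open>At a point \<open>j\<close> where all shifts in \<open>E\<close> are respected, the
  matrix applied to the labels is a function of the single pattern \<open>\<phi> j\<close>, and its
  average is given by the integral. The other points have density at most
  \<open>\<delta> * card E\<close> and cost at most \<open>K\<close> each.\<close>

lemma AP_near:
  fixes W H :: "nat \<Rightarrow> real"
  assumes v: "valid B \<beta> E \<delta>" and F: "F \<in> fin_supp G" "{g. F g \<noteq> 0} \<subseteq> E"
    and \<phi>: "\<phi> \<in> AP G M act B \<beta> E \<delta> (d i) (\<sigma> i)"
    and K: "\<And>b m. b \<in> E \<rightarrow>\<^sub>E B \<Longrightarrow> m \<in> B \<Longrightarrow> ((\<Sum>g | F g \<noteq> 0. F g * H (b g)) - W m)\<^sup>2 \<le> K"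
  shows "(\<Sum>j\<in>{1..d i}. ((\<Sum>k\<in>{1..d i}. perm_matrix i F j k * H (\<phi> k \<one>)) - W (\<phi> j \<one>))\<^sup>2) \<le>
    ((L2.nrm M (conv G act F (\<lambda>x. H (\<beta> x)) - (\<lambda>x. W (\<beta> x))))\<^sup>2 + K * \<delta> * (1 + card E)) * d i"
proof -
  let ?X = "{1..d i}" and ?\<tau> = "\<lambda>g. inv_into {1..d i} (\<sigma> i g)"
  have E: "finite E" "E \<subseteq> carrier G" "\<one> \<in> E" and obs: "finite_observable M B \<beta>"
    using v by (auto simp: valid_def)
  define N where "N = L2.nrm M (conv G act F (\<lambda>x. H (\<beta> x)) - (\<lambda>x. W (\<beta> x)))"
  define Q where "Q b = ((\<Sum>g | F g \<noteq> 0. F g * H (b g)) - W (b \<one>))\<^sup>2" for b :: "'g \<Rightarrow> nat"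
  define Z where "Z = (\<Union>g\<in>E. {j \<in> ?X. \<phi> j g \<noteq> \<phi> (?\<tau> g j) \<one>})"
  have mem: "\<phi> j \<in> E \<rightarrow>\<^sub>E B" if "j \<in> ?X" for j using \<phi> that by (auto simp: AP_def PiE_def)
  have \<tau>: "?\<tau> g j \<in> ?X" if "g \<in> E" "j \<in> ?X" for g j
    using that E permutes_image[OF \<sigma>_permutes, of g i] by (metis inv_into_into subsetD)
  have B1: "\<phi> j \<one> \<in> B" if "j \<in> ?X" for j using mem[OF that] E by auto
  have "?X \<noteq> {}" by (simp add: Suc_le_eq)
  then obtain j0 where "j0 \<in> ?X" by blast
  then have "0 \<le> K" using K[OF mem B1, of j0 j0] zero_le_power2 order_trans by blast
  have summand: "((\<Sum>k\<in>?X. perm_matrix i F j k * H (\<phi> k \<one>)) - W (\<phi> j \<one>))\<^sup>2 \<le> Q (\<phi> j) + K * indicator Z j"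
    if j: "j \<in> ?X" for j
  proof (cases "j \<in> Z")
    case False
    then have "\<phi> j g = \<phi> (?\<tau> g j) \<one>" if "g \<in> E" for g using that j by (auto simp: Z_def)
    then have "(\<Sum>g | F g \<noteq> 0. F g * H (\<phi> (?\<tau> g j) \<one>)) = (\<Sum>g | F g \<noteq> 0. F g * H (\<phi> j g))"
      using F(2) by (intro sum.cong refl) auto
    then show ?thesis
      using False unfolding perm_matrix_apply[OF F(1) j] Q_def by simp
  next
    case True
    \<comment> \<open>At a bad point the labels met by the matrix are not the pattern of any single
      point, but they still form an element of \<open>E \<rightarrow>\<^sub>E B\<close>; this is why
      \<open>K\<close> has to bound all combinations of \<open>b\<close> and
      \<open>m\<close>.\<close>
    define b where "b = (\<lambda>g\<in>E. \<phi> (?\<tau> g j) \<one>)"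
    have b: "b \<in> E \<rightarrow>\<^sub>E B" using \<tau> j B1 by (auto simp: b_def)
    have "(\<Sum>g | F g \<noteq> 0. F g * H (\<phi> (?\<tau> g j) \<one>)) = (\<Sum>g | F g \<noteq> 0. F g * H (b g))"
      using F(2) by (intro sum.cong refl) (auto simp: b_def)
    then have "((\<Sum>k\<in>?X. perm_matrix i F j k * H (\<phi> k \<one>)) - W (\<phi> j \<one>))\<^sup>2 \<le> K"
      unfolding perm_matrix_apply[OF F(1) j] using K[OF b B1[OF j]] by simp
    also have "\<dots> \<le> Q (\<phi> j) + K * indicator Z j" using True by (simp add: Q_def)
    finally show ?thesis .
  qed
  have Zsub: "Z \<subseteq> ?X" by (auto simp: Z_def)
  have "card Z \<le> (\<Sum>g\<in>E. card {j \<in> ?X. \<phi> j g \<noteq> \<phi> (?\<tau> g j) \<one>})"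
    unfolding Z_def using E(1) by (rule card_UN_le)
  then have "real (card Z) \<le> (\<Sum>g\<in>E. real (card {j \<in> ?X. \<phi> j g \<noteq> \<phi> (?\<tau> g j) \<one>}))"
    using of_nat_mono[where 'a = real] unfolding of_nat_sum[symmetric] by blast
  also have "\<dots> \<le> (\<Sum>g\<in>E. \<delta> * d i)" by (intro sum_mono AP_shift_card[OF \<phi>]) auto
  finally have Zcard: "real (card Z) \<le> card E * (\<delta> * d i)" by simp
  have "(\<Sum>j\<in>?X. ((\<Sum>k\<in>?X. perm_matrix i F j k * H (\<phi> k \<one>)) - W (\<phi> j \<one>))\<^sup>2) \<le>
      (\<Sum>j\<in>?X. Q (\<phi> j) + K * indicator Z j)"
    by (rule sum_mono[OF summand])
  also have "\<dots> = (\<Sum>j\<in>?X. Q (\<phi> j)) + K * card Z"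
    using Zsub by (simp add: sum.distrib sum_distrib_left[symmetric] indicator_def sum.If_cases Int_absorb1)
  also have "(\<Sum>j\<in>?X. Q (\<phi> j)) \<le> ((\<integral>x. Q (itinerary G act \<beta> E x) \<partial>M) + K * \<delta>) * d i"
  proof (rule AP_expectation[OF obs E(1,2) \<phi>])
    fix b assume b: "b \<in> E \<rightarrow>\<^sub>E B"
    then have "b \<one> \<in> B" using E(3) by auto
    then show "\<bar>Q b\<bar> \<le> K" using K[OF b] by (simp add: Q_def)
  qed (use \<open>0 \<le> K\<close> in auto)
  also have "(\<integral>x. Q (itinerary G act \<beta> E x) \<partial>M) = N\<^sup>2"
    unfolding N_def L2_nrm_power2
  proof (intro Bochner_Integration.integral_cong refl)
    fix x assume x: "x \<in> space M"
    have "(\<Sum>g | F g \<noteq> 0. F g * H (itinerary G act \<beta> E x g)) = conv G act F (\<lambda>x. H (\<beta> x)) x"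
      unfolding conv_def sum_fun_apply using F(2)
      by (intro sum.cong refl) (auto simp: itinerary_def koop_def)
    moreover have "itinerary G act \<beta> E x \<one> = \<beta> x" using E(3) x by (simp add: itinerary_def)
    ultimately show "Q (itinerary G act \<beta> E x) = ((conv G act F (\<lambda>x. H (\<beta> x)) - (\<lambda>x. W (\<beta> x))) x)\<^sup>2"
      by (simp add: Q_def)
  qed
  also have "K * card Z \<le> K * (card E * (\<delta> * d i))" using Zcard \<open>0 \<le> K\<close> by (rule mult_left_mono)
  finally show ?thesis unfolding N_def[symmetric] by (simp add: algebra_simps)
qed

lemma AP_norm:
  fixes H :: "nat \<Rightarrow> real"
  assumes v: "valid B \<beta> E \<delta>" and \<phi>: "\<phi> \<in> AP G M act B \<beta> E \<delta> (d i) (\<sigma> i)"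
    and K: "\<And>m. m \<in> B \<Longrightarrow> (H m)\<^sup>2 \<le> K" "K \<ge> 0"
  shows "(\<Sum>j\<in>{1..d i}. (H (\<phi> j \<one>))\<^sup>2) \<le> ((L2.nrm M (\<lambda>x. H (\<beta> x)))\<^sup>2 + K * \<delta>) * d i"
proof -
  have E: "finite E" "E \<subseteq> carrier G" "\<one> \<in> E" and obs: "finite_observable M B \<beta>"
    using v by (auto simp: valid_def)
  have "(\<Sum>j\<in>{1..d i}. (H (\<phi> j \<one>))\<^sup>2) \<le> ((\<integral>x. (H (itinerary G act \<beta> E x \<one>))\<^sup>2 \<partial>M) + K * \<delta>) * d i"
  proof (rule AP_expectation[OF obs E(1,2) \<phi>])
    fix b assume "b \<in> E \<rightarrow>\<^sub>E B"
    then have "b \<one> \<in> B" using E(3) by auto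
    then show "\<bar>(H (b \<one>))\<^sup>2\<bar> \<le> K" using K by simp
  qed (use K in auto)
  also have "(\<integral>x. (H (itinerary G act \<beta> E x \<one>))\<^sup>2 \<partial>M) = (L2.nrm M (\<lambda>x. H (\<beta> x)))\<^sup>2"
    unfolding L2_nrm_power2 using E(3)
    by (intro Bochner_Integration.integral_cong refl) (simp add: itinerary_def)
  finally show ?thesis .
qed

text \<open>
  The patterns of the level set shatter only small sets, so by the Sauer--Shelah lemma there are few
  of them.
\<close>

lemma level_zero_set:
  assumes w: "w \<in> L2 M" and \<eta>: "\<eta> \<in> L2 M"
    and approx: "\<And>e. e > 0 \<Longrightarrow> \<exists>F\<in>fin_supp G. FS.nrm F < e \<and> L2.nrm M (conv G act F \<eta> - w) < e"
    and t: "measure M {x \<in> space M. w x = t} = 0"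
  shows "zero_set {x \<in> space M. w x > t}"
  unfolding zero_set_def
proof (intro conjI allI impI)
  have [measurable]: "w \<in> borel_measurable M" "\<eta> \<in> borel_measurable M" using w \<eta> by auto
  show "{x \<in> space M. w x > t} \<in> sets M" by measurable
  fix c :: real assume "c > 0"
  \<comment> \<open>The constants are chosen in the order \<open>a\<close>, \<open>\<kappa>\<close>,
    \<open>\<epsilon>\<close>, \<open>F\<close>, \<open>n\<close>, \<open>K\<close>,
    \<open>\<delta>\<close>. Shattered sets will turn out to have density at most
    \<open>a\<close>.\<close>
  obtain a where a: "a > 0" "a \<le> c"
      "\<And>X :: nat set. finite X \<Longrightarrow> real (card {I. I \<subseteq> X \<and> real (card I) \<le> a * card X}) \<le> exp (c * card X)"
    using card_small_subsets_le[OF \<open>c > 0\<close>] by metis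
  \<comment> \<open>As the level \<open>t\<close> itself has measure zero, \<open>w\<close> comes
    close to \<open>t\<close> only on a small set. Away from it the signs of \<open>w - t\<close>
    have a definite size.\<close>
  obtain \<kappa> where \<kappa>: "\<kappa> > 0" "measure M {x \<in> space M. \<bar>w x - t\<bar> < \<kappa>} < a / 4"
  proof -
    let ?S = "\<lambda>n. {x \<in> space M. \<bar>w x - t\<bar> < 1 / Suc n}"
    have "(\<lambda>n. measure M (?S n)) \<longlonglongrightarrow> measure M (\<Inter>n. ?S n)"
    proof (rule finite_Lim_measure_decseq)
      have "1 / real (Suc n) \<le> 1 / real (Suc m)" if "m \<le> n" for m n using that by (simp add: frac_le)
      then show "decseq ?S" by (auto simp: decseq_def intro: less_le_trans)
    qed auto
    also have "(\<Inter>n. ?S n) = {x \<in> space M. w x = t}"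
    proof (intro equalityI subsetI)
      fix x assume x: "x \<in> (\<Inter>n. ?S n)"
      have "\<bar>w x - t\<bar> \<le> 0"
      proof (rule ccontr)
        assume "\<not> \<bar>w x - t\<bar> \<le> 0"
        then obtain n where "inverse (real (Suc n)) < \<bar>w x - t\<bar>"
          using reals_Archimedean[of "\<bar>w x - t\<bar>"] by auto
        moreover have "\<bar>w x - t\<bar> < 1 / Suc n" using x by blast
        ultimately show False by (simp add: inverse_eq_divide)
      qed
      then show "x \<in> {x \<in> space M. w x = t}" using x by auto
    qed auto
    finally have "(\<lambda>n. measure M (?S n)) \<longlonglongrightarrow> 0" using t by simp
    then have "\<forall>\<^sub>F n in sequentially. measure M (?S n) < a / 4" using a(1) by (intro order_tendstoD(2)) auto
    then obtain n where "measure M (?S n) < a / 4" by (auto simp: eventually_sequentially)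
    then show ?thesis by (intro that[of "1 / Suc n"]) auto
  qed
  \<comment> \<open>The summand 1 is room for the error \<open>K * \<delta>\<close> in the norms of
    the microstates.\<close>
  define C where "C = (L2.nrm M \<eta>)\<^sup>2 + 1"
  \<comment> \<open>Chosen so that \<open>sign_patterns_bound\<close>, applied with the gap
    \<open>\<kappa> / 2\<close> and the exceptional density \<open>a / 2\<close>, yields exactly
    density \<open>a\<close> for a shattered set.\<close>
  define \<epsilon> where "\<epsilon> = \<kappa> * a / (4 * (C / 2 + 5))"
  have "C > 0" by (simp add: C_def add_nonneg_pos)
  then have \<epsilon>: "\<epsilon> > 0" "\<epsilon> * (C / 2 + 5) = \<kappa> * a / 4" using \<kappa>(1) a(1) by (auto simp: \<epsilon>_def field_simps)
  obtain F where F: "F \<in> fin_supp G" "FS.nrm F < \<epsilon>" "L2.nrm M (conv G act F \<eta> - w) < \<epsilon>"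
    using approx[OF \<epsilon>(1)] by blast
  \<comment> \<open>Then neither the truncation at \<open>n\<close> nor the rounding error
    1/\<open>n\<close> can bring a value at distance at least \<open>\<kappa>\<close> from
    \<open>t\<close> closer than \<open>\<kappa> / 2\<close>.\<close>
  have "\<forall>\<^sub>F n in sequentially. real n > max (\<kappa> / 2) (2 / \<kappa>)"
    by (intro filterlim_at_top_dense[THEN iffD1, rule_format] filterlim_real_sequentially)
  from eventually_conj[OF simple_approximation[OF F(1) w \<eta> F(3), of t] this]
  obtain n where n: "L2.nrm M (conv G act F (\<lambda>x. rnd n (\<eta> x)) - (\<lambda>x. t + rnd n (w x - t))) < \<epsilon>"
      "real n > \<kappa> / 2" "real n > 2 / \<kappa>"
    by (auto simp: eventually_sequentially)
  have n0: "n > 0" "1 / n \<le> \<kappa> / 2"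
  proof -
    have "real n > 0" using n(2) \<kappa>(1) by linarith
    then show "n > 0" by simp
    then show "1 / n \<le> \<kappa> / 2" using n(3) \<kappa>(1) by (simp add: field_simps)
  qed
  \<comment> \<open>Rounding may turn values near \<open>t\<close> into \<open>t\<close> itself, so
    the bit \<open>w x > t\<close> is recorded separately.\<close>
  define f where "f x = (w x > t, t + rnd n (w x - t), rnd n (\<eta> x))" for x
  define R where "R = f ` space M"
  have finR: "finite R"
  proof (rule finite_subset)
    show "R \<subseteq> UNIV \<times> ((\<lambda>y. t + y) ` range (rnd n)) \<times> range (rnd n)" by (auto simp: R_def f_def)
  qed (simp add: finite_range_rnd)
  define B where "B = to_nat_on R ` R"
  define \<beta> where "\<beta> x = to_nat_on R (f x)" for x
  have obs: "finite_observable M B \<beta>"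
    unfolding B_def \<beta>_def R_def
  proof (rule finite_range_observable)
    fix r :: "bool \<times> real \<times> real"
    obtain p u v where r: "r = (p, u, v)" by (cases r)
    have "f -` {r} \<inter> space M = {x \<in> space M. (w x > t) = p \<and> t + rnd n (w x - t) = u \<and> rnd n (\<eta> x) = v}"
      by (auto simp: f_def r)
    also have "\<dots> \<in> sets M" by measurable
    finally show "f -` {r} \<inter> space M \<in> sets M" .
  qed (use finR in \<open>simp add: R_def\<close>)
  define W where "W m = fst (snd (from_nat_into R m))" for m
  define H where "H m = snd (snd (from_nat_into R m))" for m
  define P where "P = {m. fst (from_nat_into R m)}"
  have dec: "from_nat_into R (\<beta> x) = f x" if "x \<in> space M" for x
    unfolding \<beta>_def using that finR by (intro from_nat_into_to_nat_on) (auto simp: R_def countable_finite)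
  have W\<beta>: "W (\<beta> x) = t + rnd n (w x - t)" and H\<beta>: "H (\<beta> x) = rnd n (\<eta> x)"
    and P\<beta>: "\<beta> x \<in> P \<longleftrightarrow> w x > t" if "x \<in> space M" for x
    using dec[OF that] by (auto simp: W_def H_def P_def f_def)
  have Bx: "\<exists>x\<in>space M. m = \<beta> x" if "m \<in> B" for m using that by (auto simp: B_def \<beta>_def R_def)
  have dist_t: "(if \<beta> x \<in> P then 1 else -1) * (W (\<beta> x) - t) = \<bar>rnd n (w x - t)\<bar>" if "x \<in> space M" for x
    using W\<beta>[OF that] P\<beta>[OF that] rnd_eq[of n "w x - t"] by (auto simp: sgn_if split: if_splits)
  have labels: "0 \<le> (if m \<in> P then 1 else -1) * (W m - t)" if "m \<in> B" for m
    using Bx[OF that] dist_t abs_ge_zero by metis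
  define E where "E = insert \<one> {g. F g \<noteq> 0}"
  have E: "finite E" "E \<subseteq> carrier G" "\<one> \<in> E" "{g. F g \<noteq> 0} \<subseteq> E"
    using F(1) by (auto simp: E_def fin_supp_def)
  define q where "q b m = ((\<Sum>g | F g \<noteq> 0. F g * H (b g)) - W m)\<^sup>2" for b :: "'g \<Rightarrow> nat" and m
  have finB: "finite B" using finR by (simp add: B_def)
  \<comment> \<open>All values to be bounded form a finite set, since there are finitely many
    labels; \<open>K\<close> exceeds them all. The tolerance \<open>\<delta>\<close> is chosen only
    after \<open>K\<close>.\<close>
  define \<Q> where "\<Q> = (\<lambda>(b, m). q b m) ` ((E \<rightarrow>\<^sub>E B) \<times> B) \<union> (\<lambda>m. (H m)\<^sup>2) ` B"
  have fin\<Q>: "finite \<Q>" unfolding \<Q>_def using finB E(1) by (intro finite_UnI finite_imageI finite_cartesian_product finite_PiE)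
  define K where "K = (\<Sum>z\<in>\<Q>. \<bar>z\<bar>)"
  have K0: "K \<ge> 0" by (simp add: K_def sum_nonneg)
  have leK: "z \<le> K" if "z \<in> \<Q>" for z
    using member_le_sum[OF that, of abs] fin\<Q> abs_ge_self[of z] by (simp add: K_def)
  have Kq: "((\<Sum>g | F g \<noteq> 0. F g * H (b g)) - W m)\<^sup>2 \<le> K" if "b \<in> E \<rightarrow>\<^sub>E B" "m \<in> B" for b m
    using that by (intro leK) (auto simp: \<Q>_def q_def)
  have KH: "(H m)\<^sup>2 \<le> K" if "m \<in> B" for m using that by (intro leK) (auto simp: \<Q>_def)
  define \<delta> where "\<delta> = min (a / 4) (min (\<epsilon>\<^sup>2) 1 / ((K + 1) * (1 + card E)))"
  have \<delta>: "\<delta> > 0" "\<delta> \<le> a / 4"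
    using a(1) \<epsilon>(1) K0 unfolding \<delta>_def by (simp_all only: min.cobounded1) simp
  have \<delta>K: "K * \<delta> * (1 + card E) \<le> min (\<epsilon>\<^sup>2) 1"
  proof -
    have "K * \<delta> * (1 + card E) \<le> (K + 1) * \<delta> * (1 + card E)" using \<delta>(1) by (intro mult_right_mono) auto
    also have "\<dots> = \<delta> * ((K + 1) * (1 + card E))" by simp
    also have "\<dots> \<le> min (\<epsilon>\<^sup>2) 1 / ((K + 1) * (1 + card E)) * ((K + 1) * (1 + card E))"
      using K0 by (intro mult_right_mono) (auto simp: \<delta>_def)
    also have "\<dots> = min (\<epsilon>\<^sup>2) 1" using K0 by simp
    finally show ?thesis .
  qed
  have v: "valid B \<beta> E \<delta>" using obs E \<delta> by (simp add: valid_def)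
  have nrm_eq: "L2.nrm M (conv G act F (\<lambda>x. H (\<beta> x)) - (\<lambda>x. W (\<beta> x))) < \<epsilon>"
  proof -
    have "L2.nrm M (conv G act F (\<lambda>x. H (\<beta> x)) - (\<lambda>x. W (\<beta> x))) =
        L2.nrm M (conv G act F (\<lambda>x. rnd n (\<eta> x)) - (\<lambda>x. t + rnd n (w x - t)))"
    proof (rule L2_nrm_cong)
      fix x assume x: "x \<in> space M"
      have "conv G act F (\<lambda>x. H (\<beta> x)) x = conv G act F (\<lambda>x. rnd n (\<eta> x)) x"
        unfolding conv_def sum_fun_apply using F(1) x
        by (intro sum.cong refl) (auto simp: koop_def fin_supp_def subset_eq H\<beta>)
      then show "(conv G act F (\<lambda>x. H (\<beta> x)) - (\<lambda>x. W (\<beta> x))) x =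
          (conv G act F (\<lambda>x. rnd n (\<eta> x)) - (\<lambda>x. t + rnd n (w x - t))) x"
        by (simp add: W\<beta>[OF x])
    qed
    then show ?thesis using n(1) by simp
  qed
  have bad: "measure M {x \<in> space M. \<beta> x \<in> {m. (if m \<in> P then 1 else -1) * (W m - t) < \<kappa> / 2}} < a / 4"
  proof (rule le_less_trans[OF finite_measure_mono \<kappa>(2)])
    show "{x \<in> space M. \<beta> x \<in> {m. (if m \<in> P then 1 else -1) * (W m - t) < \<kappa> / 2}} \<subseteq> {x \<in> space M. \<bar>w x - t\<bar> < \<kappa>}"
    proof (intro subsetI CollectI conjI)
      fix x assume x: "x \<in> {x \<in> space M. \<beta> x \<in> {m. (if m \<in> P then 1 else -1) * (W m - t) < \<kappa> / 2}}"
      then show "x \<in> space M" by blast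
      then have "\<bar>rnd n (w x - t)\<bar> < \<kappa> / 2" using x dist_t[of x] by simp
      then have "min (real n) (\<bar>w x - t\<bar> - 1 / n) < \<kappa> / 2" using abs_rnd_ge[OF n0(1), of "w x - t"] by linarith
      then show "\<bar>w x - t\<bar> < \<kappa>" using n(2) n0(2) by (simp only: min_less_iff_disj) linarith
    qed
  qed measurable
  have "few c B \<beta> E \<delta> P"
    unfolding few_def using perm_matrix_HS[OF F(1,2)]
  proof (rule eventually_mono)
    fix i
    let ?X = "{1..d i}" and ?AP = "AP G M act B \<beta> E \<delta> (d i) (\<sigma> i)"
    assume HS: "(\<Sum>j\<in>?X. \<Sum>k\<in>?X. (perm_matrix i F j k)\<^sup>2) \<le> 4 * \<epsilon>\<^sup>2 * card ?X"
    let ?S = "pat G (d i) P ` ?AP"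
    have cX: "card ?X = d i" by simp
    have small: "real (card I) \<le> a * card ?X" if I: "I \<subseteq> ?X" "shatters ?S I" for I
    proof -
      \<comment> \<open>Shattering provides for every \<open>J\<close> a microstate
        \<open>\<Phi> J\<close> whose labels lie above the level exactly at the points of
        \<open>J\<close>, as far as \<open>I\<close> is concerned. So all sign patterns on
        \<open>I\<close> occur.\<close>
      have "\<forall>J. J \<subseteq> I \<longrightarrow> (\<exists>\<phi>\<in>?AP. pat G (d i) P \<phi> \<inter> I = J)"
        using I(2) unfolding shatters_def by blast
      then obtain \<Phi> where \<Phi>: "\<And>J. J \<subseteq> I \<Longrightarrow> \<Phi> J \<in> ?AP" "\<And>J. J \<subseteq> I \<Longrightarrow> pat G (d i) P (\<Phi> J) \<inter> I = J"
        by metis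
      have lab: "\<Phi> J j \<one> \<in> B" if "J \<subseteq> I" "j \<in> ?X" for J j
        using \<Phi>(1)[OF that(1)] that(2) E(3) by (auto simp: AP_def PiE_def Pi_def)
      have sg: "sgn_of J j = (if \<Phi> J j \<one> \<in> P then 1 else -1)" if J: "J \<subseteq> I" and j: "j \<in> I" for J j
      proof -
        have "j \<in> J \<longleftrightarrow> j \<in> pat G (d i) P (\<Phi> J)" using \<Phi>(2)[OF J] j by blast
        also have "\<dots> \<longleftrightarrow> \<Phi> J j \<one> \<in> P" using I(1) j by (auto simp: pat_def)
        finally show ?thesis by (simp add: sgn_of_def)
      qed
      have "\<kappa> / 2 * (card I - a / 2 * card ?X) \<le> \<epsilon> * (C / 2 + 5) * card ?X"
      proof (rule sign_patterns_bound[where T = "perm_matrix i F" and x = "\<lambda>J j. W (\<Phi> J j \<one>)"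
              and y = "\<lambda>J j. H (\<Phi> J j \<one>)" and t = t])
        fix J assume J: "J \<subseteq> I"
        let ?N = "(L2.nrm M (conv G act F (\<lambda>x. H (\<beta> x)) - (\<lambda>x. W (\<beta> x))))\<^sup>2"
        have "(\<Sum>j\<in>?X. ((\<Sum>k\<in>?X. perm_matrix i F j k * H (\<Phi> J k \<one>)) - W (\<Phi> J j \<one>))\<^sup>2) \<le>
            (?N + K * \<delta> * (1 + card E)) * d i"
          by (rule AP_near[OF v F(1) E(4) \<Phi>(1)[OF J] Kq])
        also have "\<dots> \<le> 4 * \<epsilon>\<^sup>2 * d i"
        proof (rule mult_right_mono)
          have "0 \<le> L2.nrm M (conv G act F (\<lambda>x. H (\<beta> x)) - (\<lambda>x. W (\<beta> x)))"
            by (simp add: L2.nrm_def l2ip_def)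
          then have "?N \<le> \<epsilon>\<^sup>2" using nrm_eq by (intro power_mono) auto
          then show "?N + K * \<delta> * (1 + card E) \<le> 4 * \<epsilon>\<^sup>2"
            using \<delta>K zero_le_power2[of \<epsilon>] by linarith
        qed simp
        finally show "(\<Sum>j\<in>?X. ((\<Sum>k\<in>?X. perm_matrix i F j k * H (\<Phi> J k \<one>)) - W (\<Phi> J j \<one>))\<^sup>2) \<le> 4 * \<epsilon>\<^sup>2 * card ?X"
          unfolding cX .
        have "L2.nrm M (\<lambda>x. H (\<beta> x)) = L2.nrm M (\<lambda>x. rnd n (\<eta> x))" by (rule L2_nrm_cong) (rule H\<beta>)
        then have "L2.nrm M (\<lambda>x. H (\<beta> x)) \<le> L2.nrm M \<eta>" using rnd_L2(2)[OF \<eta>] by simp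
        moreover have "0 \<le> L2.nrm M (\<lambda>x. H (\<beta> x))" by (simp add: L2.nrm_def l2ip_def)
        ultimately have "(L2.nrm M (\<lambda>x. H (\<beta> x)))\<^sup>2 \<le> (L2.nrm M \<eta>)\<^sup>2" by (intro power_mono)
        moreover have "K * \<delta> \<le> 1"
        proof -
          have "K * \<delta> * 1 \<le> K * \<delta> * (1 + card E)" using K0 \<delta>(1) by (intro mult_left_mono) auto
          then show ?thesis using \<delta>K by linarith
        qed
        ultimately have le: "(L2.nrm M (\<lambda>x. H (\<beta> x)))\<^sup>2 + K * \<delta> \<le> C" by (simp add: C_def)
        have "(\<Sum>j\<in>?X. (H (\<Phi> J j \<one>))\<^sup>2) \<le> ((L2.nrm M (\<lambda>x. H (\<beta> x)))\<^sup>2 + K * \<delta>) * d i"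
          by (rule AP_norm[OF v \<Phi>(1)[OF J] KH K0])
        also have "\<dots> \<le> C * d i" using le by (rule mult_right_mono) simp
        finally show "(\<Sum>k\<in>?X. (H (\<Phi> J k \<one>))\<^sup>2) \<le> C * card ?X" unfolding cX .
        show "0 \<le> sgn_of J j * (W (\<Phi> J j \<one>) - t)" if "j \<in> I" for j
          unfolding sg[OF J that] using labels lab[OF J] that I(1) by blast
        have "{j \<in> I. sgn_of J j * (W (\<Phi> J j \<one>) - t) < \<kappa> / 2} \<subseteq>
            pat G (d i) {m. (if m \<in> P then 1 else -1) * (W m - t) < \<kappa> / 2} (\<Phi> J)"
          using I(1) sg[OF J] by (auto simp: pat_def)
        then have "card {j \<in> I. sgn_of J j * (W (\<Phi> J j \<one>) - t) < \<kappa> / 2} \<le>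
            card (pat G (d i) {m. (if m \<in> P then 1 else -1) * (W m - t) < \<kappa> / 2} (\<Phi> J))"
          by (intro card_mono finite_pat)
        then have "real (card {j \<in> I. sgn_of J j * (W (\<Phi> J j \<one>) - t) < \<kappa> / 2}) \<le>
            real (card (pat G (d i) {m. (if m \<in> P then 1 else -1) * (W m - t) < \<kappa> / 2} (\<Phi> J)))"
          by (rule of_nat_mono)
        also have "\<dots> \<le> (measure M {x \<in> space M. \<beta> x \<in> {m. (if m \<in> P then 1 else -1) * (W m - t) < \<kappa> / 2}} + \<delta>) * d i"
          by (rule card_pat_le[OF v \<Phi>(1)[OF J]]) simp
        also have "\<dots> \<le> a / 2 * d i" using bad \<delta>(2) by (intro mult_right_mono) auto
        finally show "card {j \<in> I. sgn_of J j * (W (\<Phi> J j \<one>) - t) < \<kappa> / 2} \<le> a / 2 * card ?X" unfolding cX .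
      qed (use I HS \<epsilon>(1) \<kappa>(1) in auto)
      then have "\<kappa> / 2 * (card I - a / 2 * d i) \<le> \<kappa> / 2 * (a / 2 * d i)" unfolding \<epsilon>(2) cX by simp
      then have "card I - a / 2 * d i \<le> a / 2 * d i" using \<kappa>(1) by (simp only: mult_le_cancel_left_pos half_gt_zero)
      then show ?thesis unfolding cX by linarith
    qed
    have sub: "?S \<subseteq> Pow ?X" by (auto simp: pat_def)
    have "card ?S \<le> card {I. I \<subseteq> ?X \<and> shatters ?S I}" using sub by (intro card_le_card_shattered) auto
    also have "\<dots> \<le> card {I. I \<subseteq> ?X \<and> real (card I) \<le> a * card ?X}"
      using small by (intro card_mono) auto
    finally have "real (card ?S) \<le> real (card {I. I \<subseteq> ?X \<and> real (card I) \<le> a * card ?X})" by (rule of_nat_mono)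
    also have "\<dots> \<le> exp (c * card ?X)" by (rule a(3)) simp
    finally have cS: "real (card ?S) \<le> exp (c * d i)" unfolding cX .
    \<comment> \<open>The patterns themselves form the family, so the Hamming distance is zero
      here.\<close>
    have close: "\<exists>S\<in>?S. real (card (sym_diff S (pat G (d i) P \<phi>))) \<le> c * d i" if "\<phi> \<in> ?AP" for \<phi>
      using that \<open>c > 0\<close> by (intro bexI[of _ "pat G (d i) P \<phi>"]) auto
    show "\<exists>\<S>. \<S> \<subseteq> Pow ?X \<and> real (card \<S>) \<le> exp (c * d i) \<and>
        (\<forall>\<phi>\<in>?AP. \<exists>S\<in>\<S>. real (card (sym_diff S (pat G (d i) P \<phi>))) \<le> c * d i)"
      by (intro exI[of _ ?S] conjI ballI sub cS close)
  qed
  then show "\<exists>B \<beta> F \<delta> P. valid B \<beta> F \<delta> \<and> (\<forall>x\<in>space M. \<beta> x \<in> P \<longleftrightarrow> x \<in> {x \<in> space M. w x > t}) \<and> few c B \<beta> F \<delta> P"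
    using v P\<beta> by (intro exI[of _ B] exI[of _ \<beta>] exI[of _ E] exI[of _ \<delta>] exI[of _ P] conjI ballI) auto
qed

end

section \<open>Limits of group ring translates and factors\<close>

context pmp_system
begin

text \<open>Pairing with the fixed vector \<open>v\<close> is linear and continuous: the bound
  \<open>c\<close> is therefore preserved by convex combinations and survives the limit, where it
  keeps \<open>\<zeta>\<close> from vanishing. The bound \<open>b\<close> prevents the minimal norms
  from tending to infinity.\<close>

lemma limit_vector:
  assumes \<xi>: "\<xi> \<in> L2 M" "(\<integral>x. \<xi> x \<partial>M) = 0" and v: "v \<in> L2 M" and "c > 0"
    and F: "\<And>e. e > 0 \<Longrightarrow> \<exists>F\<in>fin_supp G. FS.nrm F \<le> e \<and> L2.nrm M (conv G act F \<xi>) \<le> b \<and> c \<le> l2ip M (conv G act F \<xi>) v"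
  obtains \<zeta> where "\<zeta> \<in> L2 M" "(\<integral>x. \<zeta> x \<partial>M) = 0" "c \<le> l2ip M \<zeta> v"
    "\<And>e. e > 0 \<Longrightarrow> \<exists>F\<in>fin_supp G. FS.nrm F < e \<and> L2.nrm M (conv G act F \<xi> - \<zeta>) < e"
proof -
  define D where "D k = {F \<in> fin_supp G. FS.nrm F \<le> 1 / Suc k \<and> c \<le> l2ip M (conv G act F \<xi>) v}" for k
  define C where "C k = (\<lambda>F. conv G act F \<xi>) ` D k" for k
  have CL: "C k \<subseteq> L2 M" for k using \<xi> by (auto simp: C_def D_def intro: conv_L2)
  obtain x where x: "\<And>k. x k \<in> C k"
    and Cauchy: "\<And>e. e > 0 \<Longrightarrow> \<exists>N. \<forall>m\<ge>N. \<forall>n\<ge>N. L2.nrm M (x m - x n) < e"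
  proof (rule L2.minimizing_Cauchy[of C M b])
    show "C k \<subseteq> L2 M" for k by (rule CL)
    show "convex (C k)" for k
    proof (rule convexI)
      fix f f' :: "'a \<Rightarrow> real" and s t :: real
      assume "f \<in> C k" "f' \<in> C k" and st: "0 \<le> s" "0 \<le> t" "s + t = 1"
      then obtain F F' where F: "F \<in> D k" "f = conv G act F \<xi>" and F': "F' \<in> D k" "f' = conv G act F' \<xi>"
        by (auto simp: C_def)
      have mem: "F \<in> fin_supp G" "F' \<in> fin_supp G" using F F' by (auto simp: D_def)
      then have sm: "s *\<^sub>R F \<in> fin_supp G" "t *\<^sub>R F' \<in> fin_supp G" by (auto intro: FS.scale_mem)
      have eq: "conv G act (s *\<^sub>R F + t *\<^sub>R F') \<xi> = s *\<^sub>R f + t *\<^sub>R f'"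
        unfolding conv_add_left[OF sm] conv_scale_left F F' ..
      have "s *\<^sub>R F + t *\<^sub>R F' \<in> D k"
        unfolding D_def
      proof (intro CollectI conjI)
        show "s *\<^sub>R F + t *\<^sub>R F' \<in> fin_supp G" by (rule FS.add_mem[OF sm])
        have "FS.nrm (s *\<^sub>R F + t *\<^sub>R F') \<le> FS.nrm (s *\<^sub>R F) + FS.nrm (t *\<^sub>R F')"
          by (rule FS.nrm_triangle[OF sm])
        also have "\<dots> = s * FS.nrm F + t * FS.nrm F'"
          unfolding FS.nrm_scale[OF mem(1)] FS.nrm_scale[OF mem(2)] using st by simp
        also have "\<dots> \<le> s * (1 / Suc k) + t * (1 / Suc k)"
          using F(1) F'(1) st unfolding D_def by (intro add_mono mult_left_mono) blast+
        also have "\<dots> = 1 / Suc k" unfolding distrib_right[symmetric] st(3) by simp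
        finally show "FS.nrm (s *\<^sub>R F + t *\<^sub>R F') \<le> 1 / Suc k" .
        have fm: "f \<in> L2 M" "f' \<in> L2 M" unfolding F F' using mem \<xi> by (auto intro: conv_L2)
        have "c = s * c + t * c" unfolding distrib_right[symmetric] st(3) by simp
        also have "\<dots> \<le> s * l2ip M f v + t * l2ip M f' v"
          using F F' st unfolding D_def by (intro add_mono mult_left_mono) blast+
        also have "\<dots> = l2ip M (s *\<^sub>R f + t *\<^sub>R f') v"
          unfolding L2.ip_add_left[OF L2.scale_mem[OF fm(1)] L2.scale_mem[OF fm(2)] v]
            L2.ip_scale_left[OF fm(1) v] L2.ip_scale_left[OF fm(2) v] ..
        finally show "c \<le> l2ip M (conv G act (s *\<^sub>R F + t *\<^sub>R F') \<xi>) v" unfolding eq .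
      qed
      then show "s *\<^sub>R f + t *\<^sub>R f' \<in> C k" unfolding C_def eq[symmetric] by blast
    qed
    have "D j \<subseteq> D i" if "i \<le> j" for i j
    proof -
      have "1 / real (Suc j) \<le> 1 / real (Suc i)" using that by (intro frac_le) auto
      then show ?thesis unfolding D_def by (blast intro: order_trans)
    qed
    then show "decseq C" unfolding decseq_def C_def by (blast intro: image_mono)
    show "\<exists>x\<in>C k. L2.nrm M x \<le> b" for k
      using F[of "1 / Suc k"] unfolding C_def D_def by auto
  qed (rule that)
  have xL: "x k \<in> L2 M" for k using x CL by blast
  obtain \<zeta> where \<zeta>: "\<zeta> \<in> L2 M" "(\<lambda>n. L2.nrm M (x n - \<zeta>)) \<longlonglongrightarrow> 0"
    by (rule L2_complete[OF xL Cauchy])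
  have dL: "x n - \<zeta> \<in> L2 M" for n by (rule L2.diff_mem[OF xL \<zeta>(1)])
  show ?thesis
  proof (rule that[OF \<zeta>(1)])
    have int_x: "(\<integral>t. x n t \<partial>M) = 0" for n
    proof -
      obtain F where F: "F \<in> fin_supp G" "x n = conv G act F \<xi>" using x[of n] by (auto simp: C_def D_def)
      show ?thesis unfolding F(2) integral_conv[OF F(1) \<xi>(1)] \<xi>(2) by simp
    qed
    have "norm (\<integral>t. \<zeta> t \<partial>M) \<le> L2.nrm M (x n - \<zeta>)" for n
    proof -
      have "(\<integral>t. (x n - \<zeta>) t \<partial>M) = (\<integral>t. x n t \<partial>M) - (\<integral>t. \<zeta> t \<partial>M)"
        using L2_integrable[OF xL[of n]] L2_integrable[OF \<zeta>(1)] by simp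
      then have "(\<integral>t. \<zeta> t \<partial>M) = - (\<integral>t. (x n - \<zeta>) t \<partial>M)" unfolding int_x by simp
      then have "norm (\<integral>t. \<zeta> t \<partial>M) = norm (\<integral>t. (x n - \<zeta>) t \<partial>M)" by simp
      also have "\<dots> \<le> (\<integral>t. norm ((x n - \<zeta>) t) \<partial>M)" by (rule integral_norm_bound)
      also have "\<dots> \<le> L2.nrm M (x n - \<zeta>)" using integral_abs_le_L2_nrm[OF dL[of n]] by simp
      finally show ?thesis .
    qed
    then have "norm (\<integral>t. \<zeta> t \<partial>M) \<le> 0" by (intro LIMSEQ_le_const[OF \<zeta>(2)]) auto
    then show "(\<integral>t. \<zeta> t \<partial>M) = 0" by simp
    have "c \<le> l2ip M \<zeta> v + L2.nrm M (x n - \<zeta>) * L2.nrm M v" for n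
    proof -
      have "c \<le> l2ip M (x n) v" using x[of n] by (auto simp: C_def D_def)
      also have "\<dots> = l2ip M \<zeta> v + l2ip M (x n - \<zeta>) v"
        unfolding L2.ip_diff_left[OF xL \<zeta>(1) v] by simp
      also have "l2ip M (x n - \<zeta>) v \<le> L2.nrm M (x n - \<zeta>) * L2.nrm M v"
        using L2.Cauchy_Schwarz[OF dL v, of n] by linarith
      finally show ?thesis by simp
    qed
    moreover have "(\<lambda>n. l2ip M \<zeta> v + L2.nrm M (x n - \<zeta>) * L2.nrm M v) \<longlonglongrightarrow> l2ip M \<zeta> v + 0 * L2.nrm M v"
      by (intro tendsto_intros \<zeta>(2))
    ultimately have "c \<le> l2ip M \<zeta> v + 0 * L2.nrm M v" by (intro LIMSEQ_le_const) auto
    then show "c \<le> l2ip M \<zeta> v" by simp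
    fix e :: real assume "e > 0"
    have "\<forall>\<^sub>F n in sequentially. L2.nrm M (x n - \<zeta>) < e" using \<zeta>(2) \<open>e > 0\<close> by (rule order_tendstoD)
    moreover have "\<forall>\<^sub>F n in sequentially. inverse (real (Suc n)) < e"
      using LIMSEQ_inverse_real_of_nat \<open>e > 0\<close> by (rule order_tendstoD)
    ultimately have "\<forall>\<^sub>F n in sequentially. L2.nrm M (x n - \<zeta>) < e \<and> inverse (real (Suc n)) < e"
      by (rule eventually_conj)
    then obtain n where n: "L2.nrm M (x n - \<zeta>) < e" "inverse (real (Suc n)) < e"
      by (auto simp: eventually_sequentially)
    obtain F where F: "F \<in> fin_supp G" "FS.nrm F \<le> 1 / Suc n" "x n = conv G act F \<xi>"
      using x[of n] by (auto simp: C_def D_def)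
    have "FS.nrm F < e" using F(2) n(2) by (simp add: inverse_eq_divide)
    then show "\<exists>F\<in>fin_supp G. FS.nrm F < e \<and> L2.nrm M (conv G act F \<xi> - \<zeta>) < e"
      using F(1,3) n(1) by (intro bexI[of _ F]) auto
  qed
qed

end

text \<open>Equivariance is required at every point of \<open>space M\<close>. The factor
  constructed below has it, and it makes the identities between the two Koopman representations hold
  pointwise.\<close>

locale pmp_factor = pmp_system G M act + N: pmp_system G N actN
  for G :: "('g, 'z) monoid_scheme" (structure) and M :: "'a measure" and act
    and N :: "'b measure" and actN +
  fixes \<pi> :: "'a \<Rightarrow> 'b"
  assumes \<pi>_measurable [measurable]: "\<pi> \<in> measurable M N"
    and distr_\<pi>: "distr M N \<pi> = N"
    and equivariant: "\<And>g x. g \<in> carrier G \<Longrightarrow> x \<in> space M \<Longrightarrow> \<pi> (act g x) = actN g (\<pi> x)"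
begin

lemma integral_factor:
  fixes f :: "'b \<Rightarrow> real"
  assumes "f \<in> borel_measurable N"
  shows "(\<integral>x. f (\<pi> x) \<partial>M) = (\<integral>y. f y \<partial>N)"
proof -
  have "(\<integral>y. f y \<partial>N) = (\<integral>y. f y \<partial>distr M N \<pi>)" by (simp add: distr_\<pi>)
  also have "\<dots> = (\<integral>x. f (\<pi> x) \<partial>M)" using assms by (intro integral_distr) auto
  finally show ?thesis by simp
qed

lemma integrable_factor_iff:
  fixes f :: "'b \<Rightarrow> real"
  assumes "f \<in> borel_measurable N"
  shows "integrable M (\<lambda>x. f (\<pi> x)) \<longleftrightarrow> integrable N f"
  using integrable_distr_eq[OF \<pi>_measurable assms] by (simp add: distr_\<pi>)

lemma L2_factor_iff: "f \<in> borel_measurable N \<Longrightarrow> (\<lambda>x. f (\<pi> x)) \<in> L2 M \<longleftrightarrow> f \<in> L2 N"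
  using integrable_factor_iff[of "\<lambda>y. (f y)\<^sup>2"] by (auto simp: L2_def)

lemma L2_factor: "f \<in> L2 N \<Longrightarrow> (\<lambda>x. f (\<pi> x)) \<in> L2 M"
  using L2_factor_iff[of f] by (auto simp: L2_def)

lemma nrm_factor: "f \<in> borel_measurable N \<Longrightarrow> L2.nrm M (\<lambda>x. f (\<pi> x)) = L2.nrm N f"
  using integral_factor[of "\<lambda>y. f y * f y"] by (simp add: L2.nrm_def l2ip_def)

lemma \<pi>_space: "x \<in> space M \<Longrightarrow> \<pi> x \<in> space N"
  by (rule measurable_space[OF \<pi>_measurable])

lemma koop_factor:
  "g \<in> carrier G \<Longrightarrow> x \<in> space M \<Longrightarrow> koop G actN g f (\<pi> x) = koop G act g (\<lambda>x. f (\<pi> x)) x"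
  by (simp add: koop_def equivariant)

lemma conv_factor:
  "F \<in> fin_supp G \<Longrightarrow> x \<in> space M \<Longrightarrow> conv G actN F f (\<pi> x) = conv G act F (\<lambda>x. f (\<pi> x)) x"
  unfolding conv_def sum_fun_apply by (intro sum.cong) (auto simp: fin_supp_def subset_eq koop_factor)

text \<open>In effect the conditional expectation onto the factor, found as a nearest point:
  minimizing vectors converge by completeness, and varying the minimizer in the direction
  \<open>\<theta>\<close> gives orthogonality.\<close>

lemma orthogonal_projection:
  assumes \<xi>: "\<xi> \<in> L2 M"
  obtains \<eta> where "\<eta> \<in> L2 N" "\<And>\<theta>. \<theta> \<in> L2 N \<Longrightarrow> l2ip M (\<xi> - (\<lambda>x. \<eta> (\<pi> x))) (\<lambda>x. \<theta> (\<pi> x)) = 0"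
proof -
  let ?p = "\<lambda>f x. f (\<pi> x)"
  \<comment> \<open>A constant sequence of affine sets, to which the argument for decreasing convex
    sets applies.\<close>
  define C where "C k = (\<lambda>\<eta>. \<xi> - ?p \<eta>) ` L2 N" for k :: nat
  have CL: "C k \<subseteq> L2 M" for k using L2_factor \<xi> by (auto simp: C_def intro!: L2.diff_mem)
  obtain x where x: "\<And>k. x k \<in> C k"
    and min: "\<And>k y. y \<in> C k \<Longrightarrow> (L2.nrm M (x k))\<^sup>2 \<le> (L2.nrm M y)\<^sup>2 + 1 / Suc k"
    and Cauchy: "\<And>e. e > 0 \<Longrightarrow> \<exists>N. \<forall>m\<ge>N. \<forall>n\<ge>N. L2.nrm M (x m - x n) < e"
  proof (rule L2.minimizing_Cauchy[of C M "L2.nrm M \<xi>"])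
    show "C k \<subseteq> L2 M" for k by (rule CL)
    show "convex (C k)" for k
    proof (rule convexI)
      fix f f' :: "'a \<Rightarrow> real" and s t :: real
      assume "f \<in> C k" "f' \<in> C k" and st: "0 \<le> s" "0 \<le> t" "s + t = 1"
      then obtain \<eta> \<eta>' where \<eta>: "\<eta> \<in> L2 N" "f = \<xi> - ?p \<eta>" and \<eta>': "\<eta>' \<in> L2 N" "f' = \<xi> - ?p \<eta>'"
        by (auto simp: C_def)
      have "s *\<^sub>R f + t *\<^sub>R f' = (s + t) *\<^sub>R \<xi> - ?p (s *\<^sub>R \<eta> + t *\<^sub>R \<eta>')"
        by (rule ext) (simp add: \<eta> \<eta>' algebra_simps)
      then have "s *\<^sub>R f + t *\<^sub>R f' = \<xi> - ?p (s *\<^sub>R \<eta> + t *\<^sub>R \<eta>')" unfolding st(3) by simp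
      moreover have "s *\<^sub>R \<eta> + t *\<^sub>R \<eta>' \<in> L2 N"
        by (intro L2.add_mem[OF L2.scale_mem[OF \<eta>(1)] L2.scale_mem[OF \<eta>'(1)]])
      ultimately show "s *\<^sub>R f + t *\<^sub>R f' \<in> C k" unfolding C_def by blast
    qed
    show "decseq C" by (simp add: decseq_def C_def)
    have "\<xi> - ?p (0 :: 'b \<Rightarrow> real) = \<xi>" by (rule ext) simp
    then have "\<xi> \<in> C k" for k using L2.zero_mem[of N] unfolding C_def by (metis image_eqI)
    then show "\<exists>x\<in>C k. L2.nrm M x \<le> L2.nrm M \<xi>" for k by blast
  qed (rule that)
  have "\<forall>k. \<exists>\<eta>. \<eta> \<in> L2 N \<and> x k = \<xi> - ?p \<eta>" using x unfolding C_def by blast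
  then obtain h where h: "\<And>k. h k \<in> L2 N" "\<And>k. x k = \<xi> - ?p (h k)" by metis
  have diff: "L2.nrm N (h m - h n) = L2.nrm M (x n - x m)" for m n
  proof -
    have "x n - x m = ?p (h m - h n)" by (rule ext) (simp add: h(2))
    then show ?thesis using nrm_factor[of "h m - h n"] L2.diff_mem[OF h(1)[of m] h(1)[of n]]
      by (simp add: L2_measurable)
  qed
  have Cauchy_h: "\<exists>K. \<forall>m\<ge>K. \<forall>n\<ge>K. L2.nrm N (h m - h n) < e" if "e > 0" for e
    using Cauchy[OF that] unfolding diff by blast
  obtain \<eta> where \<eta>: "\<eta> \<in> L2 N" "(\<lambda>n. L2.nrm N (h n - \<eta>)) \<longlonglongrightarrow> 0"
    by (rule N.L2_complete[OF h(1) Cauchy_h])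
  define r where "r = \<xi> - ?p \<eta>"
  have rL: "r \<in> L2 M" unfolding r_def by (rule L2.diff_mem[OF \<xi> L2_factor[OF \<eta>(1)]])
  have xL: "x k \<in> L2 M" for k using x CL by blast
  have rx: "L2.nrm M (r - x k) = L2.nrm N (h k - \<eta>)" for k
  proof -
    have "r - x k = ?p (h k - \<eta>)" by (rule ext) (simp add: h(2) r_def)
    then show ?thesis using nrm_factor[of "h k - \<eta>"] L2.diff_mem[OF h(1)[of k] \<eta>(1)]
      by (simp add: L2_measurable)
  qed
  have r_min: "(L2.nrm M r)\<^sup>2 \<le> (L2.nrm M y)\<^sup>2" if y: "y \<in> C 0" for y
  proof -
    have yL: "y \<in> L2 M" using y CL by blast
    have "L2.nrm M r \<le> sqrt ((L2.nrm M y)\<^sup>2 + inverse (real (Suc k))) + L2.nrm N (h k - \<eta>)" for k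
    proof -
      have "(L2.nrm M (x k))\<^sup>2 \<le> (L2.nrm M y)\<^sup>2 + inverse (real (Suc k))"
        using min[of y k] y by (simp add: C_def inverse_eq_divide)
      then have "L2.nrm M (x k) \<le> sqrt ((L2.nrm M y)\<^sup>2 + inverse (real (Suc k)))" by (rule real_le_rsqrt)
      then show ?thesis using L2.nrm_triangle_le[OF rL xL, of k] unfolding rx by linarith
    qed
    moreover have "(\<lambda>k. sqrt ((L2.nrm M y)\<^sup>2 + inverse (real (Suc k))) + L2.nrm N (h k - \<eta>)) \<longlonglongrightarrow>
        sqrt ((L2.nrm M y)\<^sup>2 + 0) + 0"
      by (intro tendsto_intros LIMSEQ_inverse_real_of_nat \<eta>(2))
    ultimately have "L2.nrm M r \<le> sqrt ((L2.nrm M y)\<^sup>2 + 0) + 0" by (intro LIMSEQ_le_const) auto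
    then have "L2.nrm M r \<le> L2.nrm M y" using L2.nrm_nonneg[OF yL] by simp
    then show ?thesis using L2.nrm_nonneg[OF rL] by (intro power_mono)
  qed
  show ?thesis
  proof (rule that[OF \<eta>(1)])
    fix \<theta> assume \<theta>: "\<theta> \<in> L2 N"
    have pL: "?p \<theta> \<in> L2 M" by (rule L2_factor[OF \<theta>])
    let ?a = "l2ip M r (?p \<theta>)" and ?b = "l2ip M (?p \<theta>) (?p \<theta>)"
    have key: "2 * s * ?a \<le> s\<^sup>2 * ?b" for s
    proof -
      have "r - s *\<^sub>R ?p \<theta> = \<xi> - ?p (\<eta> + s *\<^sub>R \<theta>)" by (rule ext) (simp add: r_def)
      moreover have "\<eta> + s *\<^sub>R \<theta> \<in> L2 N" by (rule L2.add_mem[OF \<eta>(1) L2.scale_mem[OF \<theta>]])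
      ultimately have "r - s *\<^sub>R ?p \<theta> \<in> C 0" unfolding C_def by blast
      then have "(L2.nrm M r)\<^sup>2 \<le> (L2.nrm M (r - s *\<^sub>R ?p \<theta>))\<^sup>2" by (rule r_min)
      also have "\<dots> = (L2.nrm M r)\<^sup>2 - 2 * (s * ?a) + (L2.nrm M (s *\<^sub>R ?p \<theta>))\<^sup>2"
        unfolding L2.nrm_diff_power2[OF rL L2.scale_mem[OF pL]] L2.ip_scale_right[OF pL rL] ..
      also have "(L2.nrm M (s *\<^sub>R ?p \<theta>))\<^sup>2 = s\<^sup>2 * ?b"
        unfolding L2.nrm_scale[OF pL] power_mult_distrib L2.nrm_power2[OF pL] by simp
      finally show ?thesis by simp
    qed
    have "?a = 0"
    proof (rule ccontr)
      assume "?a \<noteq> 0"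
      have b: "?b \<ge> 0" by (rule L2.ip_nonneg[OF pL])
      \<comment> \<open>Nearly the minimizer of the quadratic
        \<open>s\<^sup>2 * ?b - 2 * s * ?a\<close>; the added 1 is for the case that
        \<open>?b\<close> vanishes.\<close>
      define s where "s = ?a / (?b + 1)"
      have "?a = s * (?b + 1)" using b by (simp add: s_def)
      then have "2 * s * ?a = 2 * s * (s * (?b + 1))" by (rule arg_cong)
      also have "\<dots> = 2 * (?b + 1) * s\<^sup>2" by (simp add: power2_eq_square algebra_simps)
      finally have "2 * s * ?a = 2 * (?b + 1) * s\<^sup>2" .
      then have "2 * (?b + 1) * s\<^sup>2 \<le> ?b * s\<^sup>2" using key[of s] by (simp add: mult.commute)
      moreover have "s\<^sup>2 > 0" using \<open>?a \<noteq> 0\<close> b by (simp add: s_def)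
      ultimately have "2 * (?b + 1) \<le> ?b" by (simp only: mult_le_cancel_right_pos)
      then show False using b by simp
    qed
    then show "l2ip M (\<xi> - ?p \<eta>) (?p \<theta>) = 0" by (simp add: r_def)
  qed
qed

text \<open>With \<open>r = \<xi> - \<eta> \<circ> \<pi>\<close> the error on \<open>M\<close> is
  the sum of \<open>F r\<close> and the lifted error of \<open>\<eta>\<close>. Functions on the
  factor are invariant under translation, so \<open>F r\<close> is orthogonal to them as
  \<open>r\<close> is, and Pythagoras applies.\<close>

lemma projected_approximation:
  assumes \<xi>: "\<xi> \<in> L2 M"
  obtains \<eta> where "\<eta> \<in> L2 N" "\<And>F w. F \<in> fin_supp G \<Longrightarrow> w \<in> L2 N \<Longrightarrow>
    L2.nrm N (conv G actN F \<eta> - w) \<le> L2.nrm M (conv G act F \<xi> - (\<lambda>x. w (\<pi> x)))"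
proof -
  let ?p = "\<lambda>f x. f (\<pi> x)"
  obtain \<eta> where \<eta>: "\<eta> \<in> L2 N" "\<And>\<theta>. \<theta> \<in> L2 N \<Longrightarrow> l2ip M (\<xi> - ?p \<eta>) (?p \<theta>) = 0"
    by (rule orthogonal_projection[OF \<xi>]) (blast intro: that)
  define r where "r = \<xi> - ?p \<eta>"
  have rL: "r \<in> L2 M" unfolding r_def by (rule L2.diff_mem[OF \<xi> L2_factor[OF \<eta>(1)]])
  show ?thesis
  proof (rule that[OF \<eta>(1)])
    fix F w assume F: "F \<in> fin_supp G" and w: "w \<in> L2 N"
    define \<theta> where "\<theta> = conv G actN F \<eta> - w"
    have \<theta>: "\<theta> \<in> L2 N" unfolding \<theta>_def by (rule L2.diff_mem[OF N.conv_L2[OF F \<eta>(1)] w])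
    have pL: "?p \<theta> \<in> L2 M" by (rule L2_factor[OF \<theta>])
    have cL: "conv G act F r \<in> L2 M" by (rule conv_L2[OF F rL])
    have c: "g \<in> carrier G" if "F g \<noteq> 0" for g using F that by (auto simp: fin_supp_def)
    have orth: "l2ip M (koop G act g r) (?p \<theta>) = 0" if g: "g \<in> carrier G" for g
    proof -
      have "l2ip M (koop G act g r) (?p \<theta>) = l2ip M r (koop G act (inv g) (?p \<theta>))"
        by (rule koop_adjoint[OF g rL pL])
      also have "\<dots> = l2ip M r (?p (koop G actN (inv g) \<theta>))"
        using g by (intro l2ip_cong) (auto simp: koop_factor)
      also have "\<dots> = 0" unfolding r_def using g by (intro \<eta>(2) N.koop_L2 \<theta>) auto
      finally show ?thesis .
    qed
    have "l2ip M (conv G act F r) (?p \<theta>) = (\<Sum>g | F g \<noteq> 0. l2ip M (F g *\<^sub>R koop G act g r) (?p \<theta>))"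
      unfolding conv_def using c rL pL by (intro L2.ip_sum_left L2.scale_mem koop_L2) auto
    also have "\<dots> = (\<Sum>g | F g \<noteq> 0. F g * l2ip M (koop G act g r) (?p \<theta>))"
      using c rL pL by (intro sum.cong refl L2.ip_scale_left koop_L2) auto
    also have "\<dots> = 0" using c orth by (intro sum.neutral) auto
    finally have orth': "l2ip M (conv G act F r) (?p \<theta>) = 0" .
    have eq: "L2.nrm M (conv G act F \<xi> - ?p w) = L2.nrm M (conv G act F r + ?p \<theta>)"
      by (rule L2_nrm_cong) (simp add: r_def conv_diff_right \<theta>_def conv_factor[OF F])
    have "(L2.nrm N \<theta>)\<^sup>2 = (L2.nrm M (?p \<theta>))\<^sup>2" using nrm_factor[of \<theta>] \<theta> by (simp add: L2_measurable)
    also have "\<dots> \<le> (L2.nrm M (conv G act F r + ?p \<theta>))\<^sup>2"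
      unfolding L2.nrm_add_power2[OF cL pL] orth' by simp
    finally have "(L2.nrm N \<theta>)\<^sup>2 \<le> (L2.nrm M (conv G act F r + ?p \<theta>))\<^sup>2" .
    then have "L2.nrm N \<theta> \<le> L2.nrm M (conv G act F r + ?p \<theta>)"
      by (rule power2_le_imp_le) (rule L2.nrm_nonneg[OF L2.add_mem[OF cL pL]])
    then show "L2.nrm N (conv G actN F \<eta> - w) \<le> L2.nrm M (conv G act F \<xi> - ?p w)"
      unfolding eq \<theta>_def .
  qed
qed

end

section \<open>Construction of the factor generated by a function\<close>

lemma group_actionI:
  assumes "group G"
    and ext: "\<And>g. g \<in> carrier G \<Longrightarrow> \<phi> g \<in> extensional E"
    and mem: "\<And>g x. g \<in> carrier G \<Longrightarrow> x \<in> E \<Longrightarrow> \<phi> g x \<in> E"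
    and one: "\<And>x. x \<in> E \<Longrightarrow> \<phi> \<one>\<^bsub>G\<^esub> x = x"
    and mult: "\<And>g h x. g \<in> carrier G \<Longrightarrow> h \<in> carrier G \<Longrightarrow> x \<in> E \<Longrightarrow> \<phi> (g \<otimes>\<^bsub>G\<^esub> h) x = \<phi> g (\<phi> h x)"
  shows "group_action G E \<phi>"
proof -
  interpret group G by fact
  have Bij: "\<phi> g \<in> Bij E" if g: "g \<in> carrier G" for g
  proof -
    have "bij_betw (\<phi> g) E E"
    proof (rule bij_betw_byWitness[where f' = "\<phi> (inv\<^bsub>G\<^esub> g)"])
      show "\<forall>a\<in>E. \<phi> (inv\<^bsub>G\<^esub> g) (\<phi> g a) = a" "\<forall>a\<in>E. \<phi> g (\<phi> (inv\<^bsub>G\<^esub> g) a) = a"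
        using g one mult[of "inv\<^bsub>G\<^esub> g" g] mult[of g "inv\<^bsub>G\<^esub> g"] by auto
    qed (use g mem in auto)
    then show ?thesis using ext g by (simp add: Bij_def)
  qed
  have "\<phi> (g \<otimes>\<^bsub>G\<^esub> h) = \<phi> g \<otimes>\<^bsub>BijGroup E\<^esub> \<phi> h" if "g \<in> carrier G" "h \<in> carrier G" for g h
  proof -
    have "\<phi> (g \<otimes>\<^bsub>G\<^esub> h) = compose E (\<phi> g) (\<phi> h)"
      using that by (intro extensionalityI[of _ E]) (auto simp: ext mult compose_def)
    then show ?thesis using that Bij by (simp add: BijGroup_def)
  qed
  then have "\<phi> \<in> hom G (BijGroup E)" using Bij by (auto simp: hom_def BijGroup_def)
  then show ?thesis
    using group_BijGroup is_group by (simp add: group_action_def group_hom_def group_hom_axioms_def)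
qed

text \<open>A sequence is determined by the rational cuts of its entries, a subset of a countable
  set, and there are as many sets of naturals as reals. A bare injection suffices, because
  measurable structure and topology are transported along it.\<close>

lemma real_sequences_inject_into_reals: "\<exists>E :: (nat \<Rightarrow> real) \<Rightarrow> real. inj E"
proof -
  obtain b :: "nat set \<Rightarrow> real" where b: "bij b"
    using nat_sets_eqpoll_reals unfolding eqpoll_def by blast
  define h where "h \<omega> = to_nat ` {(n :: nat, q :: rat). of_rat q < (\<omega> n :: real)}" for \<omega>
  have lt: "h \<omega> \<noteq> h \<omega>'" if less: "\<omega> n < \<omega>' n" for \<omega> \<omega>' :: "nat \<Rightarrow> real" and n
  proof
    assume "h \<omega> = h \<omega>'"
    then have eq: "{(n, q). of_rat q < \<omega> n} = {(n, q). of_rat q < \<omega>' n}"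
      unfolding h_def by (simp add: inj_image_eq_iff)
    obtain q where q: "\<omega> n < of_rat q" "of_rat q < \<omega>' n" using of_rat_dense[OF less] by blast
    then have "(n, q) \<in> {(n, q). of_rat q < \<omega>' n}" by simp
    then have "(n, q) \<in> {(n, q). of_rat q < \<omega> n}" unfolding eq .
    then show False using q by simp
  qed
  have "inj h"
  proof (rule injI, rule ccontr)
    fix \<omega> \<omega>' :: "nat \<Rightarrow> real" assume "h \<omega> = h \<omega>'" "\<omega> \<noteq> \<omega>'"
    moreover from \<open>\<omega> \<noteq> \<omega>'\<close> obtain n where "\<omega> n \<noteq> \<omega>' n" by blast
    ultimately show False using lt[of \<omega> n \<omega>'] lt[of \<omega>' n \<omega>] by (metis linorder_neq_iff)
  qed
  then have "inj (b \<circ> h)" using b by (simp add: bij_is_inj inj_compose)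
  then show ?thesis by blast
qed

lemma second_countable_euclidean: "second_countable (euclidean :: 'a::second_countable_topology topology)"
proof -
  obtain \<B> :: "'a set set" where \<B>: "countable \<B>" "topological_basis \<B>" using ex_countable_basis by blast
  have "\<exists>V\<in>\<B>. x \<in> V \<and> V \<subseteq> U" if "open U" "x \<in> U" for U x
    using topological_basisE[OF \<B>(2) that] by blast
  then show ?thesis
    unfolding second_countable_def open_openin[symmetric] using \<B>(1) topological_basis_open[OF \<B>(2)]
    by (intro exI[of _ \<B>] conjI allI impI ballI) blast+
qed

text \<open>For the topology pulled back along the left inverse \<open>D\<close>, the map
  \<open>E\<close> is a homeomorphism onto its range, which is therefore Polish.\<close>

lemma standard_prob_space_vimage_algebra:
  fixes E :: "'c::polish_space \<Rightarrow> 'd"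
  assumes D: "\<And>\<omega>. D (E \<omega>) = \<omega>" and N: "prob_space N" "space N = range E" "sets N = sets (vimage_algebra (range E) (D) borel)"
  shows "standard_prob_space N"
proof -
  define T where "T = pullback_topology (range E) (D) (euclidean :: 'c topology)"
  have top: "topspace T = range E" by (simp add: T_def topspace_pullback_topology)
  have "continuous_map T euclidean (id \<circ> D)" unfolding T_def by (intro continuous_map_pullback) simp
  moreover have "continuous_map euclidean T E"
    unfolding T_def
  proof (rule continuous_map_pullback')
    have "D \<circ> E = id" using D by auto
    then show "continuous_map euclidean euclidean (D \<circ> E)" by simp
  qed auto
  ultimately have "homeomorphic_maps T euclidean (D) E"
    unfolding homeomorphic_maps_def using D by (auto simp: top)
  then have hom: "T homeomorphic_space (euclidean :: 'c topology)"
    unfolding homeomorphic_space_def by blast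
  have "sets N = sigma_sets (range E) {D -` A \<inter> range E | A. A \<in> {S. open S}}"
    unfolding N(3) borel_def by (subst vimage_algebra_sigma) (auto simp: sets_measure_of_conv)
  also have "{D -` A \<inter> range E | A. A \<in> {S. open S}} = {U. openin T U}"
    by (auto simp: T_def openin_pullback_topology)
  finally have "sets N = sigma_sets (topspace T) {U. openin T U}" by (simp add: top)
  moreover have "completely_metrizable_space T"
    using homeomorphic_completely_metrizable_space[OF hom] completely_metrizable_space_euclidean by blast
  moreover have "second_countable T"
    using homeomorphic_space_second_countability[OF hom] second_countable_euclidean by blast
  ultimately show ?thesis unfolding standard_prob_space_def using N(1,2) top by metis
qed

context pmp_system
begin

text \<open>
  The factor generated by the translates of a function, realized on a set of reals: it is the
  image of \<open>x \<mapsto> (\<zeta> (g\<^sup>-\<^sup>1 x))\<^sub>g\<close>, with \<open>G\<close> enumerated by natural numbers and the unused coordinates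
  set to zero.
\<close>

lemma generated_factor:
  assumes count: "countable (carrier G)" and \<zeta>: "\<zeta> \<in> borel_measurable M"
  obtains N :: "real measure" and actN \<pi> and z :: "nat \<Rightarrow> real \<Rightarrow> real"
  where "pmp_factor G M act N actN \<pi>" "standard_prob_space N"
    "\<And>n. z n \<in> borel_measurable N"
    "\<And>n. (\<exists>g\<in>carrier G. \<forall>x\<in>space M. z n (\<pi> x) = koop G act g \<zeta> x) \<or> (\<forall>x\<in>space M. z n (\<pi> x) = 0)"
    "\<exists>n. \<forall>x\<in>space M. z n (\<pi> x) = \<zeta> x"
    "\<forall>Z. space Z = space N \<longrightarrow> (\<forall>n. z n \<in> borel_measurable Z) \<longrightarrow> sets N \<subseteq> sets Z"
proof -
  have [measurable]: "\<zeta> \<in> borel_measurable M" by fact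
  define idx where "idx = to_nat_on (carrier G)"
  define en where "en = from_nat_into (carrier G)"
  have en_idx [simp]: "en (idx g) = g" if "g \<in> carrier G" for g
    using that count by (simp add: en_def idx_def)
  have idx_eq [simp]: "idx g = idx h \<longleftrightarrow> g = h" if "g \<in> carrier G" "h \<in> carrier G" for g h
    using en_idx[OF that(1)] en_idx[OF that(2)] by metis
  obtain E :: "(nat \<Rightarrow> real) \<Rightarrow> real" where E: "inj E" using real_sequences_inject_into_reals by blast
  define D where "D = inv_into UNIV E"
  have invE [simp]: "D (E \<omega>) = \<omega>" for \<omega> using E by (simp add: D_def)
  define p where "p x n = (if n \<in> idx ` carrier G then \<zeta> (act (inv (en n)) x) else 0)" for x n
  \<comment> \<open>The left shift in the enumerated coordinates: the coordinate of \<open>k\<close>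
    is replaced by that of \<open>inv g \<otimes> k\<close>, which is what happens to
    \<open>p x\<close> when \<open>x\<close> is moved by \<open>g\<close>.\<close>
  define sh where "sh g \<omega> n = (if n \<in> idx ` carrier G then \<omega> (idx (inv g \<otimes> en n)) else \<omega> n)"
    for g and \<omega> :: "nat \<Rightarrow> real" and n
  define \<pi> where "\<pi> x = E (p x)" for x
  \<comment> \<open>Restricted to the range, since a \<open>group_action\<close> consists of
    extensional maps.\<close>
  define actN where "actN g = (\<lambda>r\<in>range E. E (sh g (D r)))" for g
  define V where "V = vimage_algebra (range E) (D) borel"
  define N where "N = distr M V \<pi>"
  have spN [simp]: "space N = range E" "space V = range E" and sN: "sets N = sets V"
    by (auto simp: N_def V_def)
  have p_meas: "p \<in> borel_measurable M"
  proof (rule measurable_coordinatewise_then_product)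
    fix n
    show "(\<lambda>x. p x n) \<in> borel_measurable M"
    proof (cases "n \<in> idx ` carrier G")
      case True
      then have "inv (en n) \<in> carrier G" by auto
      then show ?thesis using True unfolding p_def by simp
    qed (simp add: p_def)
  qed
  have \<pi>_V: "\<pi> \<in> measurable M V"
    unfolding V_def by (rule measurable_vimage_algebra2) (auto simp: \<pi>_def p_meas)
  then have \<pi>_N: "\<pi> \<in> measurable M N" by (simp add: measurable_cong_sets[OF refl sN])
  have invE_V: "D \<in> measurable V borel" unfolding V_def by (rule measurable_vimage_algebra1) simp
  then have invE_N: "D \<in> measurable N borel" by (simp add: measurable_cong_sets[OF sN refl])
  have probN: "prob_space N" unfolding N_def by (rule prob_space_distr[OF \<pi>_V])
  have sh_mult: "sh (g \<otimes> h) \<omega> = sh g (sh h \<omega>)" if "g \<in> carrier G" "h \<in> carrier G" for g h \<omega>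
    using that by (auto simp: sh_def fun_eq_iff inv_mult_group m_assoc)
  have sh_one: "sh \<one> \<omega> = \<omega>" for \<omega> by (auto simp: sh_def fun_eq_iff)
  have sh_meas: "sh g \<in> measurable borel borel" for g
  proof (rule measurable_coordinatewise_then_product)
    fix n
    show "(\<lambda>\<omega>. sh g \<omega> n) \<in> borel_measurable borel"
      unfolding sh_def by (cases "n \<in> idx ` carrier G") (simp_all add: measurable_product_coordinates)
  qed
  have p_act: "p (act g x) = sh g (p x)" if g: "g \<in> carrier G" and x: "x \<in> space M" for g x
  proof
    fix n
    show "p (act g x) n = sh g (p x) n"
    proof (cases "n \<in> idx ` carrier G")
      case True
      then obtain k where k: "k \<in> carrier G" "n = idx k" by blast
      have "p (act g x) n = \<zeta> (act (inv k) (act g x))" using k by (simp add: p_def)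
      also have "act (inv k) (act g x) = act (inv (inv g \<otimes> k)) x"
        using k(1) g x by (simp add: act_mult[symmetric] inv_mult_group)
      also have "\<zeta> \<dots> = sh g (p x) n" using k g by (simp add: sh_def p_def)
      finally show ?thesis .
    qed (simp add: p_def sh_def)
  qed
  have equi: "\<pi> (act g x) = actN g (\<pi> x)" if "g \<in> carrier G" "x \<in> space M" for g x
    using p_act[OF that] by (simp add: \<pi>_def actN_def)
  have actN_V: "actN g \<in> measurable V V" for g
    unfolding V_def
  proof (rule measurable_vimage_algebra2)
    show "actN g \<in> space (vimage_algebra (range E) (D) borel) \<rightarrow> range E" by (auto simp: actN_def)
    have "(\<lambda>r. sh g (D r)) \<in> measurable V borel" by (rule measurable_compose[OF invE_V sh_meas])
    then show "(\<lambda>r. D (actN g r)) \<in> measurable (vimage_algebra (range E) (D) borel) borel"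
      unfolding V_def[symmetric] by (subst measurable_cong[where g = "\<lambda>r. sh g (D r)"]) (auto simp: actN_def)
  qed
  have distrN: "distr N N (actN g) = N" if g: "g \<in> carrier G" for g
  proof -
    have "distr N N (actN g) = distr N V (actN g)" by (rule distr_cong) (auto simp: sN)
    also have "\<dots> = distr M V (actN g \<circ> \<pi>)" unfolding N_def by (rule distr_distr[OF actN_V \<pi>_V])
    also have "\<dots> = distr M V (\<pi> \<circ> act g)" using equi[OF g] by (intro distr_cong) auto
    also have "\<dots> = distr (distr M M (act g)) V \<pi>" by (rule distr_distr[OF \<pi>_V act_measurable[OF g], symmetric])
    finally show ?thesis by (simp add: distr_act[OF g] N_def)
  qed
  have "group_action G (range E) actN"
    by (rule group_actionI[OF is_group]) (auto simp: actN_def sh_mult sh_one)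
  then have "pmp_action G N actN"
    unfolding pmp_action_def using probN distrN actN_V
    by (auto simp: measurable_cong_sets[OF sN sN])
  then interpret N: pmp_system G N actN by unfold_locales
  have "distr M N \<pi> = N" unfolding N_def by (rule distr_cong) auto
  then have fac: "pmp_factor G M act N actN \<pi>"
    by unfold_locales (auto simp: \<pi>_N equi)
  show ?thesis
  proof (rule that[OF fac, of "\<lambda>n r. D r n"])
    show "standard_prob_space N"
      by (rule standard_prob_space_vimage_algebra[OF invE probN]) (auto simp: sN V_def)
    show "(\<lambda>r. D r n) \<in> borel_measurable N" for n
      by (rule measurable_product_then_coordinatewise[OF invE_N])
    have coord: "D (\<pi> x) (idx g) = koop G act g \<zeta> x" if "g \<in> carrier G" for g x
      using that by (simp add: \<pi>_def p_def koop_def)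
    show "(\<exists>g\<in>carrier G. \<forall>x\<in>space M. D (\<pi> x) n = koop G act g \<zeta> x) \<or> (\<forall>x\<in>space M. D (\<pi> x) n = 0)" for n
    proof (cases "n \<in> idx ` carrier G")
      case True
      then show ?thesis using coord by blast
    qed (simp add: \<pi>_def p_def)
    have "D (\<pi> x) (idx \<one>) = \<zeta> x" if "x \<in> space M" for x
      using coord[of \<one> x] that by (simp add: koop_def)
    then show "\<exists>n. \<forall>x\<in>space M. D (\<pi> x) n = \<zeta> x" by blast
    show "\<forall>Z. space Z = space N \<longrightarrow> (\<forall>n. (\<lambda>r. D r n) \<in> borel_measurable Z) \<longrightarrow> sets N \<subseteq> sets Z"
    proof (intro allI impI)
      fix Z :: "real measure"
      assume Z: "space Z = space N" and meas: "\<forall>n. (\<lambda>r. D r n) \<in> borel_measurable Z"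
      have "D \<in> borel_measurable Z"
        using meas by (intro measurable_coordinatewise_then_product) blast
      then have "D -` A \<inter> space Z \<in> sets Z" if "A \<in> sets borel" for A using that by (rule measurable_sets)
      then show "sets N \<subseteq> sets Z"
        unfolding sN V_def by (subst sets_vimage_algebra2) (auto simp: Z)
    qed
  qed
qed

end

section \<open>Contradiction with completely positive entropy\<close>

lemma L2_cong: "(\<And>x. x \<in> space M \<Longrightarrow> f x = f' x) \<Longrightarrow> f \<in> L2 M \<longleftrightarrow> f' \<in> L2 M"
  unfolding L2_def using measurable_cong[of M f f' borel] Bochner_Integration.integrable_cong[of M M "\<lambda>x. (f x)\<^sup>2" "\<lambda>x. (f' x)\<^sup>2"]
  by simp

context sofic_system
begin

text \<open>The distribution of \<open>w\<close> has at most countably many atoms, so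
  \<open>t\<close> is a limit from above of levels \<open>s k\<close> that are not atoms, and the
  level set at \<open>t\<close> is the union of those at the \<open>s k\<close>.\<close>

lemma zero_set_level_all:
  fixes w :: "'a \<Rightarrow> real"
  assumes w: "w \<in> borel_measurable M"
    and zero: "\<And>t. measure M {x \<in> space M. w x = t} = 0 \<Longrightarrow> zero_set {x \<in> space M. w x > t}"
  shows "zero_set {x \<in> space M. w x > t}"
proof -
  interpret dw: prob_space "distr M borel w" using w by (rule prob_space_distr)
  have "measure (distr M borel w) {s} = measure M {x \<in> space M. w x = s}" for s
  proof -
    have "measure (distr M borel w) {s} = measure M (w -` {s} \<inter> space M)"
      using w by (intro measure_distr) auto
    also have "w -` {s} \<inter> space M = {x \<in> space M. w x = s}" by auto
    finally show ?thesis .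
  qed
  then have "countable {s. measure M {x \<in> space M. w x = s} \<noteq> 0}" using dw.countable_support by simp
  have "\<exists>s. t < s \<and> s < t + 1 / Suc k \<and> measure M {x \<in> space M. w x = s} = 0" for k :: nat
  proof -
    have "uncountable {t<..<t + 1 / Suc k}" by (simp add: uncountable_open_interval)
    then have "\<not> {t<..<t + 1 / Suc k} \<subseteq> {s. measure M {x \<in> space M. w x = s} \<noteq> 0}"
      using \<open>countable _\<close> countable_subset by blast
    then show ?thesis by auto
  qed
  then obtain s where s: "\<And>k. t < s k" "\<And>k. s k < t + 1 / Suc k" "\<And>k. measure M {x \<in> space M. w x = s k} = 0"
    by metis
  have "{x \<in> space M. w x > t} = (\<Union>k. {x \<in> space M. w x > s k})"
  proof (intro equalityI subsetI)
    fix x assume x: "x \<in> {x \<in> space M. w x > t}"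
    then obtain k where "inverse (real (Suc k)) < w x - t" using reals_Archimedean[of "w x - t"] by auto
    then have "s k < w x" using s(2)[of k] by (simp add: inverse_eq_divide)
    then show "x \<in> (\<Union>k. {x \<in> space M. w x > s k})" using x by auto
  next
    fix x assume "x \<in> (\<Union>k. {x \<in> space M. w x > s k})"
    then obtain k where "x \<in> space M" "w x > s k" by blast
    then show "x \<in> {x \<in> space M. w x > t}" using s(1)[of k] by simp
  qed
  also have "zero_set \<dots>" by (rule zero_set_UN) (rule zero[OF s(3)])
  finally show ?thesis .
qed

text \<open>The zero sets form a \<sigma>-algebra for which all \<open>w n\<close> are measurable;
  by \<open>gen\<close> it contains every measurable set.\<close>

lemma entropy_le_0_if_generated:
  assumes w: "\<And>n :: nat. w n \<in> L2 M" and \<eta>: "\<eta> \<in> L2 M"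
    and approx: "\<And>n e. e > 0 \<Longrightarrow> \<exists>F\<in>fin_supp G. FS.nrm F < e \<and> L2.nrm M (conv G act F \<eta> - w n) < e"
    and gen: "\<And>Z. space Z = space M \<Longrightarrow> (\<And>n. w n \<in> borel_measurable Z) \<Longrightarrow> sets M \<subseteq> sets Z"
  shows "sofic_entropy G d \<sigma> M act \<le> 0"
proof (rule sofic_entropy_le_0)
  define Z where "Z = sigma (space M) {D. zero_set D}"
  interpret Z: sigma_algebra "space M" "{D. zero_set D}" by (rule sigma_algebra_zero_set)
  have Z: "space Z = space M" "sets Z = {D. zero_set D}"
    using Z.space_closed Z.sigma_sets_eq unfolding Z_def by (auto simp: sets_measure_of)
  have "w n \<in> borel_measurable Z" for n
    unfolding borel_measurable_iff_greater Z
  proof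
    fix t
    have "zero_set {x \<in> space M. w n x > t}"
    proof (rule zero_set_level_all)
      show "w n \<in> borel_measurable M" by (rule L2_measurable[OF w])
      show "zero_set {x \<in> space M. w n x > t}" if "measure M {x \<in> space M. w n x = t} = 0" for t
        by (rule level_zero_set[OF w \<eta> approx that])
    qed
    then show "{x \<in> space M. t < w n x} \<in> {D. zero_set D}" by simp
  qed
  then have "sets M \<subseteq> sets Z" by (intro gen Z(1))
  then show "zero_set D" if "D \<in> sets M" for D using that Z by blast
qed

text \<open>The common core of both conclusions: each of them supplies its own \<open>\<xi>\<close>,
  test vector \<open>v\<close> and elements \<open>F\<close>, with \<open>b\<close> and
  \<open>c\<close> independent of the smallness of \<open>F\<close>.\<close>

theorem cpe_contradiction:
  assumes count: "countable (carrier G)" and cpe: "completely_positive_entropy G d \<sigma> M act"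
    and \<xi>: "\<xi> \<in> L2 M" "(\<integral>x. \<xi> x \<partial>M) = 0" and v: "v \<in> L2 M" and c: "c > 0"
    and F: "\<And>e. e > 0 \<Longrightarrow> \<exists>F\<in>fin_supp G. FS.nrm F \<le> e \<and> L2.nrm M (conv G act F \<xi>) \<le> b \<and> c \<le> l2ip M (conv G act F \<xi>) v"
  shows False
proof -
  obtain \<zeta> where \<zeta>: "\<zeta> \<in> L2 M" "(\<integral>x. \<zeta> x \<partial>M) = 0" "c \<le> l2ip M \<zeta> v"
    and approx: "\<And>e. e > 0 \<Longrightarrow> \<exists>F\<in>fin_supp G. FS.nrm F < e \<and> L2.nrm M (conv G act F \<xi> - \<zeta>) < e"
    by (rule limit_vector[OF \<xi> v c F]) (assumption, rule that)
  obtain N :: "real measure" and actN \<pi> and z :: "nat \<Rightarrow> real \<Rightarrow> real"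
    where fac: "pmp_factor G M act N actN \<pi>" and std: "standard_prob_space N"
    and z: "\<And>n. z n \<in> borel_measurable N"
      "\<And>n. (\<exists>g\<in>carrier G. \<forall>x\<in>space M. z n (\<pi> x) = koop G act g \<zeta> x) \<or> (\<forall>x\<in>space M. z n (\<pi> x) = 0)"
      "\<exists>n. \<forall>x\<in>space M. z n (\<pi> x) = \<zeta> x"
    and gen: "\<forall>Z. space Z = space N \<longrightarrow> (\<forall>n. z n \<in> borel_measurable Z) \<longrightarrow> sets N \<subseteq> sets Z"
    by (rule generated_factor[OF count L2_measurable[OF \<zeta>(1)]]) (rule that)
  interpret fac: pmp_factor G M act N actN \<pi> by (rule fac)
  interpret N: sofic_system G N actN d \<sigma> by unfold_locales (rule sofic)
  obtain \<eta> where \<eta>: "\<eta> \<in> L2 N" "\<And>F w. F \<in> fin_supp G \<Longrightarrow> w \<in> L2 N \<Longrightarrow>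
      L2.nrm N (conv G actN F \<eta> - w) \<le> L2.nrm M (conv G act F \<xi> - (\<lambda>x. w (\<pi> x)))"
    by (rule fac.projected_approximation[OF \<xi>(1)]) (rule that)
  have zL: "z n \<in> L2 N" for n
  proof -
    have "(\<lambda>x. z n (\<pi> x)) \<in> L2 M"
      using z(2)[of n]
    proof
      assume "\<exists>g\<in>carrier G. \<forall>x\<in>space M. z n (\<pi> x) = koop G act g \<zeta> x"
      then obtain g where g: "g \<in> carrier G" "\<forall>x\<in>space M. z n (\<pi> x) = koop G act g \<zeta> x" by blast
      then show ?thesis using L2_cong[of M "\<lambda>x. z n (\<pi> x)" "koop G act g \<zeta>"] koop_L2[OF g(1) \<zeta>(1)] by simp
    next
      assume "\<forall>x\<in>space M. z n (\<pi> x) = 0"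
      then show ?thesis using L2_cong[of M "\<lambda>x. z n (\<pi> x)" 0] L2.zero_mem[of M] by simp
    qed
    then show ?thesis using fac.L2_factor_iff[OF z(1)] by simp
  qed
  have "sofic_entropy G d \<sigma> N actN \<le> 0"
  proof (rule N.entropy_le_0_if_generated[OF zL \<eta>(1)])
    show "sets N \<subseteq> sets Z" if "space Z = space N" "\<And>n. z n \<in> borel_measurable Z" for Z
      using gen that by blast
    fix n and e :: real assume "e > 0"
    show "\<exists>F\<in>fin_supp G. FS.nrm F < e \<and> L2.nrm N (conv G actN F \<eta> - z n) < e"
      using z(2)[of n]
    proof
      assume "\<exists>g\<in>carrier G. \<forall>x\<in>space M. z n (\<pi> x) = koop G act g \<zeta> x"
      then obtain g where g: "g \<in> carrier G" "\<forall>x\<in>space M. z n (\<pi> x) = koop G act g \<zeta> x" by blast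
      obtain F where F: "F \<in> fin_supp G" "FS.nrm F < e" "L2.nrm M (conv G act F \<xi> - \<zeta>) < e"
        using approx[OF \<open>e > 0\<close>] by blast
      \<comment> \<open>The coordinates of the factor are translates of \<open>\<zeta>\<close>, so
        the coefficients are translated accordingly, at unchanged 2-norm.\<close>
      have F': "ltrans G g F \<in> fin_supp G" by (rule ltrans_mem[OF F(1) g(1)])
      have "L2.nrm N (conv G actN (ltrans G g F) \<eta> - z n) \<le>
          L2.nrm M (conv G act (ltrans G g F) \<xi> - (\<lambda>x. z n (\<pi> x)))"
        by (rule \<eta>(2)[OF F' zL])
      also have "\<dots> = L2.nrm M (koop G act g (conv G act F \<xi> - \<zeta>))"
        using g(2) by (intro L2_nrm_cong) (simp add: conv_ltrans[OF F(1) g(1)] koop_diff)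
      also have "\<dots> = L2.nrm M (conv G act F \<xi> - \<zeta>)"
        by (rule koop_nrm[OF g(1) L2.diff_mem[OF conv_L2[OF F(1) \<xi>(1)] \<zeta>(1)]])
      finally have "L2.nrm N (conv G actN (ltrans G g F) \<eta> - z n) < e" using F(3) by simp
      moreover have "FS.nrm (ltrans G g F) < e" using fsnrm_ltrans[OF F(1) g(1)] F(2) by simp
      ultimately show ?thesis using F' by blast
    next
      \<comment> \<open>A coordinate that corresponds to no group element; it is approximated by
        \<open>F = 0\<close>.\<close>
      assume z0: "\<forall>x\<in>space M. z n (\<pi> x) = 0"
      have 0: "(0 :: 'g \<Rightarrow> real) \<in> fin_supp G" by (rule FS.zero_mem)
      have "L2.nrm N (conv G actN 0 \<eta> - z n) \<le> L2.nrm M (conv G act 0 \<xi> - (\<lambda>x. z n (\<pi> x)))"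
        by (rule \<eta>(2)[OF 0 zL])
      also have "\<dots> = L2.nrm M 0" using z0 by (intro L2_nrm_cong) (simp add: conv_def)
      finally have "L2.nrm N (conv G actN 0 \<eta> - z n) < e" using \<open>e > 0\<close> L2.nrm_zero[of M] by linarith
      moreover have "FS.nrm (0 :: 'g \<Rightarrow> real) < e" using \<open>e > 0\<close> FS.nrm_zero by metis
      ultimately show ?thesis using 0 by blast
    qed
  qed
  \<comment> \<open>If the factor were one point, \<open>\<zeta>\<close> would be constant almost
    everywhere, hence zero as its mean is zero, against the lower bound on its product with
    \<open>v\<close>.\<close>
  moreover have "\<not> one_atom N"
  proof
    assume "one_atom N"
    then obtain r where r: "measure N {r} = 1" unfolding one_atom_def by blast
    \<comment> \<open>Sets that are not measurable have measure 0 by default, so the value 1 shows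
      measurability.\<close>
    then have rs: "{r} \<in> sets N" using measure_notin_sets[of "{r}" N] by fastforce
    have "measure M (\<pi> -` {r} \<inter> space M) = measure (distr M N \<pi>) {r}"
      using rs by (intro measure_distr[symmetric]) auto
    also have "\<dots> = 1" using r by (simp add: fac.distr_\<pi>)
    finally have ae0: "AE x in M. x \<in> \<pi> -` {r} \<inter> space M" by (rule AE_prob_1)
    obtain n where n: "\<forall>x\<in>space M. z n (\<pi> x) = \<zeta> x" using z(3) by blast
    have ae: "AE x in M. \<zeta> x = z n r"
      using ae0
    proof eventually_elim
      case (elim x)
      then have "\<pi> x = r" "x \<in> space M" by auto
      then show ?case using n by metis
    qed
    have [measurable]: "\<zeta> \<in> borel_measurable M" "v \<in> borel_measurable M" using \<zeta> v by auto
    have "(\<integral>x. \<zeta> x \<partial>M) = (\<integral>x. z n r \<partial>M)" using ae by (intro integral_cong_AE) auto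
    then have "z n r = 0" using \<zeta>(2) by (simp add: prob_space)
    then have "l2ip M \<zeta> v = (\<integral>x. 0 \<partial>M)" unfolding l2ip_def using ae by (intro integral_cong_AE) auto
    then show False using \<zeta>(3) c by simp
  qed
  moreover have "factor_of G N actN M act"
    unfolding factor_of_def using fac.equivariant fac.distr_\<pi>
    by (intro bexI[of _ \<pi>] conjI ballI AE_I2) auto
  ultimately show False
    using cpe std fac.N.pmp unfolding completely_positive_entropy_def by (meson leD)
qed

end

section \<open>Mixing\<close>

context pmp_system
begin

definition centered :: "'a set \<Rightarrow> 'a \<Rightarrow> real" where
  "centered A = (\<lambda>x. indicator A x - measure M A)"

lemma centered_L2: "A \<in> sets M \<Longrightarrow> centered A \<in> L2 M"
proof (rule L2_bounded[of _ 1])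
  show "\<bar>centered A x\<bar> \<le> 1" for x
    using prob_le_1[of A] measure_nonneg[of M A] by (auto simp: centered_def indicator_def)
qed (simp add: centered_def)

lemma integral_centered: "A \<in> sets M \<Longrightarrow> (\<integral>x. centered A x \<partial>M) = 0"
  unfolding centered_def by (subst Bochner_Integration.integral_diff) (auto simp: prob_space Int_absorb2 sets.sets_into_space emeasure_eq_measure)

lemma act_image_sets: "g \<in> carrier G \<Longrightarrow> A \<in> sets M \<Longrightarrow> act g ` A \<in> sets M"
  using act_image_eq[of g A] sets.sets_into_space[of A M] measurable_sets[OF act_measurable[of "inv g"]] by simp

lemma measure_act_image: "g \<in> carrier G \<Longrightarrow> A \<in> sets M \<Longrightarrow> measure M (act g ` A) = measure M A"
  using act_image_eq[of g A] sets.sets_into_space[of A M] measure_distr[OF act_measurable[of "inv g"], of A]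
  by (simp add: distr_act)

lemma indicator_act_inv:
  assumes "g \<in> carrier G" "A \<in> sets M" "x \<in> space M"
  shows "indicator A (act (inv g) x) = (indicator (act g ` A) x :: real)"
  using act_image_eq[of g A] sets.sets_into_space[OF assms(2)] assms by (auto simp: indicator_def)

lemma ip_centered:
  assumes A: "A \<in> sets M" and B: "B \<in> sets M"
  shows "l2ip M (centered A) (centered B) = measure M (A \<inter> B) - measure M A * measure M B"
proof -
  let ?a = "measure M A" and ?b = "measure M B"
  have "l2ip M (centered A) (centered B) =
      (\<integral>x. indicator (A \<inter> B) x - ?b * indicator A x - ?a * indicator B x + ?a * ?b \<partial>M)"
    unfolding l2ip_def centered_def
    by (intro Bochner_Integration.integral_cong refl) (simp add: indicator_inter_arith algebra_simps)
  also have "\<dots> = measure M (A \<inter> B) - ?b * ?a - ?a * ?b + ?a * ?b"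
    using A B sets.sets_into_space[OF A] sets.sets_into_space[OF B]
    by (simp add: prob_space Int_absorb2 emeasure_eq_measure le_infI1)
  finally show ?thesis by (simp add: mult.commute)
qed

lemma koop_centered:
  "g \<in> carrier G \<Longrightarrow> A \<in> sets M \<Longrightarrow> x \<in> space M \<Longrightarrow> koop G act g (centered A) x = centered (act g ` A) x"
  by (simp add: koop_def centered_def indicator_act_inv measure_act_image)

lemma ip_koop_centered:
  assumes g: "g \<in> carrier G" and A: "A \<in> sets M" and B: "B \<in> sets M"
  shows "l2ip M (koop G act g (centered A)) (centered B) = measure M (act g ` A \<inter> B) - measure M A * measure M B"
proof -
  have "l2ip M (koop G act g (centered A)) (centered B) = l2ip M (centered (act g ` A)) (centered B)"
    using g A by (intro l2ip_cong) (auto simp: koop_centered)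
  then show ?thesis by (simp add: ip_centered act_image_sets measure_act_image g A B)
qed

definition uniform_on :: "'g set \<Rightarrow> 'g \<Rightarrow> real" where
  "uniform_on S = (\<lambda>g. if g \<in> S then 1 / card S else 0)"

lemma uniform_on:
  assumes S: "finite S" "S \<subseteq> carrier G" "S \<noteq> {}"
  shows "uniform_on S \<in> fin_supp G" and "(FS.nrm (uniform_on S))\<^sup>2 = 1 / card S"
    and "conv G act (uniform_on S) f = (\<Sum>g\<in>S. (1 / card S) *\<^sub>R koop G act g f)"
proof -
  have sub: "{g. uniform_on S g \<noteq> 0} \<subseteq> S" by (auto simp: uniform_on_def)
  then show mem: "uniform_on S \<in> fin_supp G" using S by (auto simp: fin_supp_def intro: finite_subset)
  have "(FS.nrm (uniform_on S))\<^sup>2 = (\<Sum>g\<in>S. (1 / card S)\<^sup>2)"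
    unfolding fsnrm_power2[OF mem S(1) sub] by (intro sum.cong) (auto simp: uniform_on_def)
  then show "(FS.nrm (uniform_on S))\<^sup>2 = 1 / card S" using S by (simp add: power2_eq_square)
  show "conv G act (uniform_on S) f = (\<Sum>g\<in>S. (1 / card S) *\<^sub>R koop G act g f)"
    unfolding conv_superset[OF S(1) sub] by (intro sum.cong) (auto simp: uniform_on_def)
qed

end

context sofic_system
begin

lemma mixing_if_cpe:
  assumes count: "countable (carrier G)" and cpe: "completely_positive_entropy G d \<sigma> M act"
  shows "mixing G M act"
proof (rule ccontr)
  assume "\<not> mixing G M act"
  then obtain A B where A: "A \<in> sets M" and B: "B \<in> sets M" and
    not: "\<not> ((\<lambda>g. measure M (act g ` A \<inter> B)) \<longlongrightarrow> measure M A * measure M B) (inf cofinite (principal (carrier G)))"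
    unfolding mixing_def by blast
  define c where "c g = l2ip M (koop G act g (centered A)) (centered B)" for g
  obtain e where e: "e > 0" and "\<not> (\<forall>\<^sub>F g in inf cofinite (principal (carrier G)).
      dist (measure M (act g ` A \<inter> B)) (measure M A * measure M B) < e)"
    using not unfolding tendsto_iff by blast
  then have "infinite {g. \<not> (g \<in> carrier G \<longrightarrow> dist (measure M (act g ` A \<inter> B)) (measure M A * measure M B) < e)}"
    unfolding eventually_inf_principal eventually_cofinite by simp
  also have "{g. \<not> (g \<in> carrier G \<longrightarrow> dist (measure M (act g ` A \<inter> B)) (measure M A * measure M B) < e)} =
      {g \<in> carrier G. e \<le> \<bar>c g\<bar>}"
    using A B by (auto simp: c_def dist_real_def ip_koop_centered not_less)
  \<comment> \<open>Averaging coefficients of both signs could cancel them; infinitely many have the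
    same sign \<open>s\<close>, which is then absorbed into the test vector.\<close>
  also have "\<dots> = {g \<in> carrier G. e \<le> 1 * c g} \<union> {g \<in> carrier G. e \<le> (-1) * c g}"
    by (auto simp: abs_if)
  finally have "infinite {g \<in> carrier G. e \<le> 1 * c g} \<or> infinite {g \<in> carrier G. e \<le> (-1) * c g}" by simp
  then obtain s where s: "infinite {g \<in> carrier G. e \<le> s * c g}" by blast
  let ?D = "{g \<in> carrier G. e \<le> s * c g}" and ?\<xi> = "centered A" and ?v = "s *\<^sub>R centered B"
  have \<xi>: "?\<xi> \<in> L2 M" by (rule centered_L2[OF A])
  have vB: "centered B \<in> L2 M" by (rule centered_L2[OF B])
  then have v: "?v \<in> L2 M" by (rule L2.scale_mem)
  show False
  proof (rule cpe_contradiction[OF count cpe \<xi> integral_centered[OF A] v e, of "L2.nrm M ?\<xi>"])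
    fix \<epsilon> :: real assume \<epsilon>: "\<epsilon> > 0"
    \<comment> \<open>The uniform distribution on \<open>n\<close> elements has 2-norm
      \<open>1 / sqrt n\<close>.\<close>
    obtain n :: nat where n: "1 / \<epsilon>\<^sup>2 < real n" using reals_Archimedean2 by blast
    have "1 / \<epsilon>\<^sup>2 > 0" using \<epsilon> by simp
    then have n0: "n > 0" using n by (metis less_trans of_nat_0_less_iff)
    obtain S where S: "S \<subseteq> ?D" "finite S" "card S = n" using infinite_arbitrarily_large[OF s] by blast
    have S': "S \<subseteq> carrier G" "S \<noteq> {}" using S n0 by auto
    let ?F = "uniform_on S"
    note F = uniform_on[OF S(2) S']
    have kL: "koop G act g ?\<xi> \<in> L2 M" if "g \<in> S" for g using that S' \<xi> by (intro koop_L2) auto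
    have "(FS.nrm ?F)\<^sup>2 \<le> \<epsilon>\<^sup>2"
      unfolding F(2) S(3) using n n0 \<epsilon> by (simp add: field_simps)
    then have "FS.nrm ?F \<le> \<epsilon>" by (rule power2_le_imp_le) (use \<epsilon> in simp)
    moreover have "L2.nrm M (conv G act ?F ?\<xi>) \<le> L2.nrm M ?\<xi>"
    proof -
      have "L2.nrm M (conv G act ?F ?\<xi>) \<le> (\<Sum>g\<in>S. L2.nrm M ((1 / card S) *\<^sub>R koop G act g ?\<xi>))"
        unfolding F(3) by (rule L2.nrm_sum_le) (intro L2.scale_mem kL)
      also have "\<dots> = (\<Sum>g\<in>S. (1 / n) * L2.nrm M ?\<xi>)"
        using S' \<xi> by (intro sum.cong refl) (simp add: L2.nrm_scale[OF kL] S(3) koop_nrm subset_eq)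
      also have "\<dots> = L2.nrm M ?\<xi>" using S(3) n0 by simp
      finally show ?thesis .
    qed
    moreover have "e \<le> l2ip M (conv G act ?F ?\<xi>) ?v"
    proof -
      have "e = (\<Sum>g\<in>S. (1 / n) * e)" using S(3) n0 by simp
      also have "\<dots> \<le> (\<Sum>g\<in>S. (1 / n) * (s * c g))" using S(1) by (intro sum_mono mult_left_mono) auto
      also have "\<dots> = (\<Sum>g\<in>S. l2ip M ((1 / card S) *\<^sub>R koop G act g ?\<xi>) ?v)"
        by (intro sum.cong refl) (simp add: L2.ip_scale_left[OF kL v] L2.ip_scale_right[OF vB kL] c_def S(3))
      also have "\<dots> = l2ip M (conv G act ?F ?\<xi>) ?v"
        unfolding F(3) by (rule L2.ip_sum_left[symmetric]) (auto intro: L2.scale_mem kL v)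
      finally show ?thesis .
    qed
    ultimately show "\<exists>F\<in>fin_supp G. FS.nrm F \<le> \<epsilon> \<and> L2.nrm M (conv G act F ?\<xi>) \<le> L2.nrm M ?\<xi> \<and>
        e \<le> l2ip M (conv G act F ?\<xi>) ?v"
      using F(1) by blast
  qed
qed

end

section \<open>Spectral gap implies strong ergodicity\<close>

context pmp_system
begin

text \<open>For the centered indicator of a set the squared displacement under \<open>g\<close> is
  the measure of the symmetric difference, and the squared norm is
  \<open>measure M A * (1 - measure M A)\<close>.\<close>

lemma strongly_ergodic_if_spectral_gap:
  assumes gap: "spectral_gap G M act"
  shows "strongly_ergodic G M act"
  unfolding strongly_ergodic_def
proof (intro allI impI)
  fix A :: "nat \<Rightarrow> 'a set"
  assume "\<forall>n. A n \<in> sets M"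
    and inv: "\<forall>g\<in>carrier G. (\<lambda>n. measure M (sym_diff (act g ` A n) (A n))) \<longlonglongrightarrow> 0"
  then have A: "A n \<in> sets M" for n by blast
  define \<xi> where "\<xi> n x = complex_of_real (centered (A n) x)" for n x
  have cL: "centered (A n) \<in> L2 M" for n by (rule centered_L2[OF A])
  have sq: "square_integrable M (\<xi> n)" for n
    using cL[of n] unfolding square_integrable_def \<xi>_def by (auto simp: L2_def)
  have int: "(\<integral>x. \<xi> n x \<partial>M) = 0" for n
    unfolding \<xi>_def by (simp add: integral_centered[OF A])
  have nrm: "l2_norm M (\<lambda>x. \<xi> n (act (inv g) x) - \<xi> n x) = sqrt (measure M (sym_diff (act g ` A n) (A n)))"
    if g: "g \<in> carrier G" for g n
  proof -
    have s: "sym_diff (act g ` A n) (A n) \<in> sets M" using act_image_sets[OF g A] A by auto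
    have "(\<integral>x. (norm (\<xi> n (act (inv g) x) - \<xi> n x))\<^sup>2 \<partial>M) = (\<integral>x. indicator (sym_diff (act g ` A n) (A n)) x \<partial>M)"
    proof (intro Bochner_Integration.integral_cong refl)
      fix x assume "x \<in> space M"
      then have "\<xi> n (act (inv g) x) - \<xi> n x = complex_of_real (indicator (act g ` A n) x - indicator (A n) x)"
        by (simp add: \<xi>_def centered_def indicator_act_inv[OF g A])
      then show "(norm (\<xi> n (act (inv g) x) - \<xi> n x))\<^sup>2 = indicator (sym_diff (act g ` A n) (A n)) x"
        by (simp only: norm_of_real) (auto simp: indicator_def)
    qed
    also have "\<dots> = measure M (sym_diff (act g ` A n) (A n))" using s by (simp add: Int_absorb2 sets.sets_into_space)
    finally show ?thesis by (simp add: l2_norm_def)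
  qed
  have "(\<lambda>n. l2_norm M (\<lambda>x. \<xi> n (act (inv g) x) - \<xi> n x)) \<longlonglongrightarrow> 0" if g: "g \<in> carrier G" for g
    unfolding nrm[OF g] using tendsto_real_sqrt[OF bspec[OF inv g]] by simp
  then have "(\<lambda>n. l2_norm M (\<xi> n)) \<longlonglongrightarrow> 0"
    using gap sq int unfolding spectral_gap_def by blast
  then have "(\<lambda>n. (l2_norm M (\<xi> n))\<^sup>2) \<longlonglongrightarrow> 0\<^sup>2" by (rule tendsto_power)
  moreover have "(l2_norm M (\<xi> n))\<^sup>2 = measure M (A n) * (1 - measure M (A n))" for n
  proof -
    have "(l2_norm M (\<xi> n))\<^sup>2 = l2ip M (centered (A n)) (centered (A n))"
      by (simp add: l2_norm_def \<xi>_def l2ip_def power2_eq_square[symmetric])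
    then show ?thesis by (simp add: ip_centered[OF A A] algebra_simps)
  qed
  ultimately show "(\<lambda>n. measure M (A n) * (1 - measure M (A n))) \<longlonglongrightarrow> 0" by simp
qed

end

section \<open>Amenability and averages in the regular representation\<close>

context group
begin

text \<open>Inverses make the averages self-adjoint. The identity is included so that the
  displacement by \<open>s\<close> can be read off by comparing the terms of \<open>s\<close> and
  \<open>\<one>\<close> in the average.\<close>

definition symmetric_set :: "'a set \<Rightarrow> bool" where
  "symmetric_set S \<longleftrightarrow> finite S \<and> S \<subseteq> carrier G \<and> \<one> \<in> S \<and> (\<forall>s\<in>S. inv s \<in> S)"

lemma sum_symmetric_set:
  assumes "symmetric_set S"
  shows "(\<Sum>s\<in>S. f (inv s)) = (\<Sum>s\<in>S. f s)"
  using assms unfolding symmetric_set_def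
  by (intro sum.reindex_bij_witness[of _ "\<lambda>s. inv s" "\<lambda>s. inv s"]) (auto simp: subset_eq)

definition avg :: "'a set \<Rightarrow> ('a \<Rightarrow> real) \<Rightarrow> 'a \<Rightarrow> real" where
  "avg S F = (1 / card S) *\<^sub>R (\<Sum>s\<in>S. ltrans G s F)"

lemma sum_ltrans_mem:
  "F \<in> fin_supp G \<Longrightarrow> S \<subseteq> carrier G \<Longrightarrow> (\<Sum>s\<in>S. ltrans G s F) \<in> fin_supp G"
  by (intro FS.sum_mem ltrans_mem) auto

text \<open>Translations are isometries, and the adjoint of the translation by \<open>s\<close> is
  the translation by its inverse, which again belongs to \<open>S\<close>.\<close>

lemma self_adjoint_contraction_avg:
  assumes S: "symmetric_set S"
  shows "self_adjoint_contraction (fin_supp G) fsip (avg S)"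
proof unfold_locales
  have fin: "finite S" and sub: "S \<subseteq> carrier G" and card: "card S > 0"
    using S unfolding symmetric_set_def by (auto simp: card_gt_0_iff)
  fix F F' :: "'a \<Rightarrow> real"
  assume F: "F \<in> fin_supp G"
  note sF = sum_ltrans_mem[OF F sub]
  have m: "ltrans G s F \<in> fin_supp G" if "s \<in> S" for s using that sub F by (auto intro: ltrans_mem)
  show "avg S F \<in> fin_supp G" unfolding avg_def by (rule FS.scale_mem[OF sF])
  show "FS.nrm (avg S F) \<le> FS.nrm F"
  proof -
    have "FS.nrm (avg S F) = (1 / card S) * FS.nrm (\<Sum>s\<in>S. ltrans G s F)"
      unfolding avg_def FS.nrm_scale[OF sF] by simp
    also have "\<dots> \<le> (1 / card S) * (\<Sum>s\<in>S. FS.nrm (ltrans G s F))"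
      by (intro mult_left_mono FS.nrm_sum_le[OF m]) auto
    also have "(\<Sum>s\<in>S. FS.nrm (ltrans G s F)) = (\<Sum>s\<in>S. FS.nrm F)"
      using sub F by (intro sum.cong refl fsnrm_ltrans) auto
    finally show ?thesis using card by simp
  qed
  assume F': "F' \<in> fin_supp G"
  have m': "ltrans G s F' \<in> fin_supp G" if "s \<in> S" for s using that sub F' by (auto intro: ltrans_mem)
  show "avg S (F - F') = avg S F - avg S F'"
    by (simp add: avg_def ltrans_diff sum_subtractf scaleR_diff_right)
  have "fsip (avg S F) F' = (1 / card S) * (\<Sum>s\<in>S. fsip (ltrans G s F) F')"
    unfolding avg_def FS.ip_scale_left[OF sF F'] by (subst FS.ip_sum_left[OF m F']) auto
  also have "(\<Sum>s\<in>S. fsip (ltrans G s F) F') = (\<Sum>s\<in>S. fsip F (ltrans G (inv s) F'))"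
    using sub by (intro sum.cong refl fsip_ltrans F F') auto
  also have "\<dots> = (\<Sum>s\<in>S. fsip F (ltrans G s F'))" by (rule sum_symmetric_set[OF S])
  also have "\<dots> = (\<Sum>s\<in>S. fsip (ltrans G s F') F)"
    using m' F by (intro sum.cong refl FS.ip_commute) auto
  also have "\<dots> = fsip (\<Sum>s\<in>S. ltrans G s F') F" by (rule FS.ip_sum_left[symmetric, OF m' F])
  also have "(1 / card S) * \<dots> = fsip (avg S F') F"
    unfolding avg_def FS.ip_scale_left[OF sum_ltrans_mem[OF F' sub] F] ..
  also have "\<dots> = fsip F (avg S F')"
    unfolding avg_def by (rule FS.ip_commute[OF FS.scale_mem[OF sum_ltrans_mem[OF F' sub]] F])
  finally show "fsip (avg S F) F' = fsip F (avg S F')" .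
qed

section \<open>Almost invariant unit vectors and the measures with density
  \<open>F^2\<close>\<close>

definition mass :: "('a \<Rightarrow> real) \<Rightarrow> 'a set \<Rightarrow> real" where
  "mass F A = (\<Sum>h | F h \<noteq> 0. (F h)\<^sup>2 * indicator A h)"

lemma mass_superset:
  assumes "finite E" "{h. F h \<noteq> 0} \<subseteq> E"
  shows "mass F A = (\<Sum>h\<in>E. (F h)\<^sup>2 * indicator A h)"
  unfolding mass_def using assms by (intro sum.mono_neutral_left) auto

lemma mass_carrier: "F \<in> fin_supp G \<Longrightarrow> mass F (carrier G) = (FS.nrm F)\<^sup>2"
  unfolding mass_def
  by (subst fsnrm_power2[of F G "{h. F h \<noteq> 0}"]) (auto simp: fin_supp_def indicator_def intro!: sum.cong)

lemma mass_l_coset: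
  assumes F: "F \<in> fin_supp G" and g: "g \<in> carrier G" and A: "A \<subseteq> carrier G"
  shows "mass F (g <# A) = mass (ltrans G (inv g) F) A"
proof -
  have Fc: "{h. F h \<noteq> 0} \<subseteq> carrier G" using F by (simp add: fin_supp_def)
  have "mass (ltrans G (inv g) F) A = (\<Sum>h\<in>(\<lambda>h. inv g \<otimes> h) ` {h. F h \<noteq> 0}. (ltrans G (inv g) F h)\<^sup>2 * indicator A h)"
    unfolding mass_def using g by (subst ltrans_supp[OF F]) auto
  also have "\<dots> = (\<Sum>h | F h \<noteq> 0. (ltrans G (inv g) F (inv g \<otimes> h))\<^sup>2 * indicator A (inv g \<otimes> h))"
    using inj_on_subset[OF inj_on_cmult Fc, of "inv g"] g by (subst sum.reindex) auto
  also have "\<dots> = (\<Sum>h | F h \<noteq> 0. (F h)\<^sup>2 * indicator (g <# A) h)"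
  proof (rule sum.cong[OF refl])
    fix h assume "h \<in> {h. F h \<noteq> 0}"
    then have h: "h \<in> carrier G" using Fc by blast
    then have "ltrans G (inv g) F (inv g \<otimes> h) = F h"
      using g by (simp add: ltrans_def m_assoc[symmetric])
    moreover have "inv g \<otimes> h \<in> A \<longleftrightarrow> h \<in> g <# A"
    proof
      assume "inv g \<otimes> h \<in> A"
      moreover have "h = g \<otimes> (inv g \<otimes> h)" using g h by (simp add: m_assoc[symmetric])
      ultimately show "h \<in> g <# A" unfolding l_coset_def by blast
    next
      assume "h \<in> g <# A"
      then obtain a where a: "a \<in> A" "h = g \<otimes> a" unfolding l_coset_def by blast
      then have "inv g \<otimes> h = a" using g A by (simp add: m_assoc[symmetric] subset_eq)
      then show "inv g \<otimes> h \<in> A" using a by simp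
    qed
    ultimately show "(ltrans G (inv g) F (inv g \<otimes> h))\<^sup>2 * indicator A (inv g \<otimes> h) = (F h)\<^sup>2 * indicator (g <# A) h"
      by (simp add: indicator_def)
  qed
  finally show ?thesis by (simp add: mass_def)
qed

text \<open>Cauchy-Schwarz for the factorization of the difference of squares as
  \<open>(F - F') * (F + F')\<close>. The bound is uniform in \<open>A\<close>.\<close>

lemma mass_diff_le:
  assumes F: "F \<in> fin_supp G" and F': "F' \<in> fin_supp G"
  shows "\<bar>mass F A - mass F' A\<bar> \<le> FS.nrm (F - F') * FS.nrm (F + F')"
proof -
  define E where "E = {h. F h \<noteq> 0} \<union> {h. F' h \<noteq> 0}"
  define u where "u h = indicator A h * (F - F') h" for h
  have E: "finite E" "{h. F h \<noteq> 0} \<subseteq> E" "{h. F' h \<noteq> 0} \<subseteq> E" "E \<subseteq> carrier G"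
    using F F' by (auto simp: E_def fin_supp_def)
  have uE: "{h. u h \<noteq> 0} \<subseteq> E" and dE: "{h. (F - F') h \<noteq> 0} \<subseteq> E" by (auto simp: u_def E_def)
  have u: "u \<in> fin_supp G"
    unfolding fin_supp_def using finite_subset[OF uE E(1)] uE E(4) by blast
  have d: "F - F' \<in> fin_supp G" and s: "F + F' \<in> fin_supp G"
    by (rule FS.diff_mem[OF F F'], rule FS.add_mem[OF F F'])
  have "mass F A - mass F' A = fsip u (F + F')"
    unfolding mass_superset[OF E(1,2)] mass_superset[OF E(1,3)] fsip_superset[OF E(1) uE] sum_subtractf[symmetric]
    by (intro sum.cong refl) (simp add: u_def power2_eq_square algebra_simps)
  then have "\<bar>mass F A - mass F' A\<bar> \<le> FS.nrm u * FS.nrm (F + F')"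
    using FS.Cauchy_Schwarz[OF u s] by simp
  also have "\<dots> \<le> FS.nrm (F - F') * FS.nrm (F + F')"
  proof (rule mult_right_mono)
    have "(FS.nrm u)\<^sup>2 \<le> (FS.nrm (F - F'))\<^sup>2"
      unfolding fsnrm_power2[OF u E(1) uE] fsnrm_power2[OF d E(1) dE]
      by (intro sum_mono) (auto simp: u_def indicator_def)
    then show "FS.nrm u \<le> FS.nrm (F - F')" by (rule power2_le_imp_le) (rule FS.nrm_nonneg[OF d])
  qed (rule FS.nrm_nonneg[OF s])
  finally show ?thesis .
qed

text \<open>An average of unit vectors can have norm near 1 only if they are nearly parallel. Of the
  \<open>card S\<close> terms all but those of \<open>\<one>\<close> and \<open>g\<close> contribute
  at most \<open>card S - 2\<close>, so the sum of these two has norm at least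
  \<open>2 - card S * \<eta>\<close>, and the parallelogram law bounds their difference.\<close>

lemma almost_invariant_if_avg_large:
  fixes \<eta> :: real
  assumes S: "symmetric_set S" and F: "F \<in> fin_supp G" "FS.nrm F = 1"
    and large: "1 - \<eta> \<le> FS.nrm (avg S F)" "card S * \<eta> \<le> 1" "0 \<le> \<eta>" and g: "g \<in> S"
  shows "(FS.nrm (ltrans G g F - F))\<^sup>2 \<le> 4 * card S * \<eta>"
proof (cases "g = \<one>")
  case True
  then show ?thesis using ltrans_one[OF F(1)] large(3) by simp
next
  case False
  have fin: "finite S" and sub: "S \<subseteq> carrier G" and one: "\<one> \<in> S"
    using S unfolding symmetric_set_def by auto
  have gc: "g \<in> carrier G" using g sub by blast
  let ?u = "ltrans G g F" and ?k = "real (card S)"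
  have u: "?u \<in> fin_supp G" "FS.nrm ?u = 1" using ltrans_mem[OF F(1) gc] fsnrm_ltrans[OF F(1) gc] F(2) by auto
  have k: "?k > 0" using fin one by (auto simp: card_gt_0_iff)
  let ?R = "S - {\<one>, g}"
  have R: "real (card ?R) = ?k - 2"
  proof -
    have "card ?R + card {\<one>, g} = card S"
      using fin one g by (metis card_Diff_subset card_mono empty_subsetI finite.emptyI finite.insertI insert_subset le_add_diff_inverse2)
    then show ?thesis using False by simp
  qed
  have sumS: "(\<Sum>s\<in>S. ltrans G s F) = (?u + F) + (\<Sum>s\<in>?R. ltrans G s F)"
  proof -
    have "(\<Sum>s\<in>S. ltrans G s F) = (\<Sum>s\<in>{\<one>, g}. ltrans G s F) + (\<Sum>s\<in>?R. ltrans G s F)"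
      using fin one g by (subst sum.subset_diff[of "{\<one>, g}" S]) (auto simp: add.commute)
    also have "(\<Sum>s\<in>{\<one>, g}. ltrans G s F) = ?u + F" using False ltrans_one[OF F(1)] by (simp add: add.commute)
    finally show ?thesis .
  qed
  have Rm: "(\<Sum>s\<in>?R. ltrans G s F) \<in> fin_supp G" using sub by (intro sum_ltrans_mem F) auto
  have uF: "?u + F \<in> fin_supp G" by (rule FS.add_mem[OF u(1) F(1)])
  define N where "N = FS.nrm (?u + F)"
  have "FS.nrm (avg S F) = (1 / ?k) * FS.nrm (\<Sum>s\<in>S. ltrans G s F)"
    unfolding avg_def FS.nrm_scale[OF sum_ltrans_mem[OF F(1) sub]] by simp
  then have "?k * FS.nrm (avg S F) = FS.nrm (\<Sum>s\<in>S. ltrans G s F)" using k by simp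
  moreover have "?k * (1 - \<eta>) \<le> ?k * FS.nrm (avg S F)" using large(1) k by (intro mult_left_mono) auto
  ultimately have "?k * (1 - \<eta>) \<le> FS.nrm (\<Sum>s\<in>S. ltrans G s F)" by simp
  moreover have "FS.nrm (\<Sum>s\<in>S. ltrans G s F) \<le> N + FS.nrm (\<Sum>s\<in>?R. ltrans G s F)"
    unfolding sumS N_def by (rule FS.nrm_triangle[OF uF Rm])
  moreover have "FS.nrm (\<Sum>s\<in>?R. ltrans G s F) \<le> ?k - 2"
  proof -
    have "FS.nrm (\<Sum>s\<in>?R. ltrans G s F) \<le> (\<Sum>s\<in>?R. FS.nrm (ltrans G s F))"
      by (rule FS.nrm_sum_le[of _ _ G]) (use sub F in \<open>auto intro: ltrans_mem\<close>)
    also have "\<dots> = (\<Sum>s\<in>?R. 1)" using sub F fsnrm_ltrans[OF F(1)] by (intro sum.cong) auto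
    also have "\<dots> = ?k - 2" using R by simp
    finally show ?thesis .
  qed
  ultimately have "?k * (1 - \<eta>) \<le> N + (?k - 2)" by linarith
  then have low: "2 - ?k * \<eta> \<le> N" unfolding right_diff_distrib by linarith
  have "(2 - ?k * \<eta>)\<^sup>2 = 4 - 4 * (?k * \<eta>) + (?k * \<eta>)\<^sup>2"
    by (simp add: power2_eq_square algebra_simps)
  then have "4 - 4 * (?k * \<eta>) \<le> (2 - ?k * \<eta>)\<^sup>2" using zero_le_power2[of "?k * \<eta>"] by linarith
  also have "\<dots> \<le> N\<^sup>2" using low large(2) by (intro power_mono) auto
  also have "\<dots> = 2 + 2 * fsip ?u F" unfolding N_def FS.nrm_add_power2[OF u(1) F(1)] u(2) F(2) by simp
  finally have "- (2 * fsip ?u F) \<le> 4 * (?k * \<eta>) - 2" by simp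
  moreover have "(FS.nrm (?u - F))\<^sup>2 = 2 - 2 * fsip ?u F"
    unfolding FS.nrm_diff_power2[OF u(1) F(1)] u(2) F(2) by simp
  ultimately show ?thesis by simp
qed

lemma exists_almost_invariant_mass:
  assumes no_gap: "\<And>S \<rho>. symmetric_set S \<Longrightarrow> 0 \<le> \<rho> \<Longrightarrow> \<rho> < 1 \<Longrightarrow>
      \<exists>F\<in>fin_supp G. FS.nrm (avg S F) > \<rho> * FS.nrm F"
    and K: "finite K" "K \<subseteq> carrier G" and e: "e > 0"
  shows "\<exists>F\<in>fin_supp G. FS.nrm F = 1 \<and> (\<forall>g\<in>K. \<forall>A\<subseteq>carrier G. \<bar>mass F (g <# A) - mass F A\<bar> \<le> e)"
proof -
  define S where "S = insert \<one> (K \<union> (\<lambda>g. inv g) ` K)"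
  have S: "symmetric_set S" using K unfolding symmetric_set_def S_def by (auto simp: subset_eq)
  then have k: "real (card S) \<ge> 1"
    unfolding symmetric_set_def by (metis One_nat_def Suc_leI card_gt_0_iff empty_iff of_nat_1 of_nat_le_iff)
  \<comment> \<open>Divided by \<open>card S\<close> to match the loss in the preceding lemma. The
    resulting displacement \<open>e / 2\<close> meets the factor 2, the bound for the norm of the
    sum in \<open>mass_diff_le\<close>.\<close>
  define \<eta> where "\<eta> = min 1 ((e / 2)\<^sup>2 / 4) / card S"
  have \<eta>: "0 < \<eta>" "card S * \<eta> \<le> 1" "4 * card S * \<eta> \<le> (e / 2)\<^sup>2"
  proof -
    have eq: "card S * \<eta> = min 1 ((e / 2)\<^sup>2 / 4)" using k by (simp add: \<eta>_def)
    show "0 < \<eta>" using k e by (simp add: \<eta>_def)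
    show "card S * \<eta> \<le> 1" unfolding eq by simp
    have "4 * card S * \<eta> = 4 * min 1 ((e / 2)\<^sup>2 / 4)" unfolding eq[symmetric] by simp
    also have "\<dots> \<le> 4 * ((e / 2)\<^sup>2 / 4)" by (intro mult_left_mono min.cobounded2) simp
    finally show "4 * card S * \<eta> \<le> (e / 2)\<^sup>2" by simp
  qed
  have "\<eta> \<le> card S * \<eta>" using k \<eta>(1) by simp
  then have "\<eta> \<le> 1" using \<eta>(2) by linarith
  then obtain F0 where F0: "F0 \<in> fin_supp G" "FS.nrm (avg S F0) > (1 - \<eta>) * FS.nrm F0"
    using no_gap[OF S, of "1 - \<eta>"] \<eta>(1) by auto
  interpret A: self_adjoint_contraction "fin_supp G" fsip "avg S" by (rule self_adjoint_contraction_avg[OF S])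
  have pos: "FS.nrm F0 > 0"
  proof (rule ccontr)
    assume "\<not> FS.nrm F0 > 0"
    then have "FS.nrm F0 = 0" using FS.nrm_nonneg[OF F0(1)] by simp
    then show False using F0(2) A.A_contraction[OF F0(1)] by simp
  qed
  define F where "F = (1 / FS.nrm F0) *\<^sub>R F0"
  have F: "F \<in> fin_supp G" unfolding F_def by (rule FS.scale_mem[OF F0(1)])
  have F1: "FS.nrm F = 1" unfolding F_def FS.nrm_scale[OF F0(1)] using pos by simp
  have "avg S F = (1 / FS.nrm F0) *\<^sub>R avg S F0"
    unfolding F_def avg_def by (simp add: ltrans_scale scaleR_sum_right[symmetric] mult.commute)
  then have "FS.nrm (avg S F) = FS.nrm (avg S F0) / FS.nrm F0"
    using FS.nrm_scale[OF A.A_mem[OF F0(1)], of "1 / FS.nrm F0"] pos by simp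
  then have large: "1 - \<eta> \<le> FS.nrm (avg S F)" using F0(2) pos by (simp add: pos_le_divide_eq)
  have "\<bar>mass F (g <# A) - mass F A\<bar> \<le> e" if g: "g \<in> K" and A: "A \<subseteq> carrier G" for g A
  proof -
    have gc: "g \<in> carrier G" "inv g \<in> carrier G" "inv g \<in> S" using g K by (auto simp: S_def)
    let ?u = "ltrans G (inv g) F"
    have u: "?u \<in> fin_supp G" by (rule ltrans_mem[OF F gc(2)])
    have "(FS.nrm (?u - F))\<^sup>2 \<le> 4 * card S * \<eta>"
      using \<eta>(1) by (intro almost_invariant_if_avg_large[OF S F F1 large \<eta>(2) _ gc(3)]) simp
    then have "(FS.nrm (?u - F))\<^sup>2 \<le> (e / 2)\<^sup>2" using \<eta>(3) by linarith
    then have le: "FS.nrm (?u - F) \<le> e / 2" by (rule power2_le_imp_le) (use e in simp)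
    have "FS.nrm (?u + F) \<le> FS.nrm ?u + FS.nrm F" by (rule FS.nrm_triangle[OF u F])
    then have le2: "FS.nrm (?u + F) \<le> 2" using fsnrm_ltrans[OF F gc(2)] F1 by simp
    have "\<bar>mass F (g <# A) - mass F A\<bar> \<le> FS.nrm (?u - F) * FS.nrm (?u + F)"
      unfolding mass_l_coset[OF F gc(1) A] by (rule mass_diff_le[OF u F])
    also have "\<dots> \<le> e / 2 * 2"
      using le le2 e FS.nrm_nonneg[OF FS.add_mem[OF u F]] by (intro mult_mono) auto
    finally show ?thesis by simp
  qed
  then show ?thesis using F F1 by blast
qed

text \<open>
  Day's argument: the absolute squares of almost invariant unit vectors are almost invariant
  probability measures, and Tychonoff compactness gives an invariant mean.
\<close>

lemma spectral_radius_lt_1_if_not_amenable: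
  assumes na: "\<not> amenable G"
  obtains S \<rho> where "symmetric_set S" "0 \<le> \<rho>" "\<rho> < 1"
    "\<And>F. F \<in> fin_supp G \<Longrightarrow> FS.nrm (avg S F) \<le> \<rho> * FS.nrm F"
proof (rule ccontr)
  note witness = that
  assume *: "\<not> thesis"
  have no_gap: "\<exists>F\<in>fin_supp G. FS.nrm (avg S F) > \<rho> * FS.nrm F"
    if S: "symmetric_set S" "0 \<le> \<rho>" "\<rho> < 1" for S \<rho>
  proof (rule ccontr)
    assume "\<not> ?thesis"
    then have "FS.nrm (avg S F) \<le> \<rho> * FS.nrm F" if "F \<in> fin_supp G" for F using that by (meson not_le)
    then show False using witness[OF S] * by blast
  qed
  \<comment> \<open>A cube in a product of lines, compact by Tychonoff. Total mass and additivity
    are exact closed conditions, collected in \<open>C\<close>; invariance is imposed through the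
    approximate conditions \<open>f\<close>, and any finitely many of these can be met
    together.\<close>
  define K0 :: "('a set \<Rightarrow> real) set" where "K0 = PiE UNIV (\<lambda>_. {0..1})"
  have "compactin (product_topology (\<lambda>_. euclidean) UNIV) K0"
    unfolding K0_def compactin_PiE by simp
  then have "compact K0" by (simp add: euclidean_product_topology)
  define C where "C = {m :: 'a set \<Rightarrow> real. m (carrier G) = 1} \<inter>
      (\<Inter>(A, B)\<in>{(A, B). A \<subseteq> carrier G \<and> B \<subseteq> carrier G \<and> A \<inter> B = {}}. {m. m (A \<union> B) = m A + m B})"
  have ev: "continuous_on UNIV (\<lambda>m :: 'a set \<Rightarrow> real. m A)" for A by (rule continuous_on_product_coordinates)
  have "closed C"
    unfolding C_def
  proof (intro closed_Int closed_INT ballI)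
    show "closed {m :: 'a set \<Rightarrow> real. m (carrier G) = 1}"
      by (intro closed_Collect_eq continuous_intros ev)
    fix p :: "'a set \<times> 'a set"
    show "closed (case p of (A, B) \<Rightarrow> {m :: 'a set \<Rightarrow> real. m (A \<union> B) = m A + m B})"
      by (cases p) (auto intro!: closed_Collect_eq continuous_on_add ev)
  qed
  define f where "f p = {m :: 'a set \<Rightarrow> real. \<forall>A\<in>Pow (carrier G). \<bar>m (fst p <# A) - m A\<bar> \<le> 1 / Suc (snd p)}" for p
  have "K0 \<inter> C \<inter> (\<Inter>p\<in>carrier G \<times> UNIV. f p) \<noteq> {}"
  proof (rule compact_imp_fip_image)
    show "compact (K0 \<inter> C)" by (rule compact_Int_closed[OF \<open>compact K0\<close> \<open>closed C\<close>])
    show "closed (f p)" for p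
    proof -
      have "f p = (\<Inter>A\<in>Pow (carrier G). {m. \<bar>m (fst p <# A) - m A\<bar> \<le> 1 / Suc (snd p)})"
        unfolding f_def by blast
      also have "closed \<dots>"
        by (intro closed_INT ballI closed_Collect_le continuous_on_rabs continuous_on_diff ev continuous_on_const)
      finally show ?thesis .
    qed
    fix I' :: "('a \<times> nat) set" assume I': "finite I'" "I' \<subseteq> carrier G \<times> UNIV"
    \<comment> \<open>Finitely many conditions involve finitely many group elements and a highest
      precision.\<close>
    define n0 where "n0 = Max (insert 0 (snd ` I'))"
    have n0: "snd p \<le> n0" if "p \<in> I'" for p unfolding n0_def using that I'(1) by (intro Max_ge) auto
    have "\<exists>F\<in>fin_supp G. FS.nrm F = 1 \<and> (\<forall>g\<in>fst ` I'. \<forall>A\<subseteq>carrier G. \<bar>mass F (g <# A) - mass F A\<bar> \<le> 1 / Suc n0)"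
      using I' by (intro exists_almost_invariant_mass no_gap) auto
    then obtain F where F: "F \<in> fin_supp G" "FS.nrm F = 1"
      "\<And>g A. g \<in> fst ` I' \<Longrightarrow> A \<subseteq> carrier G \<Longrightarrow> \<bar>mass F (g <# A) - mass F A\<bar> \<le> 1 / Suc n0" by blast
    have nonneg: "0 \<le> mass F A" for A unfolding mass_def by (intro sum_nonneg) (auto simp: indicator_def)
    have total: "mass F (carrier G) = 1" using mass_carrier[OF F(1)] F(2) by simp
    have "mass F A \<le> mass F (carrier G)" for A
      unfolding mass_def using F(1) by (intro sum_mono) (auto simp: indicator_def fin_supp_def)
    then have "mass F \<in> K0" unfolding K0_def using nonneg total by (auto simp: PiE_def)
    moreover have "mass F \<in> C"
      unfolding C_def
    proof (intro IntI INT_I)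
      show "mass F \<in> {m. m (carrier G) = 1}" using total by simp
      fix p :: "'a set \<times> 'a set"
      assume "p \<in> {(A, B). A \<subseteq> carrier G \<and> B \<subseteq> carrier G \<and> A \<inter> B = {}}"
      then obtain A B where p: "p = (A, B)" "A \<inter> B = {}" by blast
      have "mass F (A \<union> B) = mass F A + mass F B"
        unfolding mass_def sum.distrib[symmetric] using p(2)
        by (intro sum.cong refl) (auto simp: indicator_def)
      then show "mass F \<in> (case p of (A, B) \<Rightarrow> {m. m (A \<union> B) = m A + m B})" by (simp add: p(1))
    qed
    moreover have "mass F \<in> (\<Inter>p\<in>I'. f p)"
    proof
      fix p assume p: "p \<in> I'"
      have le: "1 / real (Suc n0) \<le> 1 / real (Suc (snd p))" using n0[OF p] by (intro frac_le) auto
      show "mass F \<in> f p"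
        unfolding f_def
      proof (intro CollectI ballI)
        fix A assume "A \<in> Pow (carrier G)"
        then have "\<bar>mass F (fst p <# A) - mass F A\<bar> \<le> 1 / real (Suc n0)" using p by (intro F(3)) auto
        then show "\<bar>mass F (fst p <# A) - mass F A\<bar> \<le> 1 / real (Suc (snd p))" using le by (rule order_trans)
      qed
    qed
    ultimately show "K0 \<inter> C \<inter> (\<Inter>p\<in>I'. f p) \<noteq> {}" by blast
  qed
  then obtain m where m: "m \<in> K0" "m \<in> C" "\<And>p. p \<in> carrier G \<times> UNIV \<Longrightarrow> m \<in> f p" by blast
  have inv: "m (g <# A) = m A" if "g \<in> carrier G" "A \<subseteq> carrier G" for g A
  proof -
    have "\<bar>m (g <# A) - m A\<bar> \<le> inverse (real (Suc n))" for n
      using m(3)[of "(g, n)"] that by (auto simp: f_def inverse_eq_divide)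
    then have "\<bar>m (g <# A) - m A\<bar> \<le> 0" by (intro LIMSEQ_le_const[OF LIMSEQ_inverse_real_of_nat]) auto
    then show ?thesis by simp
  qed
  have "amenable G"
    unfolding amenable_def
  proof (intro exI[of _ m] conjI allI impI ballI)
    show "m (carrier G) = 1" using m(2) by (simp add: C_def)
    show "0 \<le> m A" for A using m(1) by (auto simp: K0_def PiE_def Pi_def)
    show "m (A \<union> B) = m A + m B" if "A \<subseteq> carrier G" "B \<subseteq> carrier G" "A \<inter> B = {}" for A B
      using m(2) that unfolding C_def by blast
    show "m (g <# A) = m A" if "g \<in> carrier G" "A \<subseteq> carrier G" for g A by (rule inv[OF that])
  qed
  then show False using na by blast
qed

end

section \<open>Spectral gap\<close>

text \<open>With \<open>q = p ^ (2 * n)\<close>, an integer \<open>k\<close> between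
  \<open>4 / q\<close> and \<open>6 / q\<close> satisfies the first condition, and
  \<open>k * \<rho> ^ (2 * n)\<close> is at most six times a power of the square of
  \<open>\<rho> / p\<close>, which is less than 1.\<close>

lemma exists_cut_parameters:
  fixes \<rho> p e :: real
  assumes "0 \<le> \<rho>" "\<rho> < p" "p \<le> 1" "e > 0"
  obtains n k :: nat where "4 < real k * p ^ (2 * n)" "real k * \<rho> ^ (2 * n) \<le> e"
proof -
  have p: "p > 0" using assms by linarith
  have "(\<rho> / p)\<^sup>2 < 1" using assms p by (simp add: power_less_one_iff abs_square_less_1)
  then obtain n where n: "((\<rho> / p)\<^sup>2) ^ n < e / 6" using real_arch_pow_inv[of "e / 6" "(\<rho> / p)\<^sup>2"] assms(4) by auto
  let ?q = "p ^ (2 * n)"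
  have q: "0 < ?q" "?q \<le> 1" using p assms(3) by (auto simp: power_le_one)
  define k where "k = nat \<lceil>4 / ?q\<rceil> + 1"
  have "4 / ?q > 0" using q by simp
  then have k1: "4 / ?q < real k" and k2: "real k \<le> 4 / ?q + 2" unfolding k_def by linarith+
  show ?thesis
  proof (rule that[of k n])
    show "4 < real k * ?q" using k1 q by (simp add: pos_divide_less_eq)
    have "1 \<le> 1 / ?q" using q by simp
    then have "real k \<le> 4 / ?q + 2 * (1 / ?q)" using k2 by linarith
    then have "real k \<le> 6 / ?q" by (simp add: add_divide_distrib[symmetric])
    then have "real k * \<rho> ^ (2 * n) \<le> 6 / ?q * \<rho> ^ (2 * n)" using assms(1) by (intro mult_right_mono) auto
    also have "\<dots> = 6 * ((\<rho> / p)\<^sup>2) ^ n" by (simp add: power_mult[symmetric] power_divide)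
    also have "\<dots> \<le> e" using n by simp
    finally show "real k * \<rho> ^ (2 * n) \<le> e" .
  qed
qed

context pmp_system
begin

definition kavg :: "'g set \<Rightarrow> ('a \<Rightarrow> real) \<Rightarrow> 'a \<Rightarrow> real" where
  "kavg S f = (1 / card S) *\<^sub>R (\<Sum>s\<in>S. koop G act s f)"

lemma self_adjoint_contraction_kavg:
  assumes S: "symmetric_set S"
  shows "self_adjoint_contraction (L2 M) (l2ip M) (kavg S)"
proof unfold_locales
  have fin: "finite S" and sub: "S \<subseteq> carrier G" and card: "card S > 0"
    using S unfolding symmetric_set_def by (auto simp: card_gt_0_iff)
  fix f f' :: "'a \<Rightarrow> real"
  assume f: "f \<in> L2 M"
  have m: "koop G act s f \<in> L2 M" if "s \<in> S" for s using that sub f by (auto intro: koop_L2)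
  have sf: "(\<Sum>s\<in>S. koop G act s f) \<in> L2 M" by (rule L2.sum_mem[OF m])
  show "kavg S f \<in> L2 M" unfolding kavg_def by (rule L2.scale_mem[OF sf])
  show "L2.nrm M (kavg S f) \<le> L2.nrm M f"
  proof -
    have "L2.nrm M (kavg S f) = (1 / card S) * L2.nrm M (\<Sum>s\<in>S. koop G act s f)"
      unfolding kavg_def L2.nrm_scale[OF sf] by simp
    also have "\<dots> \<le> (1 / card S) * (\<Sum>s\<in>S. L2.nrm M (koop G act s f))"
      by (intro mult_left_mono L2.nrm_sum_le[OF m]) auto
    also have "(\<Sum>s\<in>S. L2.nrm M (koop G act s f)) = (\<Sum>s\<in>S. L2.nrm M f)"
      using sub f by (intro sum.cong refl koop_nrm) auto
    finally show ?thesis using card by simp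
  qed
  assume f': "f' \<in> L2 M"
  have m': "koop G act s f' \<in> L2 M" if "s \<in> S" for s using that sub f' by (auto intro: koop_L2)
  have sf': "(\<Sum>s\<in>S. koop G act s f') \<in> L2 M" by (rule L2.sum_mem[OF m'])
  show "kavg S (f - f') = kavg S f - kavg S f'"
    by (simp add: kavg_def koop_diff sum_subtractf scaleR_diff_right)
  have "l2ip M (kavg S f) f' = (1 / card S) * (\<Sum>s\<in>S. l2ip M (koop G act s f) f')"
    unfolding kavg_def L2.ip_scale_left[OF sf f'] by (subst L2.ip_sum_left[OF m f']) auto
  also have "(\<Sum>s\<in>S. l2ip M (koop G act s f) f') = (\<Sum>s\<in>S. l2ip M f (koop G act (inv s) f'))"
    using sub by (intro sum.cong refl koop_adjoint f f') auto
  also have "\<dots> = (\<Sum>s\<in>S. l2ip M f (koop G act s f'))" by (rule sum_symmetric_set[OF S])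
  also have "\<dots> = (\<Sum>s\<in>S. l2ip M (koop G act s f') f)"
    using m' f by (intro sum.cong refl L2.ip_commute) auto
  also have "\<dots> = l2ip M (\<Sum>s\<in>S. koop G act s f') f" by (rule L2.ip_sum_left[symmetric, OF m' f])
  also have "(1 / card S) * \<dots> = l2ip M (kavg S f') f"
    unfolding kavg_def L2.ip_scale_left[OF sf' f] ..
  also have "\<dots> = l2ip M f (kavg S f')"
    unfolding kavg_def by (rule L2.ip_commute[OF L2.scale_mem[OF sf'] f])
  finally show "l2ip M (kavg S f) f' = l2ip M f (kavg S f')" .
qed

text \<open>Identities that use the action law hold only on \<open>space M\<close>, so equality
  there has to be carried through the averages.\<close>

lemma kavg_cong:
  assumes "S \<subseteq> carrier G" "\<And>x. x \<in> space M \<Longrightarrow> f x = f' x" "x \<in> space M"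
  shows "kavg S f x = kavg S f' x"
  using assms by (auto simp: kavg_def sum_fun_apply koop_def subset_eq)

lemma kavg_power_cong:
  assumes "S \<subseteq> carrier G" "\<And>x. x \<in> space M \<Longrightarrow> f x = f' x" "x \<in> space M"
  shows "(kavg S ^^ n) f x = (kavg S ^^ n) f' x"
  using assms(3)
proof (induction n arbitrary: x)
  case (Suc n)
  then show ?case by (simp add: kavg_cong[OF assms(1) Suc.IH])
qed (simp add: assms(2))

text \<open>Applying group ring elements to a fixed function intertwines the averages on the group
  ring with those on functions; hence also all polynomials in them.\<close>

lemma conv_avg:
  assumes S: "finite S" "S \<subseteq> carrier G" and F: "F \<in> fin_supp G" and x: "x \<in> space M"
  shows "conv G act (avg S F) f x = kavg S (conv G act F f) x"
proof -
  have m: "ltrans G s F \<in> fin_supp G" if "s \<in> S" for s using that S F by (auto intro: ltrans_mem)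
  have eq: "conv G act (\<Sum>s\<in>S. ltrans G s F) f = (\<Sum>s\<in>S. conv G act (ltrans G s F) f)"
    by (rule conv_sum_left[OF m])
  show ?thesis
    unfolding avg_def conv_scale_left eq
    using S F x by (auto simp: kavg_def sum_fun_apply conv_ltrans subset_eq)
qed

text \<open>One polynomial is evaluated in two representations: on the group ring the average has
  norm at most \<open>\<rho>\<close>, which makes the coefficients small, while on
  \<open>L2 M\<close> the average almost fixes \<open>\<xi>\<close>.\<close>

lemma gap_elements:
  assumes S: "symmetric_set S" and \<rho>: "0 \<le> \<rho>" "\<rho> < 1"
    and gap: "\<And>F. F \<in> fin_supp G \<Longrightarrow> FS.nrm (avg S F) \<le> \<rho> * FS.nrm F"
    and \<xi>: "\<xi> \<in> L2 M" "L2.nrm M \<xi> = 1"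
    and inv: "\<And>g. g \<in> S \<Longrightarrow> L2.nrm M (koop G act g \<xi> - \<xi>) \<le> (1 - \<rho>) / 4" and e: "e > 0"
  shows "\<exists>F\<in>fin_supp G. FS.nrm F \<le> e \<and> L2.nrm M (conv G act F \<xi>) \<le> 2 \<and> 1 / 2 \<le> l2ip M (conv G act F \<xi>) \<xi>"
proof -
  have fin: "finite S" and sub: "S \<subseteq> carrier G" and card: "card S > 0"
    using S unfolding symmetric_set_def by (auto simp: card_gt_0_iff)
  interpret A: self_adjoint_contraction "fin_supp G" fsip "avg S" by (rule self_adjoint_contraction_avg[OF S])
  interpret B: self_adjoint_contraction "L2 M" "l2ip M" "kavg S" by (rule self_adjoint_contraction_kavg[OF S])
  \<comment> \<open>The unit of the group ring: applying a polynomial in \<open>avg S\<close> to it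
    gives the group ring element of that polynomial.\<close>
  define \<delta> where "\<delta> g = (if g = \<one> then 1 else 0 :: real)" for g
  have supp: "{g. \<delta> g \<noteq> 0} = {\<one>}" by (auto simp: \<delta>_def)
  then have \<delta>: "\<delta> \<in> fin_supp G" by (simp add: fin_supp_def)
  have "(FS.nrm \<delta>)\<^sup>2 = 1" using fsnrm_power2[OF \<delta>, of "{\<one>}"] by (simp add: \<delta>_def)
  then have \<delta>1: "FS.nrm \<delta> = 1" using FS.nrm_nonneg[OF \<delta>] by (simp add: power2_eq_1_iff)
  have conv_\<delta>: "conv G act \<delta> \<xi> x = \<xi> x" if "x \<in> space M" for x
    using that unfolding conv_def supp by (simp add: \<delta>_def koop_def)
  have pow: "conv G act ((avg S ^^ n) F) f x = (kavg S ^^ n) (conv G act F f) x"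
    if F: "F \<in> fin_supp G" and "x \<in> space M" for n F f x
    using that(2)
  proof (induction n arbitrary: x)
    case (Suc n)
    have "conv G act ((avg S ^^ Suc n) F) f x = kavg S (conv G act ((avg S ^^ n) F) f) x"
      using conv_avg[OF fin sub A.power_mem[OF F]] Suc.prems by simp
    also have "\<dots> = kavg S ((kavg S ^^ n) (conv G act F f)) x"
      by (rule kavg_cong[OF sub Suc.IH Suc.prems])
    finally show ?case by simp
  qed simp
  have cut: "conv G act (A.cut n F) f x = B.cut n (conv G act F f) x"
    if F: "F \<in> fin_supp G" and x: "x \<in> space M" for n F f x
  proof -
    have "conv G act (A.cut n F) f x = conv G act F f x - conv G act ((avg S ^^ n) ((avg S ^^ n) F)) f x"
      unfolding A.cut_def conv_diff_left[OF F A.power_mem[OF A.power_mem[OF F]]] by simp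
    also have "conv G act ((avg S ^^ n) ((avg S ^^ n) F)) f x = (kavg S ^^ n) (conv G act ((avg S ^^ n) F) f) x"
      by (rule pow[OF A.power_mem[OF F] x])
    also have "\<dots> = (kavg S ^^ n) ((kavg S ^^ n) (conv G act F f)) x"
      by (rule kavg_power_cong[OF sub pow[OF F] x])
    finally show ?thesis by (simp add: B.cut_def)
  qed
  have cut_cong: "B.cut n f x = B.cut n f' x"
    if eq: "\<And>x. x \<in> space M \<Longrightarrow> f x = f' x" and x: "x \<in> space M" for n f f' x
  proof -
    have "(kavg S ^^ n) ((kavg S ^^ n) f) x = (kavg S ^^ n) ((kavg S ^^ n) f') x"
      by (rule kavg_power_cong[OF sub kavg_power_cong[OF sub eq] x])
    then show ?thesis using eq[OF x] by (simp add: B.cut_def)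
  qed
  have cut_pow: "conv G act ((A.cut n ^^ k) \<delta>) \<xi> x = (B.cut n ^^ k) \<xi> x" if "x \<in> space M" for n k x
    using that
  proof (induction k arbitrary: x)
    case (Suc k)
    have "conv G act ((A.cut n ^^ Suc k) \<delta>) \<xi> x = B.cut n (conv G act ((A.cut n ^^ k) \<delta>) \<xi>) x"
      using cut[OF A.cut_power_mem[OF \<delta>] Suc.prems] by simp
    also have "\<dots> = B.cut n ((B.cut n ^^ k) \<xi>) x"
      by (rule cut_cong[OF Suc.IH Suc.prems])
    finally show ?case by simp
  qed (simp add: conv_\<delta>)
  \<comment> \<open>Then \<open>1 - 2 * \<tau> = (1 + \<rho>) / 2\<close> lies strictly between
    \<open>\<rho>\<close> and 1, as the choice of \<open>n\<close> and \<open>k\<close>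
    demands.\<close>
  define \<tau> where "\<tau> = (1 - \<rho>) / 4"
  have \<tau>: "\<tau> < 1 / 2" "\<rho> < 1 - 2 * \<tau>" "1 - 2 * \<tau> \<le> 1" using \<rho> by (auto simp: \<tau>_def field_simps)
  obtain n k :: nat where nk: "4 < real k * (1 - 2 * \<tau>) ^ (2 * n)" "real k * \<rho> ^ (2 * n) \<le> e"
    by (rule exists_cut_parameters[OF \<rho>(1) \<tau>(2,3) e]) (rule that)
  have near: "L2.nrm M (\<xi> - kavg S \<xi>) \<le> \<tau>"
  proof -
    have m: "\<xi> - koop G act s \<xi> \<in> L2 M" if "s \<in> S" for s
      using that sub \<xi>(1) by (intro L2.diff_mem koop_L2) auto
    have "\<xi> - kavg S \<xi> = (1 / card S) *\<^sub>R (\<Sum>s\<in>S. \<xi> - koop G act s \<xi>)"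
      by (rule ext) (use card in \<open>simp add: kavg_def sum_fun_apply sum_subtractf field_simps\<close>)
    then have "L2.nrm M (\<xi> - kavg S \<xi>) = (1 / card S) * L2.nrm M (\<Sum>s\<in>S. \<xi> - koop G act s \<xi>)"
      using L2.nrm_scale[OF L2.sum_mem[OF m], of S "\<lambda>s. s" "1 / card S"] by simp
    also have "\<dots> \<le> (1 / card S) * (\<Sum>s\<in>S. L2.nrm M (\<xi> - koop G act s \<xi>))"
      by (intro mult_left_mono L2.nrm_sum_le[OF m]) auto
    also have "\<dots> \<le> (1 / card S) * (\<Sum>s\<in>S. \<tau>)"
    proof (intro mult_left_mono sum_mono)
      fix s assume s: "s \<in> S"
      then have "koop G act s \<xi> \<in> L2 M" using sub \<xi>(1) by (intro koop_L2) auto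
      then show "L2.nrm M (\<xi> - koop G act s \<xi>) \<le> \<tau>"
        using inv[OF s] L2.nrm_minus_commute[OF \<xi>(1)] by (simp add: \<tau>_def)
    qed simp
    finally show ?thesis using card by simp
  qed
  let ?v = "(B.cut n ^^ k) \<xi>" and ?F = "\<delta> - (A.cut n ^^ k) \<delta>"
  have vL: "?v \<in> L2 M" by (rule B.cut_power_mem[OF \<xi>(1)])
  have v: "L2.nrm M ?v \<le> 1 / 2" by (rule B.nrm_cut_power_le_half[OF \<xi> near \<tau>(1) nk(1)])
  have F: "?F \<in> fin_supp G" by (rule FS.diff_mem[OF \<delta> A.cut_power_mem[OF \<delta>]])
  have "FS.nrm ?F \<le> k * \<rho> ^ (2 * n) * FS.nrm \<delta>" by (rule A.nrm_diff_cut_power[OF \<delta> \<rho>(1) gap])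
  then have F_small: "FS.nrm ?F \<le> e" using nk(2) \<delta>1 by simp
  have mem: "(A.cut n ^^ k) \<delta> \<in> fin_supp G" by (rule A.cut_power_mem[OF \<delta>])
  have eq: "conv G act ?F \<xi> x = (\<xi> - ?v) x" if "x \<in> space M" for x
    using conv_diff_left[OF \<delta> mem, of act \<xi>] conv_\<delta>[OF that] cut_pow[OF that] by simp
  have "L2.nrm M (conv G act ?F \<xi>) = L2.nrm M (\<xi> - ?v)" by (rule L2_nrm_cong[OF eq])
  also have "\<dots> \<le> L2.nrm M \<xi> + L2.nrm M ?v" by (rule L2.nrm_triangle_diff[OF \<xi>(1) vL])
  also have "\<dots> \<le> 2" using \<xi>(2) v by simp
  finally have "L2.nrm M (conv G act ?F \<xi>) \<le> 2" .
  moreover have "1 / 2 \<le> l2ip M (conv G act ?F \<xi>) \<xi>"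
  proof -
    have "l2ip M (conv G act ?F \<xi>) \<xi> = l2ip M (\<xi> - ?v) \<xi>" by (rule l2ip_cong[OF eq refl])
    also have "\<dots> = (L2.nrm M \<xi>)\<^sup>2 - l2ip M ?v \<xi>"
      unfolding L2.ip_diff_left[OF \<xi>(1) vL \<xi>(1)] L2.nrm_power2[OF \<xi>(1)] ..
    finally show ?thesis using L2.Cauchy_Schwarz[OF vL \<xi>(1)] v unfolding \<xi>(2) by simp
  qed
  ultimately show ?thesis using F F_small by blast
qed

section \<open>Real almost invariant vectors when there is no spectral gap\<close>

lemma square_integrable_part:
  fixes T :: "complex \<Rightarrow> real"
  assumes T: "bounded_linear T" "\<And>z. \<bar>T z\<bar> \<le> norm z" and f: "square_integrable M f"
  shows "(\<lambda>x. T (f x)) \<in> L2 M" and "L2.nrm M (\<lambda>x. T (f x)) \<le> l2_norm M f"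
    and "(\<integral>x. T (f x) \<partial>M) = T (\<integral>x. f x \<partial>M)"
proof -
  have [measurable]: "f \<in> borel_measurable M" and int: "integrable M (\<lambda>x. (norm (f x))\<^sup>2)"
    using f by (auto simp: square_integrable_def)
  have Tm: "T \<in> borel_measurable borel"
    by (intro borel_measurable_continuous_onI linear_continuous_on T(1))
  then have [measurable]: "(\<lambda>x. T (f x)) \<in> borel_measurable M" by measurable
  have le: "(T (f x))\<^sup>2 \<le> (norm (f x))\<^sup>2" for x
    using T(2)[of "f x"] by (metis abs_ge_zero power2_abs power_mono)
  have int': "integrable M (\<lambda>x. (T (f x))\<^sup>2)"
    using le by (intro Bochner_Integration.integrable_bound[OF int]) auto
  then show "(\<lambda>x. T (f x)) \<in> L2 M" by (simp add: L2_def)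
  have "(\<integral>x. (T (f x))\<^sup>2 \<partial>M) \<le> (\<integral>x. (norm (f x))\<^sup>2 \<partial>M)"
    using le by (intro integral_mono int int')
  then show "L2.nrm M (\<lambda>x. T (f x)) \<le> l2_norm M f"
    by (simp add: L2.nrm_def l2ip_def l2_norm_def power2_eq_square[symmetric])
  have "integrable M f"
  proof (rule Bochner_Integration.integrable_bound)
    show "integrable M (\<lambda>x. 1 + (norm (f x))\<^sup>2)" using int by simp
    have "norm (f x) \<le> 1 + (norm (f x))\<^sup>2" for x
    proof -
      have "2 * norm (f x) \<le> 1 + (norm (f x))\<^sup>2" using sum_squares_bound[of 1 "norm (f x)"] by simp
      then show ?thesis using norm_ge_zero[of "f x"] by linarith
    qed
    then show "AE x in M. norm (f x) \<le> norm (1 + (norm (f x))\<^sup>2)" by (intro AE_I2) simp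
  qed measurable
  then show "(\<integral>x. T (f x) \<partial>M) = T (\<integral>x. f x \<partial>M)" by (rule integral_bounded_linear[OF T(1)])
qed

text \<open>A sequence violating the gap has norms at least some \<open>c\<close> infinitely often,
  while its displacements tend to zero. The real or the imaginary part of such a vector has norm at
  least \<open>c / 2\<close>, since otherwise the squares would add up to less than
  \<open>c\<^sup>2\<close>; it is moved no more than the vector itself and can be
  normalized.\<close>

lemma almost_invariant_vector:
  assumes no_gap: "\<not> spectral_gap G M act" and S: "finite S" "S \<subseteq> carrier G" and e: "e > 0"
  obtains \<xi> where "\<xi> \<in> L2 M" "(\<integral>x. \<xi> x \<partial>M) = 0" "L2.nrm M \<xi> = 1"
    "\<And>g. g \<in> S \<Longrightarrow> L2.nrm M (koop G act g \<xi> - \<xi>) \<le> e"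
proof -
  obtain \<xi> :: "nat \<Rightarrow> 'a \<Rightarrow> complex" where \<xi>: "\<And>n. square_integrable M (\<xi> n)" "\<And>n. (\<integral>x. \<xi> n x \<partial>M) = 0"
    and inv: "\<And>g. g \<in> carrier G \<Longrightarrow> (\<lambda>n. l2_norm M (\<lambda>x. \<xi> n (act (inv g) x) - \<xi> n x)) \<longlonglongrightarrow> 0"
    and not: "\<not> (\<lambda>n. l2_norm M (\<xi> n)) \<longlonglongrightarrow> 0"
    using no_gap unfolding spectral_gap_def by blast
  have nn: "0 \<le> l2_norm M f" for f by (simp add: l2_norm_def)
  obtain c where c: "c > 0" "\<And>N. \<exists>n\<ge>N. c \<le> l2_norm M (\<xi> n)"
    using not nn unfolding lim_sequentially dist_real_def by (auto simp: not_less)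
  \<comment> \<open>The factor \<open>c / 2\<close> anticipates the division by a norm of at least
    \<open>c / 2\<close>.\<close>
  have "\<forall>\<^sub>F n in sequentially. \<forall>g\<in>S. l2_norm M (\<lambda>x. \<xi> n (act (inv g) x) - \<xi> n x) < e * (c / 2)"
    unfolding eventually_ball_finite_distrib[OF S(1)]
    using S(2) e c(1) by (intro ballI order_tendstoD(2)[OF inv]) auto
  then obtain N where N: "\<And>n g. n \<ge> N \<Longrightarrow> g \<in> S \<Longrightarrow> l2_norm M (\<lambda>x. \<xi> n (act (inv g) x) - \<xi> n x) < e * (c / 2)"
    unfolding eventually_sequentially by blast
  obtain n where n: "n \<ge> N" "c \<le> l2_norm M (\<xi> n)" using c(2) by blast
  have part: "\<exists>T. bounded_linear T \<and> (\<forall>z. \<bar>T z\<bar> \<le> norm z) \<and> c / 2 \<le> L2.nrm M (\<lambda>x. T (\<xi> n x))"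
  proof (rule ccontr)
    assume *: "\<not> ?thesis"
    have Re: "L2.nrm M (\<lambda>x. Re (\<xi> n x)) < c / 2"
      using * bounded_linear_Re abs_Re_le_cmod by (meson not_le)
    have Im: "L2.nrm M (\<lambda>x. Im (\<xi> n x)) < c / 2"
      using * bounded_linear_Im abs_Im_le_cmod by (meson not_le)
    have ReL: "(\<lambda>x. Re (\<xi> n x)) \<in> L2 M" and ImL: "(\<lambda>x. Im (\<xi> n x)) \<in> L2 M"
      using square_integrable_part(1)[OF bounded_linear_Re _ \<xi>(1)] square_integrable_part(1)[OF bounded_linear_Im _ \<xi>(1)]
        abs_Re_le_cmod abs_Im_le_cmod by blast+
    have "c\<^sup>2 \<le> (l2_norm M (\<xi> n))\<^sup>2" using n(2) c(1) by (intro power_mono) auto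
    also have "\<dots> = (\<integral>x. (Re (\<xi> n x))\<^sup>2 + (Im (\<xi> n x))\<^sup>2 \<partial>M)" by (simp add: l2_norm_def cmod_power2)
    also have "\<dots> = (L2.nrm M (\<lambda>x. Re (\<xi> n x)))\<^sup>2 + (L2.nrm M (\<lambda>x. Im (\<xi> n x)))\<^sup>2"
      unfolding L2_nrm_power2 by (intro Bochner_Integration.integral_add L2_integrable_power2 ReL ImL)
    also have "\<dots> \<le> (c / 2)\<^sup>2 + (c / 2)\<^sup>2"
      using Re Im L2.nrm_nonneg[OF ReL] L2.nrm_nonneg[OF ImL] by (intro add_mono power_mono) auto
    also have "\<dots> < c\<^sup>2" using c(1) by (simp add: power_divide)
    finally show False by simp
  qed
  then obtain T where T: "bounded_linear T" "\<And>z. \<bar>T z\<bar> \<le> norm z" "c / 2 \<le> L2.nrm M (\<lambda>x. T (\<xi> n x))" by blast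
  define h where "h x = T (\<xi> n x)" for x
  have h: "h \<in> L2 M" "(\<integral>x. h x \<partial>M) = 0" "c / 2 \<le> L2.nrm M h"
    using square_integrable_part(1,3)[OF T(1,2) \<xi>(1)[of n]] T(3) \<xi>(2)[of n] bounded_linear.linear[OF T(1)] linear_0
    unfolding h_def by auto
  have pos: "L2.nrm M h > 0" using h(3) c(1) by linarith
  have diff: "L2.nrm M (koop G act g h - h) \<le> e * (c / 2)" if g: "g \<in> S" for g
  proof -
    have gc: "inv g \<in> carrier G" using g S by auto
    have [measurable]: "\<xi> n \<in> borel_measurable M" and int: "integrable M (\<lambda>x. (norm (\<xi> n x))\<^sup>2)"
      using \<xi>(1)[of n] by (auto simp: square_integrable_def)
    have int2: "integrable M (\<lambda>x. (norm (\<xi> n (act (inv g) x)))\<^sup>2)" by (rule integrable_act[OF gc int])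
    have meas: "(\<lambda>x. \<xi> n (act (inv g) x)) \<in> borel_measurable M"
      by (rule measurable_compose[OF act_measurable[OF gc]]) measurable
    have "square_integrable M (\<lambda>x. \<xi> n (act (inv g) x) - \<xi> n x)"
      unfolding square_integrable_def
    proof
      show m: "(\<lambda>x. \<xi> n (act (inv g) x) - \<xi> n x) \<in> borel_measurable M"
        by (intro borel_measurable_diff meas) measurable
      show "integrable M (\<lambda>x. (norm (\<xi> n (act (inv g) x) - \<xi> n x))\<^sup>2)"
      proof (rule Bochner_Integration.integrable_bound)
        show "integrable M (\<lambda>x. 2 * (norm (\<xi> n (act (inv g) x)))\<^sup>2 + 2 * (norm (\<xi> n x))\<^sup>2)"
          using int int2 by auto
        have le: "(norm (a - b))\<^sup>2 \<le> 2 * (norm a)\<^sup>2 + 2 * (norm b)\<^sup>2" for a b :: complex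
        proof -
          have "(norm (a - b))\<^sup>2 \<le> (norm a + norm b)\<^sup>2" by (intro power_mono norm_triangle_ineq4) simp
          also have "\<dots> \<le> 2 * (norm a)\<^sup>2 + 2 * (norm b)\<^sup>2"
            using sum_squares_bound[of "norm a" "norm b"] by (simp add: power2_sum)
          finally show ?thesis .
        qed
        show "AE x in M. norm ((norm (\<xi> n (act (inv g) x) - \<xi> n x))\<^sup>2) \<le>
            norm (2 * (norm (\<xi> n (act (inv g) x)))\<^sup>2 + 2 * (norm (\<xi> n x))\<^sup>2)"
          using le by (intro AE_I2) simp
      qed (use m in measurable)
    qed
    then have "L2.nrm M (\<lambda>x. T (\<xi> n (act (inv g) x) - \<xi> n x)) \<le> l2_norm M (\<lambda>x. \<xi> n (act (inv g) x) - \<xi> n x)"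
      by (rule square_integrable_part(2)[OF T(1,2)])
    also have "\<dots> \<le> e * (c / 2)" using N[OF n(1) g] by simp
    also have "(\<lambda>x. T (\<xi> n (act (inv g) x) - \<xi> n x)) = koop G act g h - h"
      by (rule ext) (simp add: koop_def h_def linear_diff[OF bounded_linear.linear[OF T(1)]])
    finally show ?thesis .
  qed
  let ?\<xi> = "(1 / L2.nrm M h) *\<^sub>R h"
  show ?thesis
  proof (rule that[of ?\<xi>])
    show "?\<xi> \<in> L2 M" by (rule L2.scale_mem[OF h(1)])
    show "(\<integral>x. ?\<xi> x \<partial>M) = 0" using h(2) by simp
    show "L2.nrm M ?\<xi> = 1" unfolding L2.nrm_scale[OF h(1)] using pos by simp
    fix g assume g: "g \<in> S"
    have kL: "koop G act g h - h \<in> L2 M" using g S h(1) by (intro L2.diff_mem koop_L2) auto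
    have "L2.nrm M (koop G act g ?\<xi> - ?\<xi>) = (1 / L2.nrm M h) * L2.nrm M (koop G act g h - h)"
      unfolding koop_scale scaleR_diff_right[symmetric] L2.nrm_scale[OF kL] using pos by simp
    also have "\<dots> \<le> (1 / L2.nrm M h) * (e * L2.nrm M h)"
    proof (rule mult_left_mono)
      have "e * (c / 2) \<le> e * L2.nrm M h" using h(3) e by (intro mult_left_mono) auto
      then show "L2.nrm M (koop G act g h - h) \<le> e * L2.nrm M h" using diff[OF g] by linarith
    qed (use pos in simp)
    finally show "L2.nrm M (koop G act g ?\<xi> - ?\<xi>) \<le> e" using pos by simp
  qed
qed

end

context sofic_system
begin

text \<open>Group ring elements of the subgroup are group ring elements of \<open>G\<close> with the
  same 2-norm and the same effect on functions. So the vectors and averages come from the subgroup,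
  while the contradiction is with the entropy of the action of \<open>G\<close>. The almost
  invariant vector serves as its own test vector.\<close>

lemma spectral_gap_if_cpe:
  assumes count: "countable (carrier G)" and cpe: "completely_positive_entropy G d \<sigma> M act"
    and H: "subgroup H G" and na: "\<not> amenable (G\<lparr>carrier := H\<rparr>)"
  shows "spectral_gap (G\<lparr>carrier := H\<rparr>) M act \<and> strongly_ergodic (G\<lparr>carrier := H\<rparr>) M act"
proof -
  let ?L = "G\<lparr>carrier := H\<rparr>"
  have Hsub: "H \<subseteq> carrier G" using H by (rule subgroup.subset)
  have grp: "group ?L" by (rule subgroup_imp_group[OF H])
  have "pmp_action ?L M act"
    using group_action.induced_action[OF group_action H] pmp Hsub by (auto simp: pmp_action_def)
  then interpret L: pmp_system ?L M act
    using grp by (intro pmp_system.intro pmp_system_axioms.intro)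
  have supp: "F \<in> fin_supp G" if "F \<in> fin_supp ?L" for F
    using that Hsub by (auto simp: fin_supp_def)
  have conv_eq: "conv ?L act F f = conv G act F f" if "F \<in> fin_supp ?L" for F f
    unfolding conv_def using that H
    by (intro sum.cong refl) (auto simp: fin_supp_def koop_def subset_eq)
  have gap: "spectral_gap ?L M act"
  proof (rule ccontr)
    assume no: "\<not> spectral_gap ?L M act"
    obtain S \<rho> where S: "L.symmetric_set S" and \<rho>: "0 \<le> \<rho>" "\<rho> < 1"
      and avg: "\<And>F. F \<in> fin_supp ?L \<Longrightarrow> FS.nrm (L.avg S F) \<le> \<rho> * FS.nrm F"
      by (rule L.spectral_radius_lt_1_if_not_amenable[OF na]) (rule that)
    have finS: "finite S" "S \<subseteq> carrier ?L" using S unfolding L.symmetric_set_def by auto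
    have "(1 - \<rho>) / 4 > 0" using \<rho> by simp
    then obtain \<xi> where \<xi>: "\<xi> \<in> L2 M" "(\<integral>x. \<xi> x \<partial>M) = 0" "L2.nrm M \<xi> = 1"
      and inv: "\<And>g. g \<in> S \<Longrightarrow> L2.nrm M (koop ?L act g \<xi> - \<xi>) \<le> (1 - \<rho>) / 4"
      by (rule L.almost_invariant_vector[OF no finS]) (rule that)
    have "\<exists>F\<in>fin_supp G. FS.nrm F \<le> e \<and> L2.nrm M (conv G act F \<xi>) \<le> 2 \<and> 1 / 2 \<le> l2ip M (conv G act F \<xi>) \<xi>"
      if e: "e > 0" for e
    proof -
      have "\<exists>F\<in>fin_supp ?L. FS.nrm F \<le> e \<and> L2.nrm M (conv ?L act F \<xi>) \<le> 2 \<and> 1 / 2 \<le> l2ip M (conv ?L act F \<xi>) \<xi>"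
        by (rule L.gap_elements[OF S \<rho> avg \<xi>(1,3) inv e])
      then show ?thesis using supp conv_eq by metis
    qed
    then show False by (rule cpe_contradiction[OF count cpe \<xi>(1,2) \<xi>(1), of "1 / 2" 2, rotated]) simp_all
  qed
  then show ?thesis using L.strongly_ergodic_if_spectral_gap by blast
qed

end

theorem corollary1p3:
  fixes G :: "('g, 'z) monoid_scheme"
    and d :: "nat \<Rightarrow> nat"
    and \<sigma> :: "nat \<Rightarrow> 'g \<Rightarrow> nat \<Rightarrow> nat"
    and M :: "'a measure"
    and act :: "'g \<Rightarrow> 'a \<Rightarrow> 'a"
  assumes "group G"
    and "countable (carrier G)"
    and "sofic_approximation G d \<sigma>"
    and "standard_prob_space M"
    and "pmp_action G M act"
    and "completely_positive_entropy G d \<sigma> M act"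
  shows "(infinite (carrier G) \<longrightarrow> mixing G M act) \<and>
         (\<forall>H. subgroup H G \<longrightarrow> \<not> amenable (G\<lparr>carrier := H\<rparr>) \<longrightarrow>
            strongly_ergodic (G\<lparr>carrier := H\<rparr>) M act \<and>
            spectral_gap (G\<lparr>carrier := H\<rparr>) M act)"
proof -
  interpret sofic_system G M act d \<sigma>
    using assms(1,3,5)
    by (intro sofic_system.intro sofic_system_axioms.intro pmp_system.intro pmp_system_axioms.intro)
  show ?thesis
    using mixing_if_cpe[OF assms(2,6)] spectral_gap_if_cpe[OF assms(2,6)] by blast
qed

end
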